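(* Let $n\geqslant4$ and $2\leqslant k\leqslant n-2$, and let $M$ be a Griffiths positive Hermitian $k\times k$ matrix of constant $(1,1)$-forms on $\mathbb{C}^n$ satisfying the simultaneous diagonalizability (SD) condition. If $n-k=2$ or $n-k=3$, then $\det M$ is Hodge--Riemann for $(p,q)$ (with respect to any Kähler reference form $\omega$) for every pair of nonnegative integers $p,q$ with $p+q=n-k$.
   Context: Let $V=\mathbb{C}^n$, and let $V^{p,q}=\Lambda^pV^*\otimes\Lambda^q\overline{V^*}$ be the space of constant-coefficient $(p,q)$-forms. For $\Omega\in V^{k,k}$ and nonnegative integers $p,q$ with $p+q=n-k$, the Lefschetz map is $L_\Omega^{p,q}\colon V^{p,q}\to V^{n-q,n-p}$, $\alpha\mapsto\alpha\wedge\Omega$. A Hermitian $k\times k$ matrix of constant $(1,1)$-forms is $M=(\alpha_{ab})_{a,b=1}^k$ with $\alpha_{ba}=\overline{\alpha_{ab}}$. Since $(1,1)$-forms commute under the wedge product, $\det M$ is defined by the usual permutation formula; it is a real $(k,k)$-form. A real constant $(1,1)$-form is Kähler (positive) if its associated Hermitian form is positive definite, i.e. it equals $\frac{\sqrt{-1}}{2}\sum_j dw_j\wedge d\bar w_j$ in some complex linear coordinates. $M$ is Griffiths positive if $\sum_{a,b}\theta_a\overline{\theta_b}\,\alpha_{ab}$ is Kähler for every $0\ne\theta\in\mathbb{C}^k$. $M$ satisfies the SD condition if there are complex linear coordinates $z_1,\dots,z_n$ on $\mathbb{C}^n$ such that $M=\sum_{j=1}^nB_jV_j$, where $V_j=\frac{\sqrt{-1}}{2}dz_j\wedge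 d\bar z_j$ and each $B_j=B_j^*$ is a constant Hermitian $k\times k$ matrix (the $B_j$ need not commute). Fix a Kähler reference form $\omega$. A real $(k,k)$-form $\Omega$ is Lefschetz for $(p,q)$ (where $p+q=n-k$) if $L_\Omega^{p,q}$ is an isomorphism. It is Hodge--Riemann for $(p,q)$ (with respect to $\omega$) if there is a continuous path of real $(k,k)$-forms $\Omega_t$, $0\leqslant t\leqslant1$, with $\Omega_0=\Omega$, $\Omega_1=\omega^k$, such that $\Omega_t\wedge\omega^{2r}$ is Lefschetz for $(p-r,q-r)$ for every integer $0\leqslant r\leqslant\min\{p,q\}$ and every $t\in[0,1]$. *)

theory Defs
  imports
    "Jordan_Normal_Form.Schur_Decomposition"
    "HOL-Combinatorics.Permutations"
begin

section \<open>Constant-coefficient forms\<close>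

text \<open>
  The exterior algebra of constant-coefficient complex forms is represented by coefficients in the
  standard basis: \<open>\<alpha> I J\<close> is the coefficient of \<open>dz\<^sub>I \<and> d\<bar>z\<^sub>J\<close>, where for a finite set
  \<open>I = {i\<^sub>1 < \<dots> < i\<^sub>p}\<close> one puts \<open>dz\<^sub>I = dz\<^sub>i\<^sub>1 \<and> \<dots> \<and> dz\<^sub>i\<^sub>p\<close>. The coordinates of
  \<open>\<complex>\<^sup>n\<close> are indexed by \<open>0, \<dots>, n - 1\<close>.
\<close>

type_synonym form = "nat set \<Rightarrow> nat set \<Rightarrow> complex"

definition forms :: "nat \<Rightarrow> nat \<Rightarrow> nat \<Rightarrow> form set" where
  "forms n p q = {\<alpha>. \<forall>I J. \<alpha> I J \<noteq> 0 \<longrightarrow>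
     I \<subseteq> {..<n} \<and> J \<subseteq> {..<n} \<and> card I = p \<and> card J = q}"

text \<open>
  For disjoint \<open>I\<close> and \<open>J\<close>, \<open>dz\<^sub>I \<and> dz\<^sub>J = shuffle_sign I J \<cdot> dz\<^bsub>I \<union> J\<^esub>\<close>: the exponent counts
  the inversions. In \<open>wedge\<close> the factor \<open>(-1) ^ (card L * card (I - K))\<close> comes from moving
  \<open>d\<bar>z\<^sub>L\<close> past \<open>dz\<^bsub>I - K\<^esub>\<close>.
\<close>

definition shuffle_sign :: "nat set \<Rightarrow> nat set \<Rightarrow> complex" where
  "shuffle_sign I J = (-1) ^ card {(i, j). i \<in> I \<and> j \<in> J \<and> j < i}"

definition wedge :: "form \<Rightarrow> form \<Rightarrow> form" where
  "wedge \<alpha> \<beta> = (\<lambda>I J. \<Sum>K\<in>Pow I. \<Sum>L\<in>Pow J.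
     (-1) ^ (card L * card (I - K)) * shuffle_sign K (I - K) * shuffle_sign L (J - L)
       * \<alpha> K L * \<beta> (I - K) (J - L))"

definition unit_form :: form where
  "unit_form = (\<lambda>I J. if I = {} \<and> J = {} then 1 else 0)"

definition wedge_list :: "form list \<Rightarrow> form" where
  "wedge_list \<alpha>s = foldr wedge \<alpha>s unit_form"

definition wedge_power :: "form \<Rightarrow> nat \<Rightarrow> form" where
  "wedge_power \<alpha> r = wedge_list (replicate r \<alpha>)"

text \<open>
  The sign in the conjugate comes from \<open>d\<bar>z\<^sub>J \<and> dz\<^sub>I = (-1)\<^bsup>|I| |J|\<^esup> dz\<^sub>I \<and> d\<bar>z\<^sub>J\<close>.
\<close>

definition conj_form :: "form \<Rightarrow> form" where
  "conj_form \<alpha> = (\<lambda>I J. (-1) ^ (card I * card J) * cnj (\<alpha> J I))"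

definition real_form :: "nat \<Rightarrow> nat \<Rightarrow> form \<Rightarrow> bool" where
  "real_form n k \<alpha> \<longleftrightarrow> \<alpha> \<in> forms n k k \<and> conj_form \<alpha> = \<alpha>"


section \<open>Positivity\<close>

text \<open>
  A real \<open>(1,1)\<close>-form \<open>\<alpha> = (\<i>/2) \<Sum> h\<^sub>i\<^sub>j dz\<^sub>i \<and> d\<bar>z\<^sub>j\<close> has associated Hermitian form
  \<open>v \<mapsto> \<Sum> h\<^sub>i\<^sub>j v\<^sub>i \<bar>v\<^sub>j\<close>.
\<close>

definition assoc_hermitian :: "nat \<Rightarrow> form \<Rightarrow> complex vec \<Rightarrow> complex" where
  "assoc_hermitian n \<alpha> v =
     (\<Sum>i<n. \<Sum>j<n. (2 / \<i>) * \<alpha> {i} {j} * (v $ i) * cnj (v $ j))"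

definition kahler :: "nat \<Rightarrow> form \<Rightarrow> bool" where
  "kahler n \<alpha> \<longleftrightarrow> real_form n 1 \<alpha> \<and>
     (\<forall>v\<in>carrier_vec n. v \<noteq> 0\<^sub>v n \<longrightarrow> 0 < Re (assoc_hermitian n \<alpha> v))"


section \<open>Hermitian matrices of (1,1)-forms\<close>

definition hermitian_form_matrix :: "nat \<Rightarrow> nat \<Rightarrow> form mat \<Rightarrow> bool" where
  "hermitian_form_matrix n k M \<longleftrightarrow> M \<in> carrier_mat k k \<and>
     (\<forall>a<k. \<forall>b<k. M $$ (a, b) \<in> forms n 1 1 \<and> M $$ (b, a) = conj_form (M $$ (a, b)))"

text \<open>
  Forms of bidegree \<open>(1,1)\<close> commute, so the order of the factors in each product is immaterial.
\<close>

definition form_det :: "nat \<Rightarrow> form mat \<Rightarrow> form" where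
  "form_det k M = (\<lambda>I J. \<Sum>\<sigma> | \<sigma> permutes {..<k}.
     of_int (sign \<sigma>) * wedge_list (map (\<lambda>a. M $$ (a, \<sigma> a)) [0..<k]) I J)"

definition griffiths_positive :: "nat \<Rightarrow> nat \<Rightarrow> form mat \<Rightarrow> bool" where
  "griffiths_positive n k M \<longleftrightarrow> (\<forall>\<theta>\<in>carrier_vec k. \<theta> \<noteq> 0\<^sub>v k \<longrightarrow>
     kahler n (\<lambda>I J. \<Sum>a<k. \<Sum>b<k. (\<theta> $ a) * cnj (\<theta> $ b) * (M $$ (a, b)) I J))"

text \<open>
  An invertible matrix \<open>A\<close> encodes the complex linear coordinates \<open>w\<^sub>j = \<Sum>\<^sub>i A\<^sub>j\<^sub>i z\<^sub>i\<close>;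
  \<open>coord_form n A j\<close> is \<open>dw\<^sub>j\<close>.
\<close>

definition coord_form :: "nat \<Rightarrow> complex mat \<Rightarrow> nat \<Rightarrow> form" where
  "coord_form n A j = (\<lambda>I J. \<Sum>i<n. if I = {i} \<and> J = {} then A $$ (j, i) else 0)"

definition coord_volume :: "nat \<Rightarrow> complex mat \<Rightarrow> nat \<Rightarrow> form" where
  "coord_volume n A j =
     (\<lambda>I J. (\<i> / 2) * wedge (coord_form n A j) (conj_form (coord_form n A j)) I J)"

definition SD_condition :: "nat \<Rightarrow> nat \<Rightarrow> form mat \<Rightarrow> bool" where
  "SD_condition n k M \<longleftrightarrow> (\<exists>A (B :: nat \<Rightarrow> complex mat).
     A \<in> carrier_mat n n \<and> invertible_mat A \<and>
     (\<forall>j<n. B j \<in> carrier_mat k k \<and> mat_adjoint (B j) = B j) \<and>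
     (\<forall>a<k. \<forall>b<k. M $$ (a, b) = (\<lambda>I J. \<Sum>j<n. B j $$ (a, b) * coord_volume n A j I J)))"


section \<open>Lefschetz and Hodge--Riemann forms\<close>

text \<open>The map is linear by construction, so it is an isomorphism iff it is bijective.\<close>

definition lefschetz :: "nat \<Rightarrow> nat \<Rightarrow> nat \<Rightarrow> form \<Rightarrow> bool" where
  "lefschetz n p q \<Omega> \<longleftrightarrow>
     bij_betw (\<lambda>\<alpha>. wedge \<alpha> \<Omega>) (forms n p q) (forms n (n - q) (n - p))"

text \<open>
  Continuity of the path is continuity of all coefficients, i.e. continuity in the
  finite-dimensional space \<open>forms n k k\<close>.
\<close>

definition hodge_riemann :: "nat \<Rightarrow> nat \<Rightarrow> nat \<Rightarrow> nat \<Rightarrow> form \<Rightarrow> form \<Rightarrow> bool" where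
  "hodge_riemann n k p q \<omega> \<Omega> \<longleftrightarrow> (\<exists>\<Omega>\<^sub>t :: real \<Rightarrow> form.
     (\<forall>I J. continuous_on {0..1} (\<lambda>t. \<Omega>\<^sub>t t I J)) \<and>
     (\<forall>t\<in>{0..1}. real_form n k (\<Omega>\<^sub>t t)) \<and>
     \<Omega>\<^sub>t 0 = \<Omega> \<and> \<Omega>\<^sub>t 1 = wedge_power \<omega> k \<and>
     (\<forall>t\<in>{0..1}. \<forall>r\<le>min p q.
        lefschetz n (p - r) (q - r) (wedge (\<Omega>\<^sub>t t) (wedge_power \<omega> (2 * r)))))"

end

theory Submission
  imports Defs "HOL-Library.FuncSet"
begin

text \<open>
  In the coordinates of the SD condition \<open>det M = \<Sum>\<^sub>J c\<^sub>J V\<^sub>J\<close>, where \<open>c\<^sub>J\<close> is, up to the factor \<open>k!\<close>,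
  the mixed discriminant of the \<open>B\<^sub>j\<close>, \<open>j \<in> J\<close>, and Griffiths positivity says that every \<open>B\<^sub>j\<close> is
  positive definite. Wedging with such a diagonal form splits into blocks indexed by pairs \<open>(P, Q)\<close> of
  disjoint index sets. For \<open>p + q \<le> 3\<close> each block is either a scalar \<open>c\<^sub>J > 0\<close> or the symmetric
  matrix \<open>A\<close> with zero diagonal and \<open>A\<^sub>i\<^sub>j = c\<^bsub>X - {i, j}\<^esub>\<close>, where \<open>|X| = k + 2\<close>.

  The point is that \<open>A\<close> is nonsingular. If all \<open>B\<^sub>l\<close> have rank one, then
  \<open>A\<^sub>i\<^sub>j = D |x\<^sub>i y\<^sub>j - x\<^sub>j y\<^sub>i|\<^sup>2\<close>, so \<open>A\<close> has at most one positive eigenvalue. For a fixed \<open>l\<close> this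
  is equivalent to \<open>A\<close> being nonpositive on the hyperplane orthogonal to the \<open>l\<close>-th row, which is a
  convex condition on \<open>B\<^sub>l\<close> because that row does not depend on \<open>B\<^sub>l\<close>; hence it passes to sums of rank one
  matrices. Finally, a kernel vector of \<open>A\<close> would persist when the \<open>B\<^sub>l\<close> are replaced by the identity
  one after the other, but then \<open>A\<close> is a multiple of \<open>J - 1\<close> with \<open>J\<close> the all-ones matrix.

  The path runs from \<open>M\<close> linearly to \<open>\<omega>\<^sub>0\<close> times the identity, \<open>\<omega>\<^sub>0\<close> being the standard form of the SD
  coordinates, and then from \<open>\<omega>\<^sub>0\<close> to \<open>\<omega>\<close>; every matrix on it has positive definite coefficients in
  suitable coordinates. For \<open>r = 1\<close> one takes coordinates in which \<open>\<omega>\<close> is standard, where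
  \<open>\<alpha> \<and> \<bar>\<alpha> \<and> \<Omega> \<and> \<omega>\<^sup>2\<close> is a sum of squares.
\<close>

section \<open>Positive definite Hermitian matrices\<close>

text \<open>The matrices \<open>B j\<close> need not commute, so in general no change of basis makes
  all of them diagonal, and the coefficients of the determinant have no product formula. Information
  about them comes from rank one matrices, where they are squared minors. Squared minors may vanish,
  however, while nonpositivity is transferred between rows only through a positive entry. The
  vectors are therefore moved into general position, and positive definite families are reached as
  limits. A limit yields weak inequalities only; strict ones are recovered by splitting a small
  multiple of the identity off a positive definite matrix. The bound \<open>p + q \<le> 3\<close>
  enters twice. It forces the common part of the two index sets in a block to have at most one
  element, which leaves scalars and one kind of matrix. It also makes \<open>p - 1\<close> or
  \<open>q - 1\<close> zero in the case \<open>r = 1\<close>.\<close>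

definition herm_form :: "nat \<Rightarrow> (nat \<Rightarrow> nat \<Rightarrow> complex) \<Rightarrow> (nat \<Rightarrow> complex) \<Rightarrow> complex" where
  "herm_form k H x = (\<Sum>a<k. \<Sum>b<k. H a b * x a * cnj (x b))"

text \<open>Matrices are functions constrained only below \<open>k\<close>, so that they can be
  updated, combined linearly and cut off without dimension bookkeeping.\<close>

definition pos_def :: "nat \<Rightarrow> (nat \<Rightarrow> nat \<Rightarrow> complex) \<Rightarrow> bool" where
  "pos_def k H \<longleftrightarrow> (\<forall>a<k. \<forall>b<k. H b a = cnj (H a b)) \<and>
     (\<forall>x. (\<exists>a<k. x a \<noteq> 0) \<longrightarrow> 0 < Re (herm_form k H x))"

lemma pos_def_sym: "pos_def k H \<Longrightarrow> a < k \<Longrightarrow> b < k \<Longrightarrow> H b a = cnj (H a b)"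
  unfolding pos_def_def by (drule conjunct1, drule spec, drule (1) mp, drule spec, erule (1) mp)

lemma pos_def_pos: "pos_def k H \<Longrightarrow> a < k \<Longrightarrow> x a \<noteq> 0 \<Longrightarrow> 0 < Re (herm_form k H x)"
  unfolding pos_def_def by (drule conjunct2, drule spec, erule mp) blast

definition rank_one :: "(nat \<Rightarrow> complex) \<Rightarrow> nat \<Rightarrow> nat \<Rightarrow> complex" where
  "rank_one v = (\<lambda>a b. v a * cnj (v b))"

lemma herm_form_cong:
  assumes "\<And>a b. a < k \<Longrightarrow> b < k \<Longrightarrow> H a b = H' a b" "\<And>a. a < k \<Longrightarrow> x a = x' a"
  shows "herm_form k H x = herm_form k H' x'"
  unfolding herm_form_def using assms by (intro sum.cong refl) auto

lemma pos_def_diag: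
  assumes "pos_def k H" "a < k"
  shows "H a a = of_real (Re (H a a))" "0 < Re (H a a)"
proof -
  have "H a a = cnj (H a a)" using assms by (rule pos_def_sym) fact
  from arg_cong[OF this, of Im] show "H a a = of_real (Re (H a a))" by (simp add: complex_eq_iff)
  let ?x = "\<lambda>i. if i = a then 1 else (0::complex)"
  have "0 < Re (herm_form k H ?x)"
    by (rule pos_def_pos[OF assms]) simp
  also have "herm_form k H ?x = (\<Sum>i<k. \<Sum>j<k. if j = a then (if i = a then H a a else 0) else 0)"
    unfolding herm_form_def by (intro sum.cong refl) auto
  also have "\<dots> = H a a" using assms(2) by simp
  finally show "0 < Re (H a a)" .
qed

lemma herm_form_Suc:
  "herm_form (Suc k) H x = herm_form k H x + (\<Sum>a<k. H a k * x a) * cnj (x k)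
     + (\<Sum>b<k. H k b * cnj (x b)) * x k + H k k * x k * cnj (x k)"
  unfolding herm_form_def by (simp add: sum.distrib sum_distrib_left sum_distrib_right algebra_simps)

text \<open>Elimination of the last coordinate: the Schur complement \<open>H'\<close> of the entry
  \<open>H k k\<close> is again positive definite, and the last column of \<open>H\<close>, divided
  by the square root of \<open>H k k\<close>, is the last column of the factor. Starting from the
  last index makes the factor upper triangular.\<close>

lemma cholesky:
  assumes "pos_def k H"
  shows "\<exists>L. (\<forall>a<k. \<forall>b<k. H a b = (\<Sum>r<k. L a r * cnj (L b r))) \<and>
     (\<forall>a<k. \<forall>r<a. L a r = 0) \<and> (\<forall>a<k. L a a \<noteq> 0)"
  using assms
proof (induction k arbitrary: H)
  case 0
  then show ?case by auto
next
  case (Suc k)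
  let ?d = "H k k"
  define d where "d = Re ?d"
  have d: "?d = of_real d" "d > 0" using pos_def_diag[OF Suc.prems, of k] unfolding d_def by auto
  have herm: "H b a = cnj (H a b)" if "a < Suc k" "b < Suc k" for a b
    using Suc.prems that by (rule pos_def_sym)
  have hk: "H k a = cnj (H a k)" if "a < k" for a using herm[of a k] that by simp
  define H' where "H' = (\<lambda>a b. H a b - H a k * H k b / ?d)"
  have "pos_def k H'"
    unfolding pos_def_def
  proof (intro conjI allI impI)
    fix a b assume ab: "a < k" "b < k"
    show "H' b a = cnj (H' a b)"
      unfolding H'_def using herm[of a b] herm[of a k] herm[of k b] ab d(1) by (simp add: mult.commute)
  next
    fix x :: "nat \<Rightarrow> complex" assume x: "\<exists>a<k. x a \<noteq> 0"
    define s where "s = (\<Sum>a<k. H a k * x a)"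
    \<comment> \<open>The last entry minimises the form over all extensions of \<open>x\<close>; the
      minimum is \<open>herm_form k H' x\<close>.\<close>
    define y where "y = (\<lambda>a. if a = k then - s / ?d else x a)"
    have "\<exists>a<Suc k. y a \<noteq> 0" using x unfolding y_def by (metis less_Suc_eq less_irrefl)
    then have pos: "0 < Re (herm_form (Suc k) H y)" using pos_def_pos[OF Suc.prems] by blast
    have s1: "(\<Sum>a<k. H a k * y a) = s" unfolding s_def y_def by (intro sum.cong) auto
    have s2: "(\<Sum>b<k. H k b * cnj (y b)) = cnj s"
      unfolding s_def y_def cnj_sum by (intro sum.cong) (auto simp: hk)
    have h: "herm_form k H y = herm_form k H x" by (rule herm_form_cong) (auto simp: y_def)
    have "herm_form k H' x = herm_form k H x - (\<Sum>a<k. \<Sum>b<k. H a k * x a * (H k b * cnj (x b)) / ?d)"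
      unfolding herm_form_def H'_def sum_subtractf[symmetric]
      by (intro sum.cong refl) (simp add: left_diff_distrib)
    also have "(\<Sum>a<k. \<Sum>b<k. H a k * x a * (H k b * cnj (x b)) / ?d) = s * cnj s / ?d"
      unfolding s_def cnj_sum sum_product sum_divide_distrib by (intro sum.cong) (auto simp: hk)
    finally have h': "herm_form k H' x = herm_form k H x - s * cnj s / ?d" .
    have "herm_form (Suc k) H y = herm_form k H x + s * cnj (- s / ?d) + cnj s * (- s / ?d)
       + ?d * (- s / ?d) * cnj (- s / ?d)"
      unfolding herm_form_Suc s1 s2 h by (simp add: y_def)
    also have "\<dots> = herm_form k H' x" unfolding h' using d by (simp add: field_simps)
    finally show "0 < Re (herm_form k H' x)" using pos by simp
  qed
  from Suc.IH[OF this] obtain L where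
    L0: "\<forall>a<k. \<forall>b<k. H' a b = (\<Sum>r<k. L a r * cnj (L b r))"
      "\<forall>a<k. \<forall>r<a. L a r = 0" "\<forall>a<k. L a a \<noteq> 0" by (elim exE conjE) (rule that)
  note L = L0[rule_format]
  define e where "e = complex_of_real (sqrt d)"
  have e: "e \<noteq> 0" "cnj e = e" "e * e = ?d"
    using d unfolding e_def by (auto simp flip: of_real_mult)
  define L' where "L' = (\<lambda>a r. if r = k then H a k / e else if a = k then 0 else L a r)"
  have "H a b = (\<Sum>r<Suc k. L' a r * cnj (L' b r))" if ab: "a < Suc k" "b < Suc k" for a b
  proof -
    have "(\<Sum>r<Suc k. L' a r * cnj (L' b r)) = (\<Sum>r<k. L' a r * cnj (L' b r)) + H a k * H k b / ?d"
      using herm[of b k] ab e by (simp add: L'_def)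
    also have "(\<Sum>r<k. L' a r * cnj (L' b r)) = H a b - H a k * H k b / ?d"
    proof (cases "a = k \<or> b = k")
      case True
      then have "(\<Sum>r<k. L' a r * cnj (L' b r)) = 0" by (intro sum.neutral) (auto simp: L'_def)
      then show ?thesis using True d by auto
    next
      case False
      then have "(\<Sum>r<k. L' a r * cnj (L' b r)) = H' a b"
        using ab by (subst L) (auto simp: L'_def intro!: sum.cong)
      then show ?thesis by (simp add: H'_def)
    qed
    finally show ?thesis by simp
  qed
  moreover have "\<forall>a<Suc k. \<forall>r<a. L' a r = 0" using L(2) unfolding L'_def by auto
  moreover have "\<forall>a<Suc k. L' a a \<noteq> 0" using L(3) d e unfolding L'_def by auto
  ultimately show ?case by (intro exI[of _ L'] conjI allI impI) auto
qed

lemma pos_def_decompose: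
  assumes "pos_def k H"
  obtains L N where "L \<in> carrier_mat k k" "N \<in> carrier_mat k k" "L * N = 1\<^sub>m k" "N * L = 1\<^sub>m k"
    "\<And>a b. a < k \<Longrightarrow> b < k \<Longrightarrow> H a b = (\<Sum>r<k. L $$ (a, r) * cnj (L $$ (b, r)))"
proof -
  from cholesky[OF assms] obtain l where
    l: "\<forall>a<k. \<forall>b<k. H a b = (\<Sum>r<k. l a r * cnj (l b r))"
      "\<forall>a<k. \<forall>r<a. l a r = 0" "\<forall>a<k. l a a \<noteq> 0" by (elim exE conjE) (rule that)
  define L where "L = mat k k (\<lambda>(a, r). l a r)"
  have L: "L \<in> carrier_mat k k" unfolding L_def by auto
  have "upper_triangular L" unfolding L_def upper_triangular_def using l(2) by auto
  then have "det L = prod_list (diag_mat L)" by (rule det_upper_triangular[OF _ L])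
  also have "\<dots> \<noteq> 0" using l(3) by (auto simp: prod_list_zero_iff diag_mat_def L_def)
  finally have "det L \<noteq> 0" .
  from det_non_zero_imp_unit[OF L this, of "()"]
  obtain N where N: "N \<in> carrier_mat k k" "N * L = 1\<^sub>m k" "L * N = 1\<^sub>m k"
    unfolding Units_def ring_mat_def by auto
  show ?thesis
    by (rule that[OF L N(1,3,2)]) (use l(1) in \<open>auto simp: L_def intro!: sum.cong\<close>)
qed

lemma herm_form_sum_squares:
  assumes "\<And>a b. a < k \<Longrightarrow> b < k \<Longrightarrow> H a b = (\<Sum>r<m. l a r * cnj (l b r))"
  shows "herm_form k H x = of_real (\<Sum>r<m. (cmod (\<Sum>a<k. l a r * x a))\<^sup>2)"
proof -
  have "herm_form k H x = (\<Sum>a<k. \<Sum>b<k. \<Sum>r<m. (l a r * x a) * cnj (l b r * x b))"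
    unfolding herm_form_def using assms
    by (intro sum.cong refl) (simp add: sum_distrib_left sum_distrib_right algebra_simps)
  also have "\<dots> = (\<Sum>a<k. \<Sum>r<m. \<Sum>b<k. (l a r * x a) * cnj (l b r * x b))"
    by (intro sum.cong refl sum.swap)
  also have "\<dots> = (\<Sum>r<m. \<Sum>a<k. \<Sum>b<k. (l a r * x a) * cnj (l b r * x b))"
    by (rule sum.swap)
  also have "\<dots> = (\<Sum>r<m. (\<Sum>a<k. l a r * x a) * cnj (\<Sum>a<k. l a r * x a))"
    by (simp only: cnj_sum sum_product)
  finally show ?thesis by (simp only: of_real_sum complex_norm_square)
qed

text \<open>The positive cone is open. With \<open>y\<close> the image of \<open>x\<close> under the
  transpose of \<open>L\<close>, the form is the squared norm of \<open>y\<close>; recovering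
  \<open>x\<close> from \<open>y\<close> through \<open>N\<close> bounds the squared norm of
  \<open>x\<close> by \<open>K\<close> times the form.\<close>

lemma pos_def_minus_scaled_id:
  assumes "pos_def k H"
  obtains \<delta> :: real where "\<delta> > 0" "pos_def k (\<lambda>a b. H a b - of_real \<delta> * of_bool (a = b))"
proof -
  obtain L N where LN: "L \<in> carrier_mat k k" "N \<in> carrier_mat k k" "L * N = 1\<^sub>m k"
    "\<And>a b. a < k \<Longrightarrow> b < k \<Longrightarrow> H a b = (\<Sum>r<k. L $$ (a, r) * cnj (L $$ (b, r)))"
    by (rule pos_def_decompose[OF assms]) (rule that)
  define K where "K = (\<Sum>a<k. (\<Sum>r<k. cmod (N $$ (r, a)))\<^sup>2)"
  have K0: "K \<ge> 0" unfolding K_def by (simp add: sum_nonneg)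
  have bound: "(\<Sum>a<k. (cmod (x a))\<^sup>2) \<le> K * Re (herm_form k H x)" for x
  proof -
    define y where "y = (\<lambda>r. \<Sum>a<k. L $$ (a, r) * x a)"
    have hy: "Re (herm_form k H x) = (\<Sum>r<k. (cmod (y r))\<^sup>2)"
      unfolding y_def by (subst herm_form_sum_squares[OF LN(4)]) auto
    have "(cmod (x a))\<^sup>2 \<le> (\<Sum>r<k. cmod (N $$ (r, a)))\<^sup>2 * (\<Sum>r<k. (cmod (y r))\<^sup>2)" if a: "a < k" for a
    proof -
      have "(\<Sum>r<k. N $$ (r, a) * y r) = (\<Sum>r<k. \<Sum>b<k. (L $$ (b, r) * N $$ (r, a)) * x b)"
        unfolding y_def sum_distrib_left by (simp add: algebra_simps)
      also have "\<dots> = (\<Sum>b<k. \<Sum>r<k. (L $$ (b, r) * N $$ (r, a)) * x b)" by (rule sum.swap)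
      also have "\<dots> = (\<Sum>b<k. (L * N) $$ (b, a) * x b)"
        using LN(1,2) a by (intro sum.cong refl)
          (auto simp: scalar_prod_def sum_distrib_right lessThan_atLeast0 intro!: sum.cong)
      also have "\<dots> = (\<Sum>b<k. if b = a then x a else 0)"
        unfolding LN(3) using a by (intro sum.cong) auto
      finally have "x a = (\<Sum>r<k. N $$ (r, a) * y r)" using a by simp
      then have "cmod (x a) \<le> (\<Sum>r<k. cmod (N $$ (r, a)) * cmod (y r))"
        using norm_sum[of "\<lambda>r. N $$ (r, a) * y r" "{..<k}"] by (simp add: norm_mult)
      also have "\<dots> \<le> (\<Sum>r<k. cmod (N $$ (r, a)) * sqrt (\<Sum>r<k. (cmod (y r))\<^sup>2))"
        by (intro sum_mono mult_left_mono real_le_rsqrt member_le_sum) auto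
      also have "\<dots> = (\<Sum>r<k. cmod (N $$ (r, a))) * sqrt (\<Sum>r<k. (cmod (y r))\<^sup>2)"
        by (simp add: sum_distrib_right)
      finally have "(cmod (x a))\<^sup>2 \<le> ((\<Sum>r<k. cmod (N $$ (r, a))) * sqrt (\<Sum>r<k. (cmod (y r))\<^sup>2))\<^sup>2"
        by (intro power_mono) auto
      then show ?thesis by (simp add: power_mult_distrib sum_nonneg)
    qed
    then have "(\<Sum>a<k. (cmod (x a))\<^sup>2) \<le> (\<Sum>a<k. (\<Sum>r<k. cmod (N $$ (r, a)))\<^sup>2 * (\<Sum>r<k. (cmod (y r))\<^sup>2))"
      by (intro sum_mono) auto
    then show ?thesis unfolding hy K_def by (simp add: sum_distrib_right)
  qed
  \<comment> \<open>\<open>K + 1\<close> in place of \<open>K\<close> makes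
    \<open>\<delta> * K < 1\<close> strict and covers \<open>K = 0\<close>.\<close>
  define \<delta> where "\<delta> = 1 / (K + 1)"
  have d: "\<delta> > 0" unfolding \<delta>_def using K0 by simp
  have "pos_def k (\<lambda>a b. H a b - of_real \<delta> * of_bool (a = b))"
    unfolding pos_def_def
  proof (intro conjI allI impI)
    fix a b assume "a < k" "b < k"
    then have "H b a = cnj (H a b)" by (rule pos_def_sym[OF assms])
    then show "H b a - of_real \<delta> * of_bool (b = a) = cnj (H a b - of_real \<delta> * of_bool (a = b))"
      by simp
  next
    fix x :: "nat \<Rightarrow> complex" assume x: "\<exists>a<k. x a \<noteq> 0"
    have "herm_form k (\<lambda>a b. H a b - of_real \<delta> * of_bool (a = b)) x
       = herm_form k H x - (\<Sum>a<k. \<Sum>b<k. if b = a then of_real \<delta> * (x a * cnj (x a)) else 0)"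
      unfolding herm_form_def sum_subtractf[symmetric] by (intro sum.cong refl) (auto simp: algebra_simps)
    also have "\<dots> = herm_form k H x - of_real (\<delta> * (\<Sum>a<k. (cmod (x a))\<^sup>2))"
      by (simp add: sum_distrib_left flip: complex_norm_square)
    finally have eq: "Re (herm_form k (\<lambda>a b. H a b - of_real \<delta> * of_bool (a = b)) x)
       = Re (herm_form k H x) - \<delta> * (\<Sum>a<k. (cmod (x a))\<^sup>2)" by simp
    have pos: "0 < Re (herm_form k H x)" using pos_def_pos[OF assms] x by blast
    have "\<delta> * (\<Sum>a<k. (cmod (x a))\<^sup>2) \<le> \<delta> * (K * Re (herm_form k H x))"
      using bound d by (intro mult_left_mono) auto
    also have "\<dots> = (\<delta> * K) * Re (herm_form k H x)" by simp
    also have "\<dots> < 1 * Re (herm_form k H x)"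
      using pos K0 by (intro mult_strict_right_mono) (auto simp: \<delta>_def)
    finally show "0 < Re (herm_form k (\<lambda>a b. H a b - of_real \<delta> * of_bool (a = b)) x)"
      unfolding eq by simp
  qed
  with d show ?thesis by (rule that)
qed

lemma pos_def_id: "pos_def k (\<lambda>a b. of_bool (a = b))"
  unfolding pos_def_def
proof (intro conjI allI impI)
  fix x :: "nat \<Rightarrow> complex" assume x: "\<exists>a<k. x a \<noteq> 0"
  have "herm_form k (\<lambda>a b. of_bool (a = b)) x = (\<Sum>a<k. \<Sum>b<k. if b = a then x a * cnj (x a) else 0)"
    unfolding herm_form_def by (intro sum.cong refl) auto
  also have "\<dots> = of_real (\<Sum>a<k. (cmod (x a))\<^sup>2)" by (simp flip: complex_norm_square)
  also have "Re \<dots> = (\<Sum>a<k. (cmod (x a))\<^sup>2)" by simp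
  finally have eq: "Re (herm_form k (\<lambda>a b. of_bool (a = b)) x) = (\<Sum>a<k. (cmod (x a))\<^sup>2)" .
  from x obtain a where a: "a < k" "x a \<noteq> 0" by blast
  have "0 < (\<Sum>a<k. (cmod (x a))\<^sup>2)"
    by (rule sum_pos2[of _ a]) (use a in auto)
  then show "0 < Re (herm_form k (\<lambda>a b. of_bool (a = b)) x)" unfolding eq .
qed (simp add: eq_commute)

section \<open>Coefficients of the determinant of a Hermitian pencil\<close>

text \<open>Extensional functions, so that every bijection occurs once and the set is
  finite.\<close>

definition bijs :: "'a set \<Rightarrow> 'b set \<Rightarrow> ('a \<Rightarrow> 'b) set" where
  "bijs S J = {\<tau> \<in> S \<rightarrow>\<^sub>E J. bij_betw \<tau> S J}"

lemma bijsD: "\<tau> \<in> bijs S J \<Longrightarrow> bij_betw \<tau> S J" "\<tau> \<in> bijs S J \<Longrightarrow> a \<in> S \<Longrightarrow> \<tau> a \<in> J"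
  unfolding bijs_def by auto

text \<open>
  The coefficient of the square-free monomial with index set \<open>J\<close> in \<open>det (\<Sum>\<^sub>j x\<^sub>j B\<^sub>j)\<close>: row \<open>a\<close> of
  the determinant is taken from \<open>B\<^sub>j\<close> with \<open>j = \<tau> a\<close>.
\<close>

definition mixed_coeff :: "nat \<Rightarrow> (nat \<Rightarrow> nat \<Rightarrow> nat \<Rightarrow> complex) \<Rightarrow> nat set \<Rightarrow> complex" where
  "mixed_coeff k B J = (\<Sum>\<tau>\<in>bijs {..<k} J. \<Sum>\<sigma> | \<sigma> permutes {..<k}.
     of_int (sign \<sigma>) * (\<Prod>a<k. B (\<tau> a) a (\<sigma> a)))"

lemma permutes_lessThan: "\<sigma> permutes {..<k} \<Longrightarrow> a < k \<Longrightarrow> \<sigma> a < k"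
  using permutes_in_image[of \<sigma> "{..<k}" a] by auto

lemma mixed_coeff_cong:
  assumes "\<And>j a b. j \<in> J \<Longrightarrow> a < k \<Longrightarrow> b < k \<Longrightarrow> B j a b = B' j a b"
  shows "mixed_coeff k B J = mixed_coeff k B' J"
  unfolding mixed_coeff_def
proof (intro sum.cong refl)
  fix \<tau> \<sigma> assume "\<tau> \<in> bijs {..<k} J" "\<sigma> \<in> {\<sigma>. \<sigma> permutes {..<k}}"
  then have "(\<Prod>a<k. B (\<tau> a) a (\<sigma> a)) = (\<Prod>a<k. B' (\<tau> a) a (\<sigma> a))"
    by (intro prod.cong refl assms) (auto dest: bijsD permutes_lessThan)
  then show "of_int (sign \<sigma>) * (\<Prod>a<k. B (\<tau> a) a (\<sigma> a)) = of_int (sign \<sigma>) * (\<Prod>a<k. B' (\<tau> a) a (\<sigma> a))"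
    by simp
qed

text \<open>A bijection onto \<open>J\<close> takes the value \<open>l\<close> in exactly one row
  \<open>c\<close>, so every product contains exactly one entry of \<open>B l\<close>.\<close>

lemma mixed_coeff_linear:
  assumes "l \<in> J" "finite R"
  shows "mixed_coeff k (B(l := \<lambda>a b. \<Sum>r\<in>R. s r * Z r a b)) J
    = (\<Sum>r\<in>R. s r * mixed_coeff k (B(l := Z r)) J)"
proof -
  let ?B = "B(l := \<lambda>a b. \<Sum>r\<in>R. s r * Z r a b)"
  have "(\<Prod>a<k. ?B (\<tau> a) a (\<sigma> a)) = (\<Sum>r\<in>R. s r * (\<Prod>a<k. (B(l := Z r)) (\<tau> a) a (\<sigma> a)))"
    if \<tau>: "\<tau> \<in> bijs {..<k} J" for \<tau> \<sigma>
  proof -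
    have bij: "bij_betw \<tau> {..<k} J" using bijsD(1)[OF \<tau>] .
    then obtain c where c: "c < k" "\<tau> c = l" using assms(1) by (auto simp: bij_betw_def)
    have ne: "\<tau> a \<noteq> l" if "a \<in> {..<k} - {c}" for a
      using bij c that by (auto simp: bij_betw_def inj_on_def)
    have split: "(\<Prod>a<k. (B(l := Y)) (\<tau> a) a (\<sigma> a)) = Y c (\<sigma> c) * (\<Prod>a\<in>{..<k} - {c}. B (\<tau> a) a (\<sigma> a))" for Y
      using c ne by (subst prod.remove[of _ c]) (auto intro!: prod.cong)
    show ?thesis unfolding split by (simp add: sum_distrib_right mult.assoc)
  qed
  then have "mixed_coeff k ?B J = (\<Sum>\<tau>\<in>bijs {..<k} J. \<Sum>\<sigma> | \<sigma> permutes {..<k}. \<Sum>r\<in>R.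
     s r * (of_int (sign \<sigma>) * (\<Prod>a<k. (B(l := Z r)) (\<tau> a) a (\<sigma> a))))"
    unfolding mixed_coeff_def by (intro sum.cong refl) (simp add: sum_distrib_left algebra_simps)
  also have "\<dots> = (\<Sum>\<tau>\<in>bijs {..<k} J. \<Sum>r\<in>R. \<Sum>\<sigma> | \<sigma> permutes {..<k}.
     s r * (of_int (sign \<sigma>) * (\<Prod>a<k. (B(l := Z r)) (\<tau> a) a (\<sigma> a))))"
    by (intro sum.cong refl sum.swap)
  also have "\<dots> = (\<Sum>r\<in>R. s r * mixed_coeff k (B(l := Z r)) J)"
    unfolding mixed_coeff_def by (subst sum.swap) (simp add: sum_distrib_left)
  finally show ?thesis .
qed

lemma bijs_permute:
  assumes "\<rho> permutes {..<k}" "\<tau> \<in> bijs {..<k} J"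
  shows "\<tau> \<circ> \<rho> \<in> bijs {..<k} J"
proof -
  have "bij_betw (\<tau> \<circ> \<rho>) {..<k} J"
    using permutes_imp_bij[OF assms(1)] bijsD(1)[OF assms(2)] by (rule bij_betw_trans)
  moreover have "\<tau> \<circ> \<rho> \<in> {..<k} \<rightarrow>\<^sub>E J"
    using assms permutes_lessThan[OF assms(1)] permutes_not_in[OF assms(1)]
    unfolding bijs_def by (auto simp: PiE_def extensional_def)
  ultimately show ?thesis unfolding bijs_def by blast
qed

lemma sum_bijs_permute:
  assumes "\<rho> permutes {..<k}"
  shows "(\<Sum>\<tau>\<in>bijs {..<k} J. f (\<tau> \<circ> \<rho>)) = (\<Sum>\<tau>\<in>bijs {..<k} J. f \<tau>)"
proof (rule sum.reindex_bij_witness[where i = "\<lambda>\<tau>. \<tau> \<circ> (inv_into UNIV \<rho>)" and j = "\<lambda>\<tau>. \<tau> \<circ> \<rho>"])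
  fix \<tau> assume "\<tau> \<in> bijs {..<k} J"
  then show "\<tau> \<circ> \<rho> \<in> bijs {..<k} J" "\<tau> \<circ> (inv_into UNIV \<rho>) \<in> bijs {..<k} J"
    using bijs_permute[OF assms] bijs_permute[OF permutes_inv[OF assms]] by auto
  show "\<tau> \<circ> \<rho> \<circ> (inv_into UNIV \<rho>) = \<tau>" "\<tau> \<circ> (inv_into UNIV \<rho>) \<circ> \<rho> = \<tau>"
    using permutes_inv_o[OF assms] by (simp_all add: comp_assoc)
qed auto

lemma prod_permute_inv:
  assumes "\<sigma> permutes {..<k}"
  shows "(\<Prod>a<k. f a (\<sigma> a)) = (\<Prod>a<k. f ((inv_into UNIV \<sigma>) a) (a::nat))"
  by (rule prod.reindex_bij_witness[where i = "(inv_into UNIV \<sigma>)" and j = \<sigma>])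
    (use assms permutes_inv[OF assms] in \<open>auto simp: permutes_inverses dest: permutes_lessThan\<close>)

text \<open>Conjugation transposes each Hermitian matrix. Renaming \<open>\<sigma> a\<close> as the
  row replaces \<open>\<tau>\<close> by its composition with the inverse of \<open>\<sigma>\<close>,
  and \<open>\<sigma>\<close> by its inverse; the sign and both ranges of summation stay the
  same.\<close>

lemma mixed_coeff_real:
  assumes "\<And>j a b. j \<in> J \<Longrightarrow> a < k \<Longrightarrow> b < k \<Longrightarrow> B j b a = cnj (B j a b)"
  shows "cnj (mixed_coeff k B J) = mixed_coeff k B J"
proof -
  have "cnj (mixed_coeff k B J) = (\<Sum>\<tau>\<in>bijs {..<k} J. \<Sum>\<sigma> | \<sigma> permutes {..<k}.
     of_int (sign \<sigma>) * (\<Prod>a<k. B (\<tau> a) (\<sigma> a) a))"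
    unfolding mixed_coeff_def cnj_sum complex_cnj_mult cnj_prod complex_cnj_of_int
  proof (intro sum.cong refl arg_cong2[of _ _ _ _ "(*)"] prod.cong)
    fix \<tau> \<sigma> a assume h: "\<tau> \<in> bijs {..<k} J" "\<sigma> \<in> {\<sigma>. \<sigma> permutes {..<k}}" "a \<in> {..<k}"
    show "cnj (B (\<tau> a) a (\<sigma> a)) = B (\<tau> a) (\<sigma> a) a"
      by (rule assms[symmetric]) (use h in \<open>auto dest: bijsD permutes_lessThan\<close>)
  qed
  also have "\<dots> = (\<Sum>\<sigma> | \<sigma> permutes {..<k}. \<Sum>\<tau>\<in>bijs {..<k} J.
     of_int (sign \<sigma>) * (\<Prod>a<k. B ((\<tau> \<circ> (inv_into UNIV \<sigma>)) a) a ((inv_into UNIV \<sigma>) a)))"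
    by (subst sum.swap) (auto intro!: sum.cong simp: prod_permute_inv[where f = "\<lambda>a b. B (_ a) b a"])
  also have "\<dots> = (\<Sum>\<sigma> | \<sigma> permutes {..<k}. \<Sum>\<tau>\<in>bijs {..<k} J.
     of_int (sign \<sigma>) * (\<Prod>a<k. B (\<tau> a) a ((inv_into UNIV \<sigma>) a)))"
    by (intro sum.cong refl sum_bijs_permute permutes_inv) auto
  also have "\<dots> = (\<Sum>\<sigma> | \<sigma> permutes {..<k}. \<Sum>\<tau>\<in>bijs {..<k} J.
     of_int (sign \<sigma>) * (\<Prod>a<k. B (\<tau> a) a (\<sigma> a)))"
    by (rule sum.reindex_bij_witness[where i = "inv_into UNIV" and j = "inv_into UNIV"])
      (auto simp: permutes_inv permutes_inv_inv sign_inverse permutes_imp_permutation[of "{..<k}"] intro!: sum.cong)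
  also have "\<dots> = mixed_coeff k B J"
    unfolding mixed_coeff_def by (rule sum.swap)
  finally show ?thesis .
qed

lemma mixed_coeff_reindex:
  assumes "inj_on h J"
  shows "mixed_coeff k B (h ` J) = mixed_coeff k (\<lambda>j. B (h j)) J"
  unfolding mixed_coeff_def
proof (rule sum.reindex_bij_witness[where j = "\<lambda>\<tau>. restrict (inv_into J h \<circ> \<tau>) {..<k}" and i = "\<lambda>\<tau>. restrict (h \<circ> \<tau>) {..<k}"])
  fix \<tau> assume t: "\<tau> \<in> bijs {..<k} (h ` J)"
  have inv: "bij_betw (inv_into J h) (h ` J) J"
    using assms by (meson bij_betw_inv_into inj_on_imp_bij_betw)
  show "restrict (h \<circ> restrict (inv_into J h \<circ> \<tau>) {..<k}) {..<k} = \<tau>"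
    using t bijsD(2)[OF t] unfolding bijs_def
    by (auto simp: fun_eq_iff PiE_def extensional_def intro!: f_inv_into_f)
  have "bij_betw (restrict (inv_into J h \<circ> \<tau>) {..<k}) {..<k} J"
    using bij_betw_trans[OF bijsD(1)[OF t] inv] by (simp add: bij_betw_cong[of _ _ "restrict _ _"])
  then show "restrict (inv_into J h \<circ> \<tau>) {..<k} \<in> bijs {..<k} J"
    unfolding bijs_def by (auto simp: bij_betw_def)
  show "(\<Sum>\<sigma> | \<sigma> permutes {..<k}. of_int (sign \<sigma>) * (\<Prod>a<k. B (h (restrict (inv_into J h \<circ> \<tau>) {..<k} a)) a (\<sigma> a)))
     = (\<Sum>\<sigma> | \<sigma> permutes {..<k}. of_int (sign \<sigma>) * (\<Prod>a<k. B (\<tau> a) a (\<sigma> a)))"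
    using bijsD(2)[OF t] by (intro sum.cong refl arg_cong2[of _ _ _ _ "(*)"] prod.cong) (auto simp: f_inv_into_f)
next
  fix \<tau> assume t: "\<tau> \<in> bijs {..<k} J"
  show "restrict (inv_into J h \<circ> restrict (h \<circ> \<tau>) {..<k}) {..<k} = \<tau>"
    using t assms bijsD(2)[OF t] unfolding bijs_def
    by (auto simp: fun_eq_iff PiE_def extensional_def intro!: inv_into_f_f)
  have "bij_betw (restrict (h \<circ> \<tau>) {..<k}) {..<k} (h ` J)"
    using bij_betw_trans[OF bijsD(1)[OF t] inj_on_imp_bij_betw[OF assms]]
    by (simp add: bij_betw_cong[of _ _ "restrict _ _"])
  then show "restrict (h \<circ> \<tau>) {..<k} \<in> bijs {..<k} (h ` J)"
    unfolding bijs_def by (auto simp: bij_betw_def)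
qed

lemma bijs_nonempty: "finite J \<Longrightarrow> card J = k \<Longrightarrow> bijs {..<k} J \<noteq> {}"
proof -
  assume "finite J" "card J = k"
  then obtain f where f: "bij_betw f {..<k} J"
    using ex_bij_betw_nat_finite[of J] by (auto simp: lessThan_atLeast0)
  then have "restrict f {..<k} \<in> bijs {..<k} J"
    unfolding bijs_def by (auto simp: bij_betw_def inj_on_def)
  then show ?thesis by blast
qed

lemma finite_bijs [simp]: "finite S \<Longrightarrow> finite J \<Longrightarrow> finite (bijs S J)"
  unfolding bijs_def by (simp add: finite_PiE)

lemma mixed_coeff_id:
  assumes "\<And>j a b. j \<in> J \<Longrightarrow> a < k \<Longrightarrow> b < k \<Longrightarrow> B j a b = of_bool (a = b)"
  shows "mixed_coeff k B J = of_nat (card (bijs {..<k} J))"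
proof -
  have "(\<Sum>\<sigma> | \<sigma> permutes {..<k}. of_int (sign \<sigma>) * (\<Prod>a<k. B (\<tau> a) a (\<sigma> a))) = 1"
    if \<tau>: "\<tau> \<in> bijs {..<k} J" for \<tau>
  proof -
    have "of_int (sign \<sigma>) * (\<Prod>a<k. B (\<tau> a) a (\<sigma> a)) = (if \<sigma> = id then 1 else 0)"
      if \<sigma>: "\<sigma> permutes {..<k}" for \<sigma>
    proof -
      have e: "(\<Prod>a<k. B (\<tau> a) a (\<sigma> a)) = (\<Prod>a<k. of_bool (a = \<sigma> a))"
        by (intro prod.cong refl assms) (use \<tau> \<sigma> in \<open>auto dest: bijsD permutes_lessThan\<close>)
      show ?thesis
      proof (cases "\<sigma> = id")
        case False
        then obtain a where "a < k" "\<sigma> a \<noteq> a"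
          using permutes_not_in[OF \<sigma>] by (metis eq_id_iff lessThan_iff)
        then have "(\<Prod>a<k. of_bool (a = \<sigma> a)) = (0::complex)" by (intro prod_zero) (auto intro!: bexI[of _ a])
        then show ?thesis using False e by simp
      next
        case True
        with e show ?thesis by simp
      qed
    qed
    then have "(\<Sum>\<sigma> | \<sigma> permutes {..<k}. of_int (sign \<sigma>) * (\<Prod>a<k. B (\<tau> a) a (\<sigma> a)))
       = (\<Sum>\<sigma> | \<sigma> permutes {..<k}. if \<sigma> = id then 1 else 0)" by (intro sum.cong) auto
    then show ?thesis by (simp add: finite_permutations permutes_id)
  qed
  then show ?thesis unfolding mixed_coeff_def by simp
qed

text \<open>
  The last two rows are unit vectors, so the determinant is up to sign the minor of \<open>(v\<^sub>0, \<dots>, v\<^bsub>k+1\<^esub>)\<close>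
  without the columns \<open>i\<close> and \<open>j\<close>, but all these matrices have the same first \<open>k\<close> rows.
\<close>

definition minor_mat :: "nat \<Rightarrow> (nat \<Rightarrow> nat \<Rightarrow> complex) \<Rightarrow> nat \<Rightarrow> nat \<Rightarrow> complex mat" where
  "minor_mat k v i j = mat (k + 2) (k + 2) (\<lambda>(a, b).
     if a < k then v b a else if a = k then of_bool (b = i) else of_bool (b = j))"

lemma det_minor_mat:
  assumes ij: "i \<noteq> j" "i < k + 2" "j < k + 2"
  shows "det (minor_mat k v i j) = (\<Sum>\<pi> | \<pi> permutes {..<k+2} \<and> \<pi> k = i \<and> \<pi> (Suc k) = j.
     of_int (sign \<pi>) * (\<Prod>a<k. v (\<pi> a) a))"
proof -
  have "det (minor_mat k v i j) = (\<Sum>\<pi> | \<pi> permutes {0..<k+2}. of_int (sign \<pi>) *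
     (\<Prod>a=0..<k+2. minor_mat k v i j $$ (a, \<pi> a)))"
    by (subst det_def') (auto simp: minor_mat_def intro!: sum.cong)
  also have "\<dots> = (\<Sum>\<pi> | \<pi> permutes {..<k+2}. if \<pi> k = i \<and> \<pi> (Suc k) = j then
     of_int (sign \<pi>) * (\<Prod>a<k. v (\<pi> a) a) else 0)"
  proof (intro sum.cong)
    fix \<pi> assume "\<pi> \<in> {\<pi>. \<pi> permutes {..<k+2}}"
    then have p: "\<pi> a < k + 2" if "a < k + 2" for a using that permutes_lessThan by blast
    have "(\<Prod>a=0..<k+2. minor_mat k v i j $$ (a, \<pi> a)) =
      (\<Prod>a<k. v (\<pi> a) a) * of_bool (\<pi> k = i) * of_bool (\<pi> (Suc k) = j)"
      using p by (simp add: minor_mat_def atLeast0LessThan)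
    then show "of_int (sign \<pi>) * (\<Prod>a=0..<k+2. minor_mat k v i j $$ (a, \<pi> a)) =
      (if \<pi> k = i \<and> \<pi> (Suc k) = j then of_int (sign \<pi>) * (\<Prod>a<k. v (\<pi> a) a) else 0)"
      by auto
  qed (auto simp: atLeast0LessThan)
  also have "\<dots> = (\<Sum>\<pi> | \<pi> permutes {..<k+2} \<and> \<pi> k = i \<and> \<pi> (Suc k) = j.
     of_int (sign \<pi>) * (\<Prod>a<k. v (\<pi> a) a))"
    by (subst sum.inter_filter[symmetric]) (auto simp: finite_permutations intro!: sum.cong)
  finally show ?thesis .
qed

text \<open>Both sides are the same double sum. The squared modulus expands into pairs
  \<open>(\<pi>, \<pi>')\<close> of permutations that send \<open>k\<close> to \<open>i\<close> and
  \<open>Suc k\<close> to \<open>j\<close>. Such a pair amounts to \<open>\<pi>\<close> and a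
  permutation \<open>\<sigma>\<close> of the rows below \<open>k\<close>, with \<open>\<pi>'\<close>
  the composition of \<open>\<pi>\<close> with the inverse of \<open>\<sigma>\<close>; and
  \<open>\<pi>\<close> is determined by its restriction to these rows, a bijection onto the
  remaining columns.\<close>

lemma mixed_coeff_rank_one:
  assumes ij: "i \<noteq> j" "i < k + 2" "j < k + 2"
  shows "mixed_coeff k (\<lambda>l. rank_one (v l)) ({..<k+2} - {i, j}) = of_real ((cmod (det (minor_mat k v i j)))\<^sup>2)"
proof -
  define P where "P = {\<pi>. \<pi> permutes {..<k+2} \<and> \<pi> k = i \<and> \<pi> (Suc k) = j}"
  define g where "g = (\<lambda>\<pi>. \<Prod>a<k. v (\<pi> a) a)"
  let ?S = "{\<sigma>. \<sigma> permutes {..<k}}"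
  let ?J = "{..<k+2} - {i, j}"
  have finP: "finite P" unfolding P_def by (rule finite_subset[OF _ finite_permutations[of "{..<k+2}"]]) auto
  have perm: "\<sigma> permutes {..<k+2}" if "\<sigma> permutes {..<k}" for \<sigma>
    by (rule permutes_subset[OF that]) auto
  have fixk: "\<sigma> k = k" "\<sigma> (Suc k) = Suc k" if "\<sigma> permutes {..<k}" for \<sigma>
    using permutes_not_in[OF that] by auto
  have inner: "(\<Sum>\<pi>'\<in>P. F \<pi>') = (\<Sum>\<sigma>\<in>?S. F (\<pi> \<circ> (inv_into UNIV \<sigma>)))" if \<pi>: "\<pi> \<in> P" for \<pi> and F :: "_ \<Rightarrow> complex"
  proof (rule sum.reindex_bij_witness[where i = "\<lambda>\<sigma>. \<pi> \<circ> (inv_into UNIV \<sigma>)" and j = "\<lambda>\<pi>'. (inv_into UNIV \<pi>') \<circ> \<pi>"])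
    have p: "\<pi> permutes {..<k+2}" "\<pi> k = i" "\<pi> (Suc k) = j" using \<pi> unfolding P_def by auto
    fix \<pi>' assume "\<pi>' \<in> P"
    then have p': "\<pi>' permutes {..<k+2}" "\<pi>' k = i" "\<pi>' (Suc k) = j" unfolding P_def by auto
    have q: "(inv_into UNIV \<pi>') \<circ> \<pi> permutes {..<k+2}"
      using permutes_compose[OF p(1) permutes_inv[OF p'(1)]] .
    show inve: "\<pi> \<circ> (inv_into UNIV ((inv_into UNIV \<pi>') \<circ> \<pi>)) = \<pi>'"
      by (simp add: o_inv_distrib[OF permutes_bij[OF permutes_inv[OF p'(1)]] permutes_bij[OF p(1)]]
          permutes_inv_inv[OF p'(1)] permutes_inv_o(1)[OF p(1)] flip: comp_assoc)
    have "((inv_into UNIV \<pi>') \<circ> \<pi>) k = k" "((inv_into UNIV \<pi>') \<circ> \<pi>) (Suc k) = Suc k"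
      using p p' permutes_inverses(2)[OF p'(1)] by (metis comp_apply)+
    then have "((inv_into UNIV \<pi>') \<circ> \<pi>) a = a" if "a \<in> {..<k+2} - {..<k}" for a
      using that by (cases "a = k") (auto simp: less_Suc_eq)
    then show "(inv_into UNIV \<pi>') \<circ> \<pi> \<in> ?S"
      by (intro CollectI permutes_superset[OF q])
    show "F (\<pi> \<circ> (inv_into UNIV ((inv_into UNIV \<pi>') \<circ> \<pi>))) = F \<pi>'" unfolding inve ..
  next
    have p: "\<pi> permutes {..<k+2}" "\<pi> k = i" "\<pi> (Suc k) = j" using \<pi> unfolding P_def by auto
    fix \<sigma> assume "\<sigma> \<in> ?S"
    then have s: "\<sigma> permutes {..<k}" by simp
    note s' = permutes_inv[OF s]
    show "\<pi> \<circ> (inv_into UNIV \<sigma>) \<in> P"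
      using permutes_compose[OF perm[OF s'] p(1)] fixk[OF s'] p unfolding P_def by auto
    show "inv_into UNIV (\<pi> \<circ> (inv_into UNIV \<sigma>)) \<circ> \<pi> = \<sigma>"
      by (simp add: o_inv_distrib[OF permutes_bij[OF p(1)] permutes_bij[OF s']]
          permutes_inv_inv[OF s] comp_assoc permutes_inv_o(2)[OF p(1)])
  qed
  \<comment> \<open>As \<open>sign \<pi>\<close> occurs twice, only \<open>sign \<sigma>\<close> is
    left. Reindexing the conjugated product by \<open>\<sigma>\<close> pairs the entries
    \<open>a\<close> and \<open>\<sigma> a\<close> of the same vector
    \<open>v (\<pi> a)\<close>.\<close>
  have tm: "of_int (sign \<pi>) * g \<pi> * cnj (of_int (sign (\<pi> \<circ> (inv_into UNIV \<sigma>))) * g (\<pi> \<circ> (inv_into UNIV \<sigma>)))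
     = of_int (sign \<sigma>) * (\<Prod>a<k. rank_one (v (\<pi> a)) a (\<sigma> a))"
    if \<pi>: "\<pi> \<in> P" and s: "\<sigma> permutes {..<k}" for \<pi> \<sigma>
  proof -
    have p: "\<pi> permutes {..<k+2}" using \<pi> unfolding P_def by auto
    have "g (\<pi> \<circ> (inv_into UNIV \<sigma>)) = (\<Prod>a<k. v (\<pi> a) (\<sigma> a))"
      unfolding g_def using prod_permute_inv[OF s, of "\<lambda>a b. v (\<pi> a) b"] by simp
    moreover have "sign (\<pi> \<circ> (inv_into UNIV \<sigma>)) = sign \<pi> * sign \<sigma>"
      using permutes_imp_permutation[OF _ p] permutes_imp_permutation[OF _ s]
      by (simp add: sign_compose sign_inverse permutation_inverse)
    moreover have "of_int (sign \<pi>) * of_int (sign \<pi>) = (1::complex)"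
      by (metis of_int_1 of_int_mult sign_idempotent)
    ultimately show ?thesis
      unfolding g_def rank_one_def by (simp add: prod.distrib mult_ac)
  qed
  have "of_real ((cmod (det (minor_mat k v i j)))\<^sup>2)
     = (\<Sum>\<pi>\<in>P. \<Sum>\<pi>'\<in>P. of_int (sign \<pi>) * g \<pi> * cnj (of_int (sign \<pi>') * g \<pi>'))"
    unfolding complex_norm_square det_minor_mat[OF ij] P_def[symmetric] g_def[symmetric]
    by (simp only: cnj_sum sum_product g_def)
  also have "\<dots> = (\<Sum>\<pi>\<in>P. \<Sum>\<sigma>\<in>?S. of_int (sign \<sigma>) * (\<Prod>a<k. rank_one (v (\<pi> a)) a (\<sigma> a)))"
  proof (rule sum.cong[OF refl])
    fix \<pi> assume \<pi>: "\<pi> \<in> P"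
    show "(\<Sum>\<pi>'\<in>P. of_int (sign \<pi>) * g \<pi> * cnj (of_int (sign \<pi>') * g \<pi>'))
      = (\<Sum>\<sigma>\<in>?S. of_int (sign \<sigma>) * (\<Prod>a<k. rank_one (v (\<pi> a)) a (\<sigma> a)))"
      unfolding inner[OF \<pi>] by (intro sum.cong refl tm[OF \<pi>]) simp
  qed
  also have "\<dots> = (\<Sum>\<tau>\<in>bijs {..<k} ?J. \<Sum>\<sigma>\<in>?S. of_int (sign \<sigma>) * (\<Prod>a<k. rank_one (v (\<tau> a)) a (\<sigma> a)))"
  proof (rule sum.reindex_bij_witness[where j = "\<lambda>\<pi>. restrict \<pi> {..<k}" and
        i = "\<lambda>\<tau> a. if a < k then \<tau> a else if a = k then i else if a = Suc k then j else a"])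
    fix \<pi> assume "\<pi> \<in> P"
    then have p: "\<pi> permutes {..<k+2}" "\<pi> k = i" "\<pi> (Suc k) = j" unfolding P_def by auto
    show "(\<lambda>a. if a < k then restrict \<pi> {..<k} a else if a = k then i else if a = Suc k then j else a) = \<pi>"
      using p permutes_not_in[OF p(1)] by (auto simp: fun_eq_iff)
    have "\<pi> ` {..<k} = \<pi> ` ({..<k+2} - {k, Suc k})" by (rule arg_cong[of _ _ "image \<pi>"]) auto
    also have "\<dots> = \<pi> ` {..<k+2} - \<pi> ` {k, Suc k}"
      by (rule image_set_diff) (rule permutes_inj[OF p(1)])
    also have "\<dots> = ?J" using permutes_image[OF p(1)] p by auto
    finally have im: "\<pi> ` {..<k} = ?J" .
    then show "restrict \<pi> {..<k} \<in> bijs {..<k} ?J"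
      using permutes_inj_on[OF p(1), of "{..<k}"] unfolding bijs_def bij_betw_def inj_on_restrict_eq
      by auto
    show "(\<Sum>\<sigma>\<in>?S. of_int (sign \<sigma>) * (\<Prod>a<k. rank_one (v (restrict \<pi> {..<k} a)) a (\<sigma> a)))
       = (\<Sum>\<sigma>\<in>?S. of_int (sign \<sigma>) * (\<Prod>a<k. rank_one (v (\<pi> a)) a (\<sigma> a)))"
      by (intro sum.cong refl) simp
  next
    fix \<tau> assume t: "\<tau> \<in> bijs {..<k} ?J"
    let ?p = "\<lambda>a. if a < k then \<tau> a else if a = k then i else if a = Suc k then j else a"
    show "restrict ?p {..<k} = \<tau>" using t unfolding bijs_def by (auto simp: fun_eq_iff PiE_def extensional_def)
    have b: "bij_betw \<tau> {..<k} ?J" by (rule bijsD(1)[OF t])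
    have "bij_betw ?p ({..<k} \<union> {k, Suc k}) (?J \<union> {i, j})"
    proof (rule bij_betw_combine)
      show "bij_betw ?p {..<k} ?J" using b by (simp add: bij_betw_def inj_on_def)
      show "bij_betw ?p {k, Suc k} {i, j}" using ij by (auto simp: bij_betw_def)
    qed auto
    moreover have "{..<k} \<union> {k, Suc k} = {..<k+2}" by auto
    moreover have "?J \<union> {i, j} = {..<k+2}" using ij by auto
    ultimately have "bij_betw ?p {..<k+2} {..<k+2}" by simp
    then have "?p permutes {..<k+2}" by (rule bij_imp_permutes) auto
    then show "?p \<in> P" unfolding P_def by simp
  qed
  finally show ?thesis unfolding mixed_coeff_def by simp
qed

section \<open>Pluecker relations for the minors\<close>

lemma det_mat_2: "det (mat 2 2 f) = f (0, 0) * f (1, 1) - f (0, 1) * f (1, 0::nat)" for f :: "nat \<times> nat \<Rightarrow> complex"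
proof -
  have e: "mat_delete (mat 2 2 f) 0 j = mat 1 1 (\<lambda>_. f (1, 1 - j))" if "j < 2" for j
    using that by (auto simp: mat_delete_def less_2_cases_iff)
  show ?thesis
    by (subst laplace_expansion_row[of _ 2 0])
      (simp_all add: cofactor_def e det_single lessThan_Suc lessThan_nat_numeral)
qed

text \<open>\<open>V\<close> and \<open>W\<close> agree in their first \<open>k\<close> rows, so the
  product of \<open>V\<close> with the inverse \<open>N\<close> of \<open>W\<close> starts with the
  first \<open>k\<close> rows of the identity, and its last two rows are the rows \<open>i\<close>
  and \<open>j\<close> of \<open>N\<close>. Its determinant is therefore a two by two minor of the
  last two columns \<open>x\<close> and \<open>y\<close> of \<open>N\<close>.\<close>

lemma det_minor_mat_pluecker:
  assumes d0: "det (minor_mat k v i0 j0) \<noteq> 0"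
  obtains x y where "\<And>i j. i < k + 2 \<Longrightarrow> j < k + 2 \<Longrightarrow>
    det (minor_mat k v i j) = det (minor_mat k v i0 j0) * (x i * y j - x j * y i)"
proof -
  let ?m = "k + 2"
  define W where "W = minor_mat k v i0 j0"
  have W: "W \<in> carrier_mat ?m ?m" unfolding W_def minor_mat_def by auto
  from det_non_zero_imp_unit[OF W d0[folded W_def], of "()"]
  obtain N where N: "N \<in> carrier_mat ?m ?m" "N * W = 1\<^sub>m ?m" "W * N = 1\<^sub>m ?m"
    unfolding Units_def ring_mat_def by auto
  define x y where "x = (\<lambda>i. N $$ (i, k))" and "y = (\<lambda>i. N $$ (i, Suc k))"
  show ?thesis
  proof (rule that)
    fix i j assume ij: "i < k + 2" "j < k + 2"
    define V where "V = minor_mat k v i j"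
    have V: "V \<in> carrier_mat ?m ?m" unfolding V_def minor_mat_def by auto
    define C where "C = mat 2 k (\<lambda>(a, b). N $$ (if a = 0 then i else j, b))"
    define D where "D = mat 2 2 (\<lambda>(a, b). N $$ (if a = 0 then i else j, k + b))"
    have idx: "(V * N) $$ (a, b) = four_block_mat (1\<^sub>m k) (0\<^sub>m k 2) C D $$ (a, b)"
      if ab: "a < ?m" "b < ?m" for a b
    proof -
      have VN: "(V * N) $$ (a, b) = (\<Sum>c<?m. V $$ (a, c) * N $$ (c, b))"
        using V N(1) ab by (auto simp: scalar_prod_def lessThan_atLeast0)
      consider "a < k" | "a = k" | "a = Suc k" using ab by linarith
      then show ?thesis
      proof cases
        case 1
        have "(\<Sum>c<?m. V $$ (a, c) * N $$ (c, b)) = (\<Sum>c<?m. W $$ (a, c) * N $$ (c, b))"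
          using 1 by (intro sum.cong) (auto simp: V_def W_def minor_mat_def)
        also have "\<dots> = (W * N) $$ (a, b)"
          using W N(1) ab by (auto simp: scalar_prod_def lessThan_atLeast0)
        finally show ?thesis using 1 ab unfolding VN N(3) C_def D_def by (auto simp: index_mat_four_block)
      next
        case 2
        have "(\<Sum>c<?m. V $$ (a, c) * N $$ (c, b)) = (\<Sum>c<?m. if c = i then N $$ (i, b) else 0)"
          using 2 by (intro sum.cong) (auto simp: V_def minor_mat_def)
        then show ?thesis using 2 ab ij unfolding VN C_def D_def by (auto simp: index_mat_four_block)
      next
        case 3
        have "(\<Sum>c<?m. V $$ (a, c) * N $$ (c, b)) = (\<Sum>c<?m. if c = j then N $$ (j, b) else 0)"
          using 3 by (intro sum.cong) (auto simp: V_def minor_mat_def)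
        then show ?thesis using 3 ab ij unfolding VN C_def D_def by (auto simp: index_mat_four_block)
      qed
    qed
    have "V * N = four_block_mat (1\<^sub>m k) (0\<^sub>m k 2) C D"
      using V N(1) idx by (intro eq_matI) (auto simp: C_def D_def)
    then have "det (V * N) = det (1\<^sub>m k) * det D"
      by (simp only:) (rule det_four_block_mat_upper_right_zero; auto simp: C_def D_def)
    also have "\<dots> = x i * y j - x j * y i"
      unfolding D_def det_mat_2 by (simp add: x_def y_def)
    finally have VN: "det (V * N) = x i * y j - x j * y i" .
    have "V * N * W = V" using V N(1,2) W by (simp add: assoc_mult_mat[OF V N(1) W])
    then have "det V = det (V * N) * det W" 
      using det_mult[of "V * N" ?m W] V N(1) W by simp
    then show "det (minor_mat k v i j) = det (minor_mat k v i0 j0) * (x i * y j - x j * y i)"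
      unfolding VN unfolding V_def W_def by (simp only: mult.commute)
  qed
qed

definition bilin :: "nat \<Rightarrow> (nat \<Rightarrow> nat \<Rightarrow> real) \<Rightarrow> (nat \<Rightarrow> real) \<Rightarrow> (nat \<Rightarrow> real) \<Rightarrow> real" where
  "bilin m A u w = (\<Sum>i<m. \<Sum>j<m. A i j * u i * w j)"

text \<open>Expanding the squared modulus turns the form into
  \<open>D * (2 * a * b - 2 * (cmod c)\<^sup>2)\<close> with the sums \<open>a\<close>,
  \<open>b\<close>, \<open>c\<close> below, and \<open>a\<close> vanishes by assumption.\<close>

lemma bilin_pluecker_nonpos:
  fixes x y :: "nat \<Rightarrow> complex"
  assumes "\<And>i j. i < m \<Longrightarrow> j < m \<Longrightarrow> A i j = D * (cmod (x i * y j - x j * y i))\<^sup>2" "D \<ge> 0"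
    and "(\<Sum>i<m. (cmod (x i))\<^sup>2 * u i) = 0"
  shows "bilin m A u u \<le> 0"
proof -
  define a b where "a = (\<Sum>i<m. (cmod (x i))\<^sup>2 * u i)" and "b = (\<Sum>i<m. (cmod (y i))\<^sup>2 * u i)"
  define c where "c = (\<Sum>i<m. x i * cnj (y i) * of_real (u i))"
  have t: "complex_of_real ((cmod (x i * y j - x j * y i))\<^sup>2 * u i * u j)
     = (of_real ((cmod (x i))\<^sup>2 * u i) * of_real ((cmod (y j))\<^sup>2 * u j)
      + of_real ((cmod (y i))\<^sup>2 * u i) * of_real ((cmod (x j))\<^sup>2 * u j))
      - ((x i * cnj (y i) * of_real (u i)) * cnj (x j * cnj (y j) * of_real (u j))
      + cnj (x i * cnj (y i) * of_real (u i)) * (x j * cnj (y j) * of_real (u j)))" for i j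
    unfolding of_real_mult complex_norm_square by (simp add: algebra_simps)
  have "complex_of_real (\<Sum>i<m. \<Sum>j<m. (cmod (x i * y j - x j * y i))\<^sup>2 * u i * u j)
     = (of_real a * of_real b + of_real b * of_real a) - (c * cnj c + cnj c * c)"
    unfolding of_real_sum t sum_subtractf sum.distrib a_def b_def c_def cnj_sum
    by (simp only: sum_product of_real_sum)
  also have "\<dots> = of_real (- 2 * (cmod c)\<^sup>2)"
    using assms(3) unfolding a_def[symmetric]
    by (simp only: of_real_mult complex_norm_square) (simp add: mult.commute)
  finally have e: "(\<Sum>i<m. \<Sum>j<m. (cmod (x i * y j - x j * y i))\<^sup>2 * u i * u j) = - 2 * (cmod c)\<^sup>2"
    by (simp only: of_real_eq_iff)
  have "bilin m A u u = D * (\<Sum>i<m. \<Sum>j<m. (cmod (x i * y j - x j * y i))\<^sup>2 * u i * u j)"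
    unfolding bilin_def sum_distrib_left using assms(1) by (intro sum.cong refl) auto
  then show ?thesis unfolding e using assms(2) by (simp add: mult_nonneg_nonneg)
qed

section \<open>Bilinear forms that are nonpositive on a hyperplane\<close>

lemma bilin_row:
  assumes "\<And>i j. A i j = A j i"
  shows "bilin m A u w = (\<Sum>j<m. w j * (\<Sum>i<m. A j i * u i))"
  unfolding bilin_def
  by (subst sum.swap) (auto simp: sum_distrib_left assms mult_ac intro!: sum.cong)

lemma bilin_lincomb:
  assumes "\<And>i j. A i j = A j i"
  shows "bilin m A (\<lambda>i. p * u i + q * w i) (\<lambda>i. p * u i + q * w i)
    = p\<^sup>2 * bilin m A u u + 2 * p * q * bilin m A u w + q\<^sup>2 * bilin m A w w"
proof -
  have "bilin m A w u = bilin m A u w"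
    unfolding bilin_def by (subst sum.swap) (auto simp: assms mult_ac intro!: sum.cong)
  moreover have "bilin m A (\<lambda>i. p * u i + q * w i) (\<lambda>i. p * u i + q * w i)
    = p\<^sup>2 * bilin m A u u + p * q * bilin m A u w + p * q * bilin m A w u + q\<^sup>2 * bilin m A w w"
    unfolding bilin_def sum_distrib_left sum.distrib[symmetric]
    by (intro sum.cong refl) (simp add: algebra_simps power2_eq_square)
  ultimately show ?thesis by simp
qed

lemma sum_two_point:
  fixes i l m :: nat and f :: "nat \<Rightarrow> real"
  assumes "i < m" "l < m"
  shows "(\<Sum>j<m. (c * of_bool (j = i) + d * of_bool (j = l)) * f j) = c * f i + d * f l"
proof -
  have "(\<Sum>j<m. (c * of_bool (j = i) + d * of_bool (j = l)) * f j)
     = (\<Sum>j<m. if j = i then c * f i else 0) + (\<Sum>j<m. if j = l then d * f l else 0)"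
    unfolding sum.distrib[symmetric] by (intro sum.cong) (auto simp: algebra_simps)
  then show ?thesis using assms by simp
qed

definition nonpos_on_row :: "nat \<Rightarrow> (nat \<Rightarrow> nat \<Rightarrow> real) \<Rightarrow> nat \<Rightarrow> bool" where
  "nonpos_on_row m A l \<longleftrightarrow> (\<forall>w. (\<Sum>j<m. A l j * w j) = 0 \<longrightarrow> bilin m A w w \<le> 0)"

lemma nonpos_on_rowD: "nonpos_on_row m A l \<Longrightarrow> (\<Sum>j<m. A l j * w j) = 0 \<Longrightarrow> bilin m A w w \<le> 0"
  unfolding nonpos_on_row_def by (drule spec, erule mp)

text \<open>
  If the form were positive at \<open>w\<close>, it would be positive definite on the span of \<open>w\<close> and
  \<open>y = e\<^sub>i + t e\<^sub>l\<close> for large \<open>t\<close>, but this plane meets the kernel of \<open>\<phi>\<close>.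
\<close>

lemma nonpos_on_row_transfer:
  assumes sym: "\<And>i j. A i j = A j i" and diag: "\<And>i. A i i = 0"
    and \<phi>: "\<And>u. (\<Sum>j<m. \<phi> j * u j) = 0 \<Longrightarrow> bilin m A u u \<le> 0"
    and il: "i < m" "l < m" "A l i > 0"
  shows "nonpos_on_row m A l"
  unfolding nonpos_on_row_def
proof (intro allI impI)
  fix w assume w: "(\<Sum>j<m. A l j * w j) = 0"
  show "bilin m A w w \<le> 0"
  proof (rule ccontr)
    assume "\<not> bilin m A w w \<le> 0"
    then have W: "bilin m A w w > 0" by simp
    define q where "q = (\<Sum>j<m. A i j * w j)"
    \<comment> \<open>Chosen so that the Gram determinant of \<open>w\<close> and \<open>y\<close>
      is \<open>1\<close>: \<open>bilin m A y y\<close> is \<open>2 * t * A l i\<close>, and the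
      mixed value is \<open>q\<close>.\<close>
    define t where "t = (q\<^sup>2 + 1) / (2 * A l i * bilin m A w w)"
    define y where "y = (\<lambda>j. 1 * of_bool (j = i) + t * of_bool (j = l))"
    have Ay: "(\<Sum>c<m. A j c * y c) = A j i + t * A j l" for j
      using sum_two_point[OF il(1,2), of 1 t "A j"] unfolding y_def by (simp add: mult.commute)
    have wy: "bilin m A w y = q"
      unfolding bilin_row[OF sym] y_def sum_two_point[OF il(1,2)] using w by (simp add: q_def)
    have yy: "bilin m A y y = 2 * t * A l i"
      unfolding bilin_row[OF sym] Ay unfolding y_def sum_two_point[OF il(1,2)]
      using diag sym[of i l] by simp
    have tt: "2 * t * A l i * bilin m A w w = q\<^sup>2 + 1"
      unfolding t_def using il(3) W by (simp add: field_simps)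
    define P Q where "P = (\<Sum>j<m. \<phi> j * y j)" and "Q = (\<Sum>j<m. \<phi> j * w j)"
    have Q0: "Q \<noteq> 0" using \<phi>[of w] W unfolding Q_def by auto
    \<comment> \<open>The combination of \<open>w\<close> and \<open>y\<close> on which
      \<open>\<phi>\<close> vanishes; \<open>Q \<noteq> 0\<close> makes its coefficients
      nontrivial.\<close>
    have "(\<Sum>j<m. \<phi> j * (P * w j + (- Q) * y j)) = P * (\<Sum>j<m. \<phi> j * w j) - Q * (\<Sum>j<m. \<phi> j * y j)"
      by (simp add: sum_distrib_left sum_subtractf algebra_simps)
    also have "\<dots> = 0" unfolding P_def[symmetric] Q_def[symmetric] by simp
    finally have "(\<Sum>j<m. \<phi> j * (P * w j + (- Q) * y j)) = 0" .
    then have "bilin m A (\<lambda>j. P * w j + (- Q) * y j) (\<lambda>j. P * w j + (- Q) * y j) \<le> 0"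
      by (rule \<phi>)
    then have "P\<^sup>2 * bilin m A w w - 2 * P * Q * q + Q\<^sup>2 * (2 * t * A l i) \<le> 0"
      unfolding bilin_lincomb[OF sym] wy yy by simp
    then have "bilin m A w w * (P\<^sup>2 * bilin m A w w - 2 * P * Q * q + Q\<^sup>2 * (2 * t * A l i)) \<le> 0"
      using W by (simp add: mult_le_0_iff)
    also have "bilin m A w w * (P\<^sup>2 * bilin m A w w - 2 * P * Q * q + Q\<^sup>2 * (2 * t * A l i))
      = (P * bilin m A w w - Q * q)\<^sup>2 + Q\<^sup>2 * (2 * t * A l i * bilin m A w w - q\<^sup>2)"
      by (simp add: algebra_simps power2_eq_square)
    also have "\<dots> = (P * bilin m A w w - Q * q)\<^sup>2 + Q\<^sup>2" unfolding tt by simp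
    finally show False using Q0 by (simp add: sum_power2_le_zero_iff)
  qed
qed

text \<open>Since the diagonal entry at \<open>l\<close> is zero, \<open>w l\<close> enters only
  through the pairing with row \<open>l\<close>. On the hyperplane orthogonal to that row the form
  is thus computed from entries outside row and column \<open>l\<close>. For a coefficient matrix
  these are the only ones in which \<open>B l\<close> occurs, and they are linear in it.\<close>

lemma bilin_split_row:
  assumes "\<And>i j. A i j = A j i" "A l l = 0" "l < m"
  shows "bilin m A w w = 2 * w l * (\<Sum>j<m. A l j * w j) + bilin m A (w(l := 0)) (w(l := 0))"
proof -
  let ?e = "\<lambda>j. 0 * of_bool (j = l) + w l * of_bool (j = l)"
  have w: "w = (\<lambda>j. 1 * (w(l := 0)) j + 1 * ?e j)" by (auto simp: fun_eq_iff)
  have row: "(\<Sum>j<m. A c j * ?e j) = w l * A c l" for c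
    using sum_two_point[OF assms(3,3), of 0 "w l" "A c"] by (simp add: mult.commute)
  have "bilin m A w w = bilin m A (w(l := 0)) (w(l := 0)) + 2 * bilin m A (w(l := 0)) ?e + bilin m A ?e ?e"
    by (subst (1 2) w, subst bilin_lincomb[OF assms(1)]) simp
  also have "bilin m A (w(l := 0)) ?e = w l * (\<Sum>j<m. A l j * (w(l := 0)) j)"
    unfolding bilin_row[OF assms(1)] sum_two_point[OF assms(3,3)] by simp
  also have "(\<Sum>j<m. A l j * (w(l := 0)) j) = (\<Sum>j<m. A l j * w j)"
    using assms(2) by (intro sum.cong) auto
  also have "bilin m A ?e ?e = 0"
    unfolding bilin_row[OF assms(1)] row sum_two_point[OF assms(3,3)] using assms(2) by simp
  finally show ?thesis by (simp add: fun_upd_def)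
qed

text \<open>The hyperplane moves with \<open>e\<close>, so the test vector has to follow:
  subtracting \<open>s e\<close> times the unit vector at \<open>i\<close> puts \<open>w\<close> on
  the hyperplane of \<open>A' e\<close>. The condition \<open>A l i > 0\<close> keeps the
  denominator of \<open>s\<close> away from zero.\<close>

lemma nonpos_on_row_limit:
  assumes lim: "\<And>i j. i < m \<Longrightarrow> j < m \<Longrightarrow> ((\<lambda>e. A' e i j) \<longlongrightarrow> A i j) F" and F: "F \<noteq> bot"
    and ev: "eventually (\<lambda>e. nonpos_on_row m (A' e) l) F"
    and il: "i < m" "l < m" "A l i > 0"
  shows "nonpos_on_row m A l"
  unfolding nonpos_on_row_def
proof (intro allI impI)
  fix w assume w: "(\<Sum>j<m. A l j * w j) = 0"
  define s where "s = (\<lambda>e. (\<Sum>j<m. A' e l j * w j) / A' e l i)"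
  define w' where "w' = (\<lambda>e j. w j - s e * of_bool (j = i))"
  have "((\<lambda>e. s e) \<longlongrightarrow> (\<Sum>j<m. A l j * w j) / A l i) F"
    unfolding s_def using il lim by (intro tendsto_intros) auto
  then have s0: "(s \<longlongrightarrow> 0) F" using w by simp
  have w'w: "((\<lambda>e. w' e j) \<longlongrightarrow> w j) F" for j
    using tendsto_diff[OF tendsto_const tendsto_mult[OF s0 tendsto_const]] unfolding w'_def by fastforce
  have "((\<lambda>e. bilin m (A' e) (w' e) (w' e)) \<longlongrightarrow> bilin m A w w) F"
    unfolding bilin_def by (intro tendsto_intros w'w lim) auto
  moreover have "eventually (\<lambda>e. A' e l i > 0) F"
    using order_tendstoD(1)[OF lim[OF il(2,1)] il(3)] .
  with ev have "eventually (\<lambda>e. bilin m (A' e) (w' e) (w' e) \<le> 0) F"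
  proof eventually_elim
    case (elim e)
    have "(\<Sum>j<m. A' e l j * w' e j) = (\<Sum>j<m. A' e l j * w j) - (\<Sum>j<m. if j = i then s e * A' e l i else 0)"
      unfolding w'_def sum_subtractf[symmetric] by (intro sum.cong) (auto simp: algebra_simps)
    also have "\<dots> = 0" using il(1) elim(2) by (simp add: s_def)
    finally show ?case using elim(1) unfolding nonpos_on_row_def by blast
  qed
  ultimately show "bilin m A w w \<le> 0" using F by (rule tendsto_upperbound)
qed

text \<open>An isotropic vector of a semidefinite form is orthogonal to the whole space. The space
  here is the hyperplane, so the image of \<open>w\<close> under \<open>A\<close> annihilates the
  hyperplane and is a multiple of row \<open>l\<close>.\<close>

lemma nonpos_on_row_degenerate:
  assumes sym: "\<And>i j. A i j = A j i" and "nonpos_on_row m A l" "l < m"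
    and w: "(\<Sum>j<m. A l j * w j) = 0" "bilin m A w w = 0"
    and j: "j < m" "A l j > 0"
  obtains \<mu> where "\<And>i. i < m \<Longrightarrow> (\<Sum>c<m. A i c * w c) = \<mu> * A l i"
proof (rule that)
  fix i assume i: "i < m"
  \<comment> \<open>For varying \<open>i\<close> these vectors span the hyperplane.\<close>
  define z where "z = (\<lambda>c. A l j * of_bool (c = i) + (- A l i) * of_bool (c = j))"
  have wz: "bilin m A w z = A l j * (\<Sum>c<m. A i c * w c) - A l i * (\<Sum>c<m. A j c * w c)"
    unfolding bilin_row[OF sym] z_def sum_two_point[OF i j(1)] by simp
  have lz: "(\<Sum>c<m. A l c * z c) = 0"
    using sum_two_point[OF i j(1), of "A l j" "- A l i" "A l"] unfolding z_def by (simp add: mult.commute)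
  have le: "2 * t * bilin m A w z + t\<^sup>2 * bilin m A z z \<le> 0" for t
  proof -
    have "(\<Sum>c<m. A l c * (1 * w c + t * z c)) = (\<Sum>c<m. A l c * w c) + t * (\<Sum>c<m. A l c * z c)"
      by (simp add: sum_distrib_left sum.distrib algebra_simps)
    then have "(\<Sum>c<m. A l c * (1 * w c + t * z c)) = 0" unfolding w lz by simp
    then have "bilin m A (\<lambda>c. 1 * w c + t * z c) (\<lambda>c. 1 * w c + t * z c) \<le> 0"
      by (rule nonpos_on_rowD[OF assms(2)])
    then show ?thesis unfolding bilin_lincomb[OF sym] using w by simp
  qed
  define b zz where "b = bilin m A w z" and "zz = bilin m A z z"
  have "b = 0"
  proof (rule ccontr)
    assume b: "b \<noteq> 0"
    \<comment> \<open>At \<open>t = b / d\<close> the polynomial in \<open>le\<close> equals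
      \<open>(b / d)\<^sup>2 * (2 * d + zz)\<close>, which is positive because \<open>d\<close>
      exceeds \<open>\<bar>zz\<bar>\<close>.\<close>
    define d where "d = \<bar>zz\<bar> + 1"
    have d: "d > 0" unfolding d_def by linarith
    have "2 * (b / d) * b + (b / d)\<^sup>2 * zz \<le> 0" unfolding b_def zz_def by (rule le)
    moreover have "2 * (b / d) * b + (b / d)\<^sup>2 * zz = (b / d)\<^sup>2 * (2 * d + zz)"
      using d by (simp add: field_simps power2_eq_square)
    moreover have "d \<ge> 1" "d \<ge> - zz" unfolding d_def by auto
    then have "2 * d + zz > 0" by linarith
    moreover have "(b / d)\<^sup>2 > 0" using b d by simp
    moreover note \<open>2 * d + zz > 0\<close>
    ultimately show False using mult_pos_pos[of "(b / d)\<^sup>2" "2 * d + zz"] by linarith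
  qed
  then have "A l j * (\<Sum>c<m. A i c * w c) = A l i * (\<Sum>c<m. A j c * w c)" using wz unfolding b_def by simp
  then show "(\<Sum>c<m. A i c * w c) = (\<Sum>c<m. A j c * w c) / A l j * A l i" using j(2) by (simp add: field_simps)
qed

section \<open>Signature of the coefficient matrix\<close>

text \<open>For Hermitian families the coefficients are real, so the real part loses nothing there
  and allows signatures to be treated with real quadratic forms.\<close>

definition coeff_mat :: "nat \<Rightarrow> (nat \<Rightarrow> nat \<Rightarrow> nat \<Rightarrow> complex) \<Rightarrow> nat \<Rightarrow> nat \<Rightarrow> real" where
  "coeff_mat k B i j = (if i = j then 0 else Re (mixed_coeff k B ({..<k+2} - {i, j})))"

lemma coeff_mat_sym: "coeff_mat k B i j = coeff_mat k B j i"
  unfolding coeff_mat_def by (simp add: insert_commute)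

lemma coeff_mat_diag [simp]: "coeff_mat k B i i = 0"
  unfolding coeff_mat_def by simp

lemma coeff_mat_cong:
  assumes "\<And>l a b. l < k + 2 \<Longrightarrow> a < k \<Longrightarrow> b < k \<Longrightarrow> B l a b = B' l a b"
  shows "coeff_mat k B i j = coeff_mat k B' i j"
  unfolding coeff_mat_def using assms by (auto intro!: arg_cong[of _ _ Re] mixed_coeff_cong)

lemma coeff_mat_row_upd:
  assumes "i = l \<or> j = l"
  shows "coeff_mat k (B(l := X)) i j = coeff_mat k B i j"
proof -
  have "mixed_coeff k (B(l := X)) ({..<k+2} - {i, j}) = mixed_coeff k B ({..<k+2} - {i, j})"
    by (rule mixed_coeff_cong) (use assms in auto)
  then show ?thesis unfolding coeff_mat_def by simp
qed

lemma coeff_mat_linear: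
  assumes "l < k + 2" "finite R" "i \<noteq> l" "j \<noteq> l"
  shows "coeff_mat k (B(l := \<lambda>a b. \<Sum>r\<in>R. of_real (s r) * Z r a b)) i j
    = (\<Sum>r\<in>R. s r * coeff_mat k (B(l := Z r)) i j)"
proof -
  have "l \<in> {..<k+2} - {i, j}" using assms by auto
  then show ?thesis unfolding coeff_mat_def using assms(2) by (simp add: mixed_coeff_linear)
qed

lemma coeff_mat_rank_one:
  assumes "i < k + 2" "j < k + 2" "i \<noteq> j"
  shows "coeff_mat k (\<lambda>l. rank_one (v l)) i j = (cmod (det (minor_mat k v i j)))\<^sup>2"
  unfolding coeff_mat_def using mixed_coeff_rank_one[OF assms(3,1,2), of v] assms(3) by simp

text \<open>The state of an induction on \<open>F\<close>: an index in \<open>F\<close> carries the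
  sum of its \<open>k\<close> rank one summands, any other index a single summand. Inserting
  \<open>l\<close> into \<open>F\<close> makes the matrix at \<open>l\<close> a sum over
  \<open>r\<close>, each term of which gives a family with state \<open>F\<close>.\<close>

definition rank_one_sums :: "nat \<Rightarrow> (nat \<Rightarrow> nat \<Rightarrow> nat \<Rightarrow> complex) \<Rightarrow> nat set \<Rightarrow> (nat \<Rightarrow> nat \<Rightarrow> nat \<Rightarrow> complex) \<Rightarrow> bool" where
  "rank_one_sums k b F B \<longleftrightarrow> (\<forall>l<k+2. if l \<in> F then B l = (\<lambda>x y. \<Sum>r<k. rank_one (b l r) x y)
     else (\<exists>r<k. B l = rank_one (b l r)))"

lemma rank_one_sums_insert:
  assumes "rank_one_sums k b (insert l F) B" "l < k + 2" "l \<notin> F"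
  shows "B = B(l := \<lambda>x y. \<Sum>r<k. of_real 1 * rank_one (b l r) x y)"
    and "r < k \<Longrightarrow> rank_one_sums k b F (B(l := rank_one (b l r)))"
proof -
  have "B l = (\<lambda>x y. \<Sum>r<k. rank_one (b l r) x y)"
    using assms unfolding rank_one_sums_def by (auto dest!: spec[of _ l])
  then show "B = B(l := \<lambda>x y. \<Sum>r<k. of_real 1 * rank_one (b l r) x y)" by (simp add: fun_eq_iff)
  show "rank_one_sums k b F (B(l := rank_one (b l r)))" if "r < k"
    using assms(1,3) that unfolding rank_one_sums_def by auto
qed

text \<open>
  Genericity keeps the off-diagonal entries of the coefficient matrix positive, without which
  nonpositivity could not be transferred from one row to another.
\<close>

definition generic_vectors :: "nat \<Rightarrow> (nat \<Rightarrow> nat \<Rightarrow> nat \<Rightarrow> complex) \<Rightarrow> bool" where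
  "generic_vectors k b \<longleftrightarrow> (\<forall>c i j. (\<forall>l<k+2. c l < k) \<longrightarrow> i < k + 2 \<longrightarrow> j < k + 2 \<longrightarrow> i \<noteq> j \<longrightarrow>
     det (minor_mat k (\<lambda>l. b l (c l)) i j) \<noteq> 0)"

text \<open>For rank one families the entries are squares of nonzero minors, and linearity adds up
  positive numbers. An entry in row or column \<open>l\<close> does not see the matrix at
  \<open>l\<close>, so any one summand can replace it; \<open>k > 0\<close> provides one.\<close>

lemma coeff_mat_generic_pos:
  assumes "finite F" "generic_vectors k b" "k > 0"
  shows "rank_one_sums k b F B \<Longrightarrow> i < k + 2 \<Longrightarrow> j < k + 2 \<Longrightarrow> i \<noteq> j \<Longrightarrow> 0 < coeff_mat k B i j"
  using assms(1)
proof (induction F arbitrary: B rule: finite_induct)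
  case empty
  then have "\<forall>l. \<exists>r. l < k + 2 \<longrightarrow> r < k \<and> B l = rank_one (b l r)" unfolding rank_one_sums_def by auto
  then obtain c where c: "\<And>l. l < k + 2 \<Longrightarrow> c l < k \<and> B l = rank_one (b l (c l))" by metis
  have "coeff_mat k B i j = coeff_mat k (\<lambda>l. rank_one (b l (c l))) i j"
    by (rule coeff_mat_cong) (use c in auto)
  also have "\<dots> = (cmod (det (minor_mat k (\<lambda>l. b l (c l)) i j)))\<^sup>2"
    by (rule coeff_mat_rank_one) (use empty in auto)
  also have "\<dots> > 0" using assms(2) empty c unfolding generic_vectors_def by auto
  finally show ?case .
next
  case (insert l F)
  show ?case
  proof (cases "l < k + 2")
    case False
    then have "rank_one_sums k b F B" using insert.prems(1) unfolding rank_one_sums_def by auto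
    then show ?thesis using insert by blast
  next
    case True
    note B = rank_one_sums_insert[OF insert.prems(1) True insert.hyps(2)]
    have pos: "0 < coeff_mat k (B(l := rank_one (b l r))) i j" if "r < k" for r
      by (rule insert.IH[OF B(2)[OF that]]) (use insert.prems in auto)
    show ?thesis
    proof (cases "i = l \<or> j = l")
      case True
      then show ?thesis using pos[OF assms(3)] coeff_mat_row_upd[OF True] by metis
    next
      case False
      have "coeff_mat k B i j = (\<Sum>r<k. 1 * coeff_mat k (B(l := rank_one (b l r))) i j)"
        by (subst B(1), rule coeff_mat_linear) (use True False in auto)
      also have "\<dots> > 0" using pos assms(3) by (intro sum_pos) auto
      finally show ?thesis .
    qed
  qed
qed

text \<open>The summation over \<open>r\<close> is possible only for the row of the inserted index
  \<open>l'\<close>, whose hyperplane all the summands share. Another row \<open>l\<close> is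
  reached from there by \<open>nonpos_on_row_transfer\<close>, which is where the positive entries
  are spent.\<close>

lemma nonpos_on_row_generic:
  assumes "finite F" "generic_vectors k b" "k > 0"
  shows "rank_one_sums k b F B \<Longrightarrow> l < k + 2 \<Longrightarrow> nonpos_on_row (k + 2) (coeff_mat k B) l"
  using assms(1)
proof (induction F arbitrary: B l rule: finite_induct)
  case empty
  then have "\<forall>l. \<exists>r. l < k + 2 \<longrightarrow> r < k \<and> B l = rank_one (b l r)" unfolding rank_one_sums_def by auto
  then obtain c where c: "\<And>l. l < k + 2 \<Longrightarrow> c l < k \<and> B l = rank_one (b l (c l))" by metis
  let ?v = "\<lambda>l. b l (c l)"
  have B: "coeff_mat k B i j = (cmod (det (minor_mat k ?v i j)))\<^sup>2"
    if "i < k + 2" "j < k + 2" "i \<noteq> j" for i j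
  proof -
    have "coeff_mat k B i j = coeff_mat k (\<lambda>l. rank_one (b l (c l))) i j"
      by (rule coeff_mat_cong) (use c in auto)
    then show ?thesis using coeff_mat_rank_one[OF that] by simp
  qed
  have "det (minor_mat k ?v 0 1) \<noteq> 0" using assms(2) c unfolding generic_vectors_def by auto
  from det_minor_mat_pluecker[OF this] obtain x y where xy: "\<And>i j. i < k + 2 \<Longrightarrow> j < k + 2 \<Longrightarrow>
    det (minor_mat k ?v i j) = det (minor_mat k ?v 0 1) * (x i * y j - x j * y i)" by blast
  have eq: "coeff_mat k B i j = (cmod (det (minor_mat k ?v 0 1)))\<^sup>2 * (cmod (x i * y j - x j * y i))\<^sup>2"
    if "i < k + 2" "j < k + 2" for i j
    using that xy[OF that] B[OF that]
    by (cases "i = j") (auto simp: norm_mult power_mult_distrib)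
  obtain i where i: "i < k + 2" "i \<noteq> l" by (metis zero_less_Suc less_Suc_eq_0_disj add_2_eq_Suc' One_nat_def zero_neq_one lessI)
  show ?case
  proof (rule nonpos_on_row_transfer[OF coeff_mat_sym coeff_mat_diag _ i(1) empty(2)])
    show "bilin (k + 2) (coeff_mat k B) u u \<le> 0" if "(\<Sum>j<k + 2. (cmod (x j))\<^sup>2 * u j) = 0" for u
      by (rule bilin_pluecker_nonpos[OF eq _ that]) auto
    show "0 < coeff_mat k B l i"
      by (rule coeff_mat_generic_pos[OF finite.emptyI assms(2,3) empty(1)]) (use i empty in auto)
  qed
next
  case (insert l' F)
  show ?case
  proof (cases "l' < k + 2")
    case False
    then have "rank_one_sums k b F B" using insert.prems(1) unfolding rank_one_sums_def by auto
    then show ?thesis using insert by blast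
  next
    case True
    note B = rank_one_sums_insert[OF insert.prems(1) True insert.hyps(2)]
    let ?B = "\<lambda>r. B(l' := rank_one (b l' r))"
    have main: "bilin (k + 2) (coeff_mat k B) w w \<le> 0" if w: "(\<Sum>j<k+2. coeff_mat k B l' j * w j) = 0" for w
    proof -
      define w' where "w' = w(l' := 0)"
      have row: "(\<Sum>j<k+2. coeff_mat k (?B r) l' j * w j) = 0" for r
        using w by (simp add: coeff_mat_row_upd)
      have "bilin (k + 2) (coeff_mat k B) w w = bilin (k + 2) (coeff_mat k B) w' w'"
        using bilin_split_row[of "coeff_mat k B", OF coeff_mat_sym coeff_mat_diag True, of w] w
        unfolding w'_def by simp
      also have "\<dots> = (\<Sum>r<k. bilin (k + 2) (coeff_mat k (?B r)) w' w')"
      proof -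
        have "coeff_mat k B i j * w' i * w' j = (\<Sum>r<k. coeff_mat k (?B r) i j * w' i * w' j)" for i j
        proof (cases "i = l' \<or> j = l'")
          case False
          have "coeff_mat k B i j = (\<Sum>r<k. 1 * coeff_mat k (?B r) i j)"
            by (subst B(1), rule coeff_mat_linear) (use True False in auto)
          then show ?thesis by (simp add: sum_distrib_right)
        qed (auto simp: w'_def)
        then have "bilin (k + 2) (coeff_mat k B) w' w'
          = (\<Sum>i<k+2. \<Sum>j<k+2. \<Sum>r<k. coeff_mat k (?B r) i j * w' i * w' j)"
          unfolding bilin_def by simp
        also have "\<dots> = (\<Sum>i<k+2. \<Sum>r<k. \<Sum>j<k+2. coeff_mat k (?B r) i j * w' i * w' j)"
          by (intro sum.cong refl sum.swap)
        also have "\<dots> = (\<Sum>r<k. \<Sum>i<k+2. \<Sum>j<k+2. coeff_mat k (?B r) i j * w' i * w' j)"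
          by (rule sum.swap)
        finally show ?thesis unfolding bilin_def .
      qed
      also have "\<dots> = (\<Sum>r<k. bilin (k + 2) (coeff_mat k (?B r)) w w)"
        using bilin_split_row[of "coeff_mat k (?B _)", OF coeff_mat_sym coeff_mat_diag True, of _ w] row
        unfolding w'_def by (intro sum.cong) auto
      also have "\<dots> \<le> 0"
      proof (rule sum_nonpos)
        fix r assume "r \<in> {..<k}"
        then show "bilin (k + 2) (coeff_mat k (?B r)) w w \<le> 0"
          by (intro nonpos_on_rowD[OF insert.IH[OF B(2) True] row]) simp
      qed
      finally show ?thesis .
    qed
    obtain i where i: "i < k + 2" "i \<noteq> l" by (metis zero_less_Suc less_Suc_eq_0_disj add_2_eq_Suc' One_nat_def zero_neq_one lessI)
    show ?thesis
    proof (rule nonpos_on_row_transfer[OF coeff_mat_sym coeff_mat_diag main i(1) insert.prems(2)])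
      show "0 < coeff_mat k B l i"
        by (rule coeff_mat_generic_pos[OF _ assms(2,3) insert.prems(1)]) (use i insert in auto)
    qed
  qed
qed

section \<open>Generic position by perturbation\<close>

lemma det_minor_mat_moment_curve:
  assumes ij: "i < k + 2" "j < k + 2" "i \<noteq> j"
  shows "det (minor_mat k (\<lambda>l a. of_nat l ^ a) i j) \<noteq> 0"
proof
  let ?W = "minor_mat k (\<lambda>l a. of_nat l ^ a) i j"
  have W: "?W \<in> carrier_mat (k+2) (k+2)" unfolding minor_mat_def by simp
  then have WT: "?W\<^sup>T \<in> carrier_mat (k+2) (k+2)" by simp
  assume "det ?W = 0"
  then have "det ?W\<^sup>T = 0" using det_transpose[OF W] by simp
  then obtain v where v: "v \<in> carrier_vec (k+2)" "v \<noteq> 0\<^sub>v (k+2)" "?W\<^sup>T *\<^sub>v v = 0\<^sub>v (k+2)"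
    unfolding det_0_iff_vec_prod_zero_field[OF WT] by blast
  have eq: "(\<Sum>a<k. of_nat l ^ a * v $ a) + of_bool (l = i) * v $ k + of_bool (l = j) * v $ (Suc k) = 0"
    if l: "l < k + 2" for l
  proof -
    have "0 = (?W\<^sup>T *\<^sub>v v) $ l" using v(3) l by simp
    also have "\<dots> = (\<Sum>a<k+2. ?W $$ (a, l) * v $ a)"
      using l v(1) W by (auto simp: scalar_prod_def lessThan_atLeast0 intro!: sum.cong)
    also have "\<dots> = (\<Sum>a<k. of_nat l ^ a * v $ a) + of_bool (l = i) * v $ k + of_bool (l = j) * v $ (Suc k)"
      using l by (simp add: minor_mat_def)
    finally show ?thesis by simp
  qed
  \<comment> \<open>A null vector of the transpose yields a polynomial of degree below
    \<open>k\<close> that vanishes at the \<open>k\<close> indices other than \<open>i\<close> and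
    \<open>j\<close>, so it is zero. The equations for \<open>i\<close> and \<open>j\<close> then
    annihilate the last two entries.\<close>
  define p where "p = (\<Sum>a<k. monom (v $ a) a)"
  have poly: "poly p x = (\<Sum>a<k. x ^ a * v $ a)" for x
    unfolding p_def by (simp add: poly_sum poly_monom mult.commute)
  have coeff: "coeff p a = (if a < k then v $ a else 0)" for a
    unfolding p_def by (simp add: coeff_sum)
  have "p = 0"
  proof (rule ccontr)
    assume p: "p \<noteq> 0"
    have "(of_nat :: nat \<Rightarrow> complex) ` ({..<k+2} - {i, j}) \<subseteq> {x. poly p x = 0}"
    proof
      fix x assume "x \<in> (of_nat :: nat \<Rightarrow> complex) ` ({..<k+2} - {i, j})"
      then obtain l where l: "x = of_nat l" "l < k + 2" "l \<noteq> i" "l \<noteq> j" by auto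
      show "x \<in> {x. poly p x = 0}" using eq[OF l(2)] l by (simp add: poly)
    qed
    then have "card ((of_nat :: nat \<Rightarrow> complex) ` ({..<k+2} - {i, j})) \<le> card {x. poly p x = 0}"
      by (intro card_mono poly_roots_finite p)
    also have "\<dots> \<le> degree p" by (rule card_poly_roots_bound[OF p])
    finally have "k \<le> degree p" using ij by (simp add: card_image inj_on_def card_Diff_subset)
    then have "coeff p (degree p) = 0" using coeff by simp
    then show False using p by simp
  qed
  then have v0: "v $ a = 0" if "a < k" for a using coeff[of a] that by simp
  have "v $ k = 0" "v $ (Suc k) = 0"
    using eq[OF ij(1)] eq[OF ij(2)] ij(3) v0 by auto
  then have "v = 0\<^sub>v (k+2)" using v(1) v0 by (intro eq_vecI) (auto simp: less_Suc_eq)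
  with v(2) show False by simp
qed

text \<open>At \<open>e = 1\<close> all vectors with index \<open>l\<close> coincide with one point
  of the moment curve, whatever \<open>r\<close> is, so no selection of summands is degenerate
  there.\<close>

definition perturb :: "(nat \<Rightarrow> nat \<Rightarrow> nat \<Rightarrow> complex) \<Rightarrow> real \<Rightarrow> nat \<Rightarrow> nat \<Rightarrow> nat \<Rightarrow> complex" where
  "perturb b e = (\<lambda>l r a. (1 - of_real e) * b l r a + of_real e * of_nat l ^ a)"

text \<open>Each minor is a polynomial in \<open>e\<close> that does not vanish at \<open>1\<close>,
  hence has finitely many zeros, and only finitely many minors matter. The filter
  \<open>at 0\<close> leaves out \<open>e = 0\<close>, where the given vectors may be
  degenerate.\<close>

lemma eventually_generic_perturb: "eventually (\<lambda>e. generic_vectors k (perturb b e)) (at 0)"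
proof -
  have one: "eventually (\<lambda>e. det (minor_mat k (\<lambda>l. perturb b e l (c l)) i j) \<noteq> 0) (at 0)"
    if ij: "i < k + 2" "j < k + 2" "i \<noteq> j" for c i j
  proof -
    \<comment> \<open>The same minor as a matrix of polynomials in \<open>e\<close>.\<close>
    define M where "M = mat (k + 2) (k + 2) (\<lambda>(a, l). if a < k then [: b l (c l) a, of_nat l ^ a - b l (c l) a :]
       else if a = k then of_bool (l = i) else of_bool (l = j))"
    have M: "M \<in> carrier_mat (k+2) (k+2)" unfolding M_def by simp
    have ev: "minor_mat k (\<lambda>l. perturb b e l (c l)) i j = map_mat (\<lambda>p. poly p (of_real e)) M" for e
      unfolding M_def minor_mat_def perturb_def by (intro eq_matI) (auto simp: algebra_simps)
    have pd: "poly (det M) x = det (map_mat (\<lambda>p. poly p x) M)" for x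
    proof -
      have M': "map_mat (\<lambda>p. poly p x) M \<in> carrier_mat (k+2) (k+2)" using M by simp
      show ?thesis unfolding det_def'[OF M] det_def'[OF M'] poly_sum poly_mult poly_prod using M
        by (intro sum.cong[OF refl] arg_cong2[of _ _ _ _ "(*)"] prod.cong[OF refl]) (auto simp: sign_def)
    qed
    have "poly (det M) (of_real 1) = det (minor_mat k (\<lambda>l a. of_nat l ^ a) i j)"
      unfolding pd ev[symmetric] by (simp add: perturb_def)
    then have "det M \<noteq> 0" using det_minor_mat_moment_curve[OF ij] by auto
    then have "finite {x. poly (det M) x = 0}" by (rule poly_roots_finite)
    then have "finite {e :: real. poly (det M) (of_real e) = 0}"
      using finite_vimageI[of "{x. poly (det M) x = 0}" complex_of_real]
      by (simp add: vimage_def inj_on_def)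
    then have "eventually (\<lambda>e. \<forall>z\<in>{e :: real. poly (det M) (of_real e) = 0}. e \<noteq> z) (at 0)"
      by (intro eventually_ball_finite) (auto intro: eventually_neq_at_within)
    then show ?thesis unfolding ev pd[symmetric] by eventually_elim auto
  qed
  have "eventually (\<lambda>e. \<forall>c\<in>{..<k+2} \<rightarrow>\<^sub>E {..<k}. \<forall>i\<in>{..<k+2}. \<forall>j\<in>{..<k+2} - {i}.
    det (minor_mat k (\<lambda>l. perturb b e l (c l)) i j) \<noteq> 0) (at 0)"
  proof (intro eventually_ball_finite ballI)
    show "finite ({..<k+2} \<rightarrow>\<^sub>E {..<k})" by (rule finite_PiE) simp_all
    fix c i j assume "i \<in> {..<k+2}" "j \<in> {..<k+2} - {i}"
    then show "eventually (\<lambda>e. det (minor_mat k (\<lambda>l. perturb b e l (c l)) i j) \<noteq> 0) (at 0)"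
      by (intro one) auto
  qed simp_all
  then show ?thesis
  proof eventually_elim
    case (elim e)
    show ?case unfolding generic_vectors_def
    proof (intro allI impI)
      fix c i j assume h: "\<forall>l<k+2. c l < k" "i < k + 2" "j < k + 2" "i \<noteq> j"
      have "restrict c {..<k+2} \<in> {..<k+2} \<rightarrow>\<^sub>E {..<k}" "i \<in> {..<k+2}" "j \<in> {..<k+2} - {i}" using h by auto
      from elim[THEN bspec, THEN bspec, THEN bspec, OF this] have "det (minor_mat k (\<lambda>l. perturb b e l (restrict c {..<k+2} l)) i j) \<noteq> 0" by simp
      also have "minor_mat k (\<lambda>l. perturb b e l (restrict c {..<k+2} l)) i j = minor_mat k (\<lambda>l. perturb b e l (c l)) i j"
        unfolding minor_mat_def by (intro eq_matI) auto
      finally show "det (minor_mat k (\<lambda>l. perturb b e l (c l)) i j) \<noteq> 0" .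
    qed
  qed
qed

lemma pos_def_rank_one_sum:
  assumes "pos_def k H"
  obtains b where "\<And>x y. x < k \<Longrightarrow> y < k \<Longrightarrow> H x y = (\<Sum>r<k. rank_one (b r) x y)"
proof -
  obtain L where L: "\<And>a b. a < k \<Longrightarrow> b < k \<Longrightarrow> H a b = (\<Sum>r<k. L $$ (a, r) * cnj (L $$ (b, r)))"
    by (rule pos_def_decompose[OF assms]) (rule that)
  show ?thesis by (rule that[of "\<lambda>r a. L $$ (a, r)"]) (use L in \<open>simp add: rank_one_def\<close>)
qed

section \<open>From generic sums to positive definite families\<close>

definition all_pos_def :: "nat \<Rightarrow> (nat \<Rightarrow> nat \<Rightarrow> nat \<Rightarrow> complex) \<Rightarrow> bool" where
  "all_pos_def k B \<longleftrightarrow> (\<forall>l<k+2. pos_def k (B l))"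

lemma all_pos_defD: "all_pos_def k B \<Longrightarrow> l < k + 2 \<Longrightarrow> pos_def k (B l)"
  unfolding all_pos_def_def by blast

lemma all_pos_def_upd: "all_pos_def k B \<Longrightarrow> pos_def k X \<Longrightarrow> all_pos_def k (B(l := X))"
  unfolding all_pos_def_def by simp

lemma rank_one_perturb_tendsto:
  "((\<lambda>e. \<Sum>r<k. rank_one (perturb b e l r) x y) \<longlongrightarrow> (\<Sum>r<k. rank_one (b l r) x y)) (at 0)"
proof -
  have "((\<lambda>e. \<Sum>r<k. rank_one (perturb b e l r) x y) \<longlongrightarrow>
    (\<Sum>r<k. ((1 - of_real 0) * b l r x + of_real 0 * of_nat l ^ x) * cnj ((1 - of_real 0) * b l r y + of_real 0 * of_nat l ^ y))) (at 0)"
    unfolding rank_one_def perturb_def by (intro tendsto_intros)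
  then show ?thesis unfolding rank_one_def by simp
qed

text \<open>Each positive definite matrix is a sum of \<open>k\<close> rank one matrices, and
  perturbing their vectors exhibits the coefficient matrix as a limit of generic ones. Nonpositivity
  on a row survives the limit through \<open>nonpos_on_row_limit\<close>, which asks for a positive
  entry of the limit; so positivity has to be settled before the signature.\<close>

lemma coeff_mat_approx:
  assumes "all_pos_def k B"
  obtains B' where "\<And>i j. ((\<lambda>e. coeff_mat k (B' e) i j) \<longlongrightarrow> coeff_mat k B i j) (at (0 :: real))"
    "\<And>l. k > 0 \<Longrightarrow> l < k + 2 \<Longrightarrow> eventually (\<lambda>e. nonpos_on_row (k + 2) (coeff_mat k (B' e)) l) (at 0)"
    "\<And>i j. k > 0 \<Longrightarrow> i < k + 2 \<Longrightarrow> j < k + 2 \<Longrightarrow> i \<noteq> j \<Longrightarrow> eventually (\<lambda>e. 0 < coeff_mat k (B' e) i j) (at 0)"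
proof -
  have "\<forall>l. \<exists>b. l < k + 2 \<longrightarrow> (\<forall>x<k. \<forall>y<k. B l x y = (\<Sum>r<k. rank_one (b r) x y))"
    using pos_def_rank_one_sum[OF all_pos_defD[OF assms]] by meson
  then obtain b where b: "\<And>l x y. l < k + 2 \<Longrightarrow> x < k \<Longrightarrow> y < k \<Longrightarrow> B l x y = (\<Sum>r<k. rank_one (b l r) x y)"
    by metis
  define B' where "B' = (\<lambda>e l x y. \<Sum>r<k. rank_one (perturb b e l r) x y)"
  have sums: "rank_one_sums k (perturb b e) {..<k+2} (B' e)" for e
    unfolding rank_one_sums_def B'_def by auto
  show ?thesis
  proof (rule that)
    fix i j
    define J where "J = {..<k+2} - {i, j}"
    have "((\<lambda>e. mixed_coeff k (B' e) J) \<longlongrightarrow> mixed_coeff k (\<lambda>l x y. \<Sum>r<k. rank_one (b l r) x y) J) (at 0)"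
      unfolding mixed_coeff_def B'_def by (intro tendsto_intros rank_one_perturb_tendsto)
    also have "mixed_coeff k (\<lambda>l x y. \<Sum>r<k. rank_one (b l r) x y) J = mixed_coeff k B J"
      by (rule mixed_coeff_cong) (auto simp: J_def b)
    finally show "((\<lambda>e. coeff_mat k (B' e) i j) \<longlongrightarrow> coeff_mat k B i j) (at (0 :: real))"
      unfolding coeff_mat_def J_def[symmetric] by (auto intro: tendsto_Re)
  next
    fix l assume kl: "k > 0" "l < k + 2"
    show "eventually (\<lambda>e. nonpos_on_row (k + 2) (coeff_mat k (B' e)) l) (at 0)"
      using eventually_generic_perturb[of k b]
      by eventually_elim (rule nonpos_on_row_generic[OF _ _ kl(1) sums kl(2)]; simp)
  next
    fix i j assume ij: "k > 0" "i < k + 2" "j < k + 2" "i \<noteq> j"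
    show "eventually (\<lambda>e. 0 < coeff_mat k (B' e) i j) (at 0)"
      using eventually_generic_perturb[of k b]
      by eventually_elim (rule coeff_mat_generic_pos[OF _ _ ij(1) sums ij(2-4)]; simp)
  qed
qed

lemma coeff_mat_nonneg:
  assumes "all_pos_def k B" "k > 0" "i < k + 2" "j < k + 2"
  shows "0 \<le> coeff_mat k B i j"
proof (cases "i = j")
  case False
  obtain B' where B': "\<And>i j. ((\<lambda>e. coeff_mat k (B' e) i j) \<longlongrightarrow> coeff_mat k B i j) (at (0 :: real))"
    "\<And>i j. k > 0 \<Longrightarrow> i < k + 2 \<Longrightarrow> j < k + 2 \<Longrightarrow> i \<noteq> j \<Longrightarrow> eventually (\<lambda>e. 0 < coeff_mat k (B' e) i j) (at 0)"
    by (rule coeff_mat_approx[OF assms(1)]) (rule that)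
  have "eventually (\<lambda>e. 0 \<le> coeff_mat k (B' e) i j) (at 0)"
    using B'(2)[OF assms(2-4) False] by eventually_elim simp
  then show ?thesis by (rule tendsto_lowerbound[OF B'(1)]) simp
qed simp

abbreviation "id_mat \<equiv> (\<lambda>(a::nat) (b::nat). of_bool (a = b) :: complex)"

lemma coeff_mat_minus_id:
  assumes "l < k + 2" "i \<noteq> l" "j \<noteq> l"
  shows "coeff_mat k (B(l := (\<lambda>a b. B l a b - of_real d * id_mat a b))) i j
    = coeff_mat k B i j - d * coeff_mat k (B(l := id_mat)) i j"
proof -
  let ?s = "\<lambda>r. if r then 1 else - d" and ?Z = "\<lambda>r. if r then B l else id_mat"
  have "B(l := (\<lambda>a b. B l a b - of_real d * id_mat a b)) = B(l := (\<lambda>a b. \<Sum>r\<in>UNIV. of_real (?s r) * ?Z r a b))"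
    by (simp add: UNIV_bool)
  then have "coeff_mat k (B(l := (\<lambda>a b. B l a b - of_real d * id_mat a b))) i j
    = (\<Sum>r\<in>UNIV. ?s r * coeff_mat k (B(l := ?Z r)) i j)"
    using coeff_mat_linear[OF assms(1) finite_UNIV assms(2,3), of B ?s ?Z] by simp
  then show ?thesis by (simp add: UNIV_bool)
qed

lemma coeff_mat_all_id:
  assumes "\<And>l. l < k + 2 \<Longrightarrow> B l = id_mat" "i < k + 2" "j < k + 2" "i \<noteq> j"
  shows "0 < coeff_mat k B i j"
proof -
  have "card ({..<k+2} - {i, j}) = k" using assms by (simp add: card_Diff_subset)
  then have "card (bijs {..<k} ({..<k+2} - {i, j})) > 0"
    by (simp add: card_gt_0_iff bijs_nonempty)
  moreover have "mixed_coeff k B ({..<k+2} - {i, j}) = of_nat (card (bijs {..<k} ({..<k+2} - {i, j})))"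
    by (rule mixed_coeff_id) (use assms in auto)
  ultimately show ?thesis unfolding coeff_mat_def using assms(4) by simp
qed

text \<open>Splitting \<open>B l\<close> into \<open>B l - d * id_mat\<close> and
  \<open>d * id_mat\<close> writes the entry as a nonnegative number plus \<open>d\<close> times the
  entry with the identity at \<open>l\<close>. The latter is positive by induction on the set
  \<open>F\<close> outside of which all matrices are the identity.\<close>

lemma coeff_mat_pos:
  assumes "all_pos_def k B" "k > 0" "i < k + 2" "j < k + 2" "i \<noteq> j"
  shows "0 < coeff_mat k B i j"
proof -
  have "0 < coeff_mat k B i j" if "finite F" "all_pos_def k B" "\<And>l. l < k + 2 \<Longrightarrow> l \<notin> F \<Longrightarrow> B l = id_mat" for F B
    using that
  proof (induction F arbitrary: B rule: finite_induct)
    case empty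
    then show ?case by (intro coeff_mat_all_id assms) auto
  next
    case (insert l F)
    have IH: "0 < coeff_mat k (B(l := id_mat)) i j"
    proof (rule insert.IH)
      show "all_pos_def k (B(l := id_mat))" by (rule all_pos_def_upd[OF insert.prems(1) pos_def_id])
    qed (use insert.prems in auto)
    show ?case
    proof (cases "i = l \<or> j = l \<or> \<not> l < k + 2")
      case True
      have "coeff_mat k (B(l := id_mat)) i j = coeff_mat k B i j"
      proof (cases "l < k + 2")
        case True
        with \<open>i = l \<or> j = l \<or> \<not> l < k + 2\<close> show ?thesis by (intro coeff_mat_row_upd) auto
      qed (auto intro!: coeff_mat_cong)
      then show ?thesis using IH by simp
    next
      case False
      then have l: "l < k + 2" "i \<noteq> l" "j \<noteq> l" by auto
      obtain d where d: "d > 0" "pos_def k (\<lambda>a b. B l a b - of_real d * id_mat a b)"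
        by (rule pos_def_minus_scaled_id[OF all_pos_defD[OF insert.prems(1) l(1)]])
      have "0 \<le> coeff_mat k (B(l := (\<lambda>a b. B l a b - of_real d * id_mat a b))) i j"
        by (rule coeff_mat_nonneg[OF all_pos_def_upd[OF insert.prems(1) d(2)] assms(2-4)])
      moreover have "0 < d * coeff_mat k (B(l := id_mat)) i j" using d(1) IH by simp
      ultimately show ?thesis unfolding coeff_mat_minus_id[OF l] by linarith
    qed
  qed
  from this[of "{..<k+2}" B] show ?thesis using assms by simp
qed

lemma nonpos_on_row_pos_def:
  assumes "all_pos_def k B" "k > 0" "l < k + 2"
  shows "nonpos_on_row (k + 2) (coeff_mat k B) l"
proof -
  obtain B' where B': "\<And>i j. ((\<lambda>e. coeff_mat k (B' e) i j) \<longlongrightarrow> coeff_mat k B i j) (at (0 :: real))"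
    "\<And>l. k > 0 \<Longrightarrow> l < k + 2 \<Longrightarrow> eventually (\<lambda>e. nonpos_on_row (k + 2) (coeff_mat k (B' e)) l) (at 0)"
    by (rule coeff_mat_approx[OF assms(1)]) (rule that)
  define i where "i = (if l = 0 then 1 else 0 :: nat)"
  have i: "i < k + 2" "l \<noteq> i" unfolding i_def by auto
  show ?thesis
    by (rule nonpos_on_row_limit[OF B'(1) _ B'(2)[OF assms(2,3)] i(1) assms(3)
          coeff_mat_pos[OF assms i]]) simp
qed

section \<open>Kernel vectors\<close>

definition singular_mat :: "nat \<Rightarrow> (nat \<Rightarrow> nat \<Rightarrow> real) \<Rightarrow> bool" where
  "singular_mat m A \<longleftrightarrow> (\<exists>u. (\<exists>i<m. u i \<noteq> 0) \<and> (\<forall>i<m. (\<Sum>j<m. A i j * u j) = 0))"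

text \<open>
  For a kernel vector \<open>u\<close> let \<open>w\<close> be \<open>u\<close> with the \<open>l\<close>-th entry removed. As a function of the \<open>l\<close>-th matrix
  \<open>X\<close>, the value of the form at \<open>w\<close> is linear, nonpositive for positive definite \<open>X\<close>, and zero for
  \<open>X = B\<^sub>l\<close>, an interior point of the positive cone; so it vanishes for all \<open>X\<close>.
\<close>

lemma singular_replace_id:
  assumes B: "all_pos_def k B" and k: "k > 0" and l: "l < k + 2"
    and sing: "singular_mat (k + 2) (coeff_mat k B)"
  shows "singular_mat (k + 2) (coeff_mat k (B(l := id_mat)))"
proof -
  note [simp del] = add_2_eq_Suc'
  let ?m = "k + 2" and ?A = "coeff_mat k B"
  let ?A' = "coeff_mat k (B(l := id_mat))"
  obtain u i0 where u: "i0 < ?m" "u i0 \<noteq> 0" and ker: "\<And>i. i < ?m \<Longrightarrow> (\<Sum>j<?m. ?A i j * u j) = 0"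
    using sing unfolding singular_mat_def by blast
  obtain d where d: "d > 0" "pos_def k (\<lambda>a b. B l a b - of_real d * id_mat a b)"
    by (rule pos_def_minus_scaled_id[OF all_pos_defD[OF B l]])
  let ?A'' = "coeff_mat k (B(l := (\<lambda>a b. B l a b - of_real d * id_mat a b)))"
  define w where "w = u(l := 0)"
  have roww: "(\<Sum>j<?m. coeff_mat k (B(l := X)) l j * w j) = 0" for X
  proof -
    have "(\<Sum>j<?m. coeff_mat k (B(l := X)) l j * w j) = (\<Sum>j<?m. ?A l j * u j)"
      unfolding w_def by (intro sum.cong) (auto simp: coeff_mat_row_upd)
    then show ?thesis using ker[OF l] by simp
  qed
  have "bilin ?m ?A u u = 0" unfolding bilin_row[OF coeff_mat_sym] using ker by simp
  then have Qw: "bilin ?m ?A w w = 0"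
    using bilin_split_row[of ?A, OF coeff_mat_sym coeff_mat_diag l, of u] ker[OF l] unfolding w_def by simp
  \<comment> \<open>The form at \<open>w\<close> is linear in the matrix at \<open>l\<close>. It is
    zero at \<open>B l\<close> and nonpositive at both \<open>id_mat\<close> and
    \<open>B l - d * id_mat\<close>, which forces zero at \<open>id_mat\<close>.\<close>
  have "bilin ?m ?A'' w w = bilin ?m ?A w w - d * bilin ?m ?A' w w"
  proof -
    have "?A'' i j * w i * w j = ?A i j * w i * w j - d * (?A' i j * w i * w j)" for i j
      by (cases "i = l \<or> j = l") (auto simp: w_def coeff_mat_minus_id[OF l] algebra_simps)
    then show ?thesis unfolding bilin_def by (simp only: sum_subtractf sum_distrib_left)
  qed
  moreover have "bilin ?m ?A'' w w \<le> 0"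
    by (rule nonpos_on_rowD[OF nonpos_on_row_pos_def[OF all_pos_def_upd[OF B d(2)] k l] roww])
  ultimately have "bilin ?m ?A' w w \<ge> 0" using Qw d(1) by (simp add: zero_le_mult_iff)
  moreover have B': "all_pos_def k (B(l := id_mat))" by (rule all_pos_def_upd[OF B pos_def_id])
  moreover have "bilin ?m ?A' w w \<le> 0"
    by (rule nonpos_on_rowD[OF nonpos_on_row_pos_def[OF B' k l] roww])
  ultimately have Q'w: "bilin ?m ?A' w w = 0" by simp
  define j0 where "j0 = (if l = 0 then 1 else 0 :: nat)"
  have j0: "j0 < ?m" "l \<noteq> j0" unfolding j0_def by auto
  obtain \<mu> where \<mu>: "\<And>i. i < ?m \<Longrightarrow> (\<Sum>c<?m. ?A' i c * w c) = \<mu> * ?A' l i"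
    by (rule nonpos_on_row_degenerate[of ?A', OF coeff_mat_sym nonpos_on_row_pos_def[OF B' k l] l roww Q'w j0(1)
        coeff_mat_pos[OF B' k l j0]]) (rule that)
  \<comment> \<open>Applying \<open>?A'\<close> to \<open>w\<close> gives \<open>\<mu>\<close> times
    column \<open>l\<close>; the entry \<open>- \<mu>\<close> at \<open>l\<close>, where
    \<open>w\<close> is zero, cancels it.\<close>
  define u' where "u' = (\<lambda>j. w j - \<mu> * of_bool (j = l))"
  have "(\<Sum>j<?m. ?A' i j * u' j) = 0" if i: "i < ?m" for i
  proof -
    have "(\<Sum>j<?m. ?A' i j * u' j) = (\<Sum>j<?m. ?A' i j * w j) - (\<Sum>j<?m. if j = l then \<mu> * ?A' i l else 0)"
      unfolding u'_def sum_subtractf[symmetric] by (intro sum.cong) (auto simp: algebra_simps)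
    then show ?thesis using \<mu>[OF i] l coeff_mat_sym[of k _ i l] by simp
  qed
  \<comment> \<open>Away from \<open>l\<close>, \<open>u'\<close> agrees with \<open>u\<close>. Were
    all these entries zero, \<open>u\<close> would be a multiple of the unit vector at
    \<open>l\<close>, which the positive entry \<open>?A j0 l\<close> keeps out of the
    kernel.\<close>
  moreover have "\<exists>j<?m. u' j \<noteq> 0"
  proof (rule ccontr)
    assume "\<not> (\<exists>j<?m. u' j \<noteq> 0)"
    then have z: "u j = 0" if "j < ?m" "j \<noteq> l" for j using that unfolding u'_def w_def by auto
    then have "i0 = l" using u by blast
    have "(\<Sum>j<?m. ?A j0 j * u j) = (\<Sum>j<?m. if j = l then ?A j0 l * u l else 0)"
      using z by (intro sum.cong) auto
    then have "?A j0 l * u l = 0" using ker[OF j0(1)] l by simp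
    moreover have "?A j0 l > 0" by (rule coeff_mat_pos[OF B k j0(1) l]) (use j0 in auto)
    ultimately show False using u \<open>i0 = l\<close> by simp
  qed
  ultimately show ?thesis unfolding singular_mat_def by blast
qed

theorem coeff_mat_nonsingular:
  assumes B: "all_pos_def k B" and k: "k > 0"
  shows "\<not> singular_mat (k + 2) (coeff_mat k B)"
proof
  note [simp del] = add_2_eq_Suc'
  assume sing: "singular_mat (k + 2) (coeff_mat k B)"
  have "singular_mat (k + 2) (coeff_mat k (\<lambda>l. if l \<in> F then id_mat else B l)) \<and> all_pos_def k (\<lambda>l. if l \<in> F then id_mat else B l)"
    if "finite F" "F \<subseteq> {..<k+2}" for F
    using that
  proof (induction F rule: finite_induct)
    case empty
    then show ?case using sing B by simp
  next
    case (insert l F)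
    let ?B = "\<lambda>l. if l \<in> F then id_mat else B l"
    have e: "(\<lambda>x. if x \<in> insert l F then id_mat else B x) = ?B(l := id_mat)" by auto
    have "l < k + 2" "singular_mat (k + 2) (coeff_mat k ?B)" "all_pos_def k ?B" using insert by auto
    then show ?case unfolding e using k by (blast intro: singular_replace_id all_pos_def_upd pos_def_id)
  qed
  from this[of "{..<k+2}"] have "singular_mat (k + 2) (coeff_mat k (\<lambda>l. if l \<in> {..<k+2} then id_mat else B l))" by simp
  then obtain u i0 where u: "i0 < k + 2" "u i0 \<noteq> 0" and
    ker: "\<And>i. i < k + 2 \<Longrightarrow> (\<Sum>j<k+2. coeff_mat k (\<lambda>l. if l \<in> {..<k+2} then id_mat else B l) i j * u j) = 0"
    unfolding singular_mat_def by blast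
  define c where "c = real (card (bijs {..<k} {..<k}))"
  have c: "coeff_mat k (\<lambda>l. if l \<in> {..<k+2} then id_mat else B l) i j = (if i = j then 0 else c)"
    if "i < k + 2" "j < k + 2" for i j
  proof (cases "i = j")
    case False
    have "card ({..<k+2} - {i, j}) = k" using that False by (simp add: card_Diff_subset)
    then obtain h where h: "bij_betw h {..<k} ({..<k+2} - {i, j})"
      using ex_bij_betw_nat_finite[of "{..<k+2} - {i, j}"] by (auto simp: lessThan_atLeast0)
    have "mixed_coeff k (\<lambda>l. id_mat) ({..<k+2} - {i, j}) = mixed_coeff k (\<lambda>l. id_mat) {..<k}"
      using mixed_coeff_reindex[of h "{..<k}" k "\<lambda>l. id_mat"] h by (simp add: bij_betw_def)
    then have "card (bijs {..<k} ({..<k+2} - {i, j})) = card (bijs {..<k} {..<k})"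
      by (simp add: mixed_coeff_id)
    then show ?thesis
      unfolding coeff_mat_def c_def using False
        mixed_coeff_id[of "{..<k+2} - {i, j}" k "\<lambda>l. if l \<in> {..<k+2} then id_mat else B l"] by simp
  qed simp
  have "c > 0" unfolding c_def using bijs_nonempty[of "{..<k}" k] by (simp add: card_gt_0_iff)
  \<comment> \<open>All off-diagonal entries equal \<open>c\<close>, so each entry of a kernel
    vector is the sum \<open>s\<close> of all entries. Summing the \<open>k + 2\<close> equations
    gives \<open>(real k + 1) * s = 0\<close>.\<close>
  have ui: "u i = (\<Sum>j<k+2. u j)" if i: "i < k + 2" for i
  proof -
    have "0 = (\<Sum>j<k+2. (if i = j then 0 else c) * u j)"
      using ker[OF i] c[OF i] by simp
    also have "\<dots> = (\<Sum>j<k+2. c * u j - (if j = i then c * u i else 0))"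
      by (intro sum.cong) auto
    also have "\<dots> = c * ((\<Sum>j<k+2. u j) - u i)"
      using i by (simp add: sum_subtractf sum_distrib_left algebra_simps)
    finally show ?thesis using \<open>c > 0\<close> by simp
  qed
  define s where "s = (\<Sum>j<k+2. u j)"
  note ui = ui[folded s_def]
  have "s = (\<Sum>j<k+2. s)" by (subst s_def, rule sum.cong[OF refl]) (simp only: lessThan_iff ui)
  then have "(real k + 1) * s = 0" by (simp add: algebra_simps)
  then have "s = 0" by (simp add: add_nonneg_eq_0_iff)
  then show False using ui[OF u(1)] u(2) by simp
qed

section \<open>Exterior algebra and change of coordinates\<close>

lemma finite_inversions: "finite I \<Longrightarrow> finite J \<Longrightarrow> finite {(i, j). i \<in> I \<and> j \<in> J \<and> j < (i::nat)}"
  by (rule finite_subset[of _ "I \<times> J"]) auto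

lemma shuffle_sign_empty [simp]: "shuffle_sign {} J = 1" "shuffle_sign I {} = 1"
  unfolding shuffle_sign_def by simp_all

lemma shuffle_sign_Un_left:
  assumes "finite I" "finite I'" "finite J" "I \<inter> I' = {}"
  shows "shuffle_sign (I \<union> I') J = shuffle_sign I J * shuffle_sign I' J"
proof -
  have "{(i, j). i \<in> I \<union> I' \<and> j \<in> J \<and> j < i}
    = {(i, j). i \<in> I \<and> j \<in> J \<and> j < i} \<union> {(i, j). i \<in> I' \<and> j \<in> J \<and> j < i}" by auto
  moreover have "card \<dots> = card {(i, j). i \<in> I \<and> j \<in> J \<and> j < i} + card {(i, j). i \<in> I' \<and> j \<in> J \<and> j < i}"
    using assms by (intro card_Un_disjoint finite_inversions) auto
  ultimately show ?thesis unfolding shuffle_sign_def by (simp add: power_add)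
qed

lemma shuffle_sign_Un_right:
  assumes "finite I" "finite J" "finite J'" "J \<inter> J' = {}"
  shows "shuffle_sign I (J \<union> J') = shuffle_sign I J * shuffle_sign I J'"
proof -
  have "{(i, j). i \<in> I \<and> j \<in> J \<union> J' \<and> j < i}
    = {(i, j). i \<in> I \<and> j \<in> J \<and> j < i} \<union> {(i, j). i \<in> I \<and> j \<in> J' \<and> j < i}" by auto
  moreover have "card \<dots> = card {(i, j). i \<in> I \<and> j \<in> J \<and> j < i} + card {(i, j). i \<in> I \<and> j \<in> J' \<and> j < i}"
    using assms by (intro card_Un_disjoint finite_inversions) auto
  ultimately show ?thesis unfolding shuffle_sign_def by (simp add: power_add)
qed

lemma shuffle_sign_square [simp]: "shuffle_sign I J * shuffle_sign I J = 1"
  unfolding shuffle_sign_def by (simp flip: power_add)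

lemma shuffle_sign_nonzero [simp]: "shuffle_sign I J \<noteq> 0"
  unfolding shuffle_sign_def by simp

lemma cnj_shuffle_sign [simp]: "cnj (shuffle_sign I J) = shuffle_sign I J"
  unfolding shuffle_sign_def by simp

lemma shuffle_sign_less:
  assumes "\<And>i j. i \<in> I \<Longrightarrow> j \<in> J \<Longrightarrow> i < j"
  shows "shuffle_sign I J = 1"
proof -
  have e: "{(i, j). i \<in> I \<and> j \<in> J \<and> j < i} = {}" using assms by (auto dest: less_asym)
  show ?thesis unfolding shuffle_sign_def e by simp
qed

lemma shuffle_sign_singletons: "i \<noteq> j \<Longrightarrow> shuffle_sign {i} {j} = (if j < i then -1 else 1)"
proof -
  have "{(a, b). a \<in> {i} \<and> b \<in> {j} \<and> b < a} = (if j < i then {(i, j)} else {})" by auto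
  then show ?thesis unfolding shuffle_sign_def by simp
qed

text \<open>Both sides count the inversions in the arrangement of \<open>N\<close> that lists
  \<open>K\<close>, then \<open>L\<close>, then the rest. Associativity of the products below comes
  from this identity.\<close>

lemma shuffle_sign_cocycle:
  assumes "finite N" "K \<in> Pow N" "L \<in> Pow (N - K)"
  shows "shuffle_sign (K \<union> L) (N - (K \<union> L)) * shuffle_sign K L = shuffle_sign K (N - K) * shuffle_sign L (N - K - L)"
proof -
  have fin: "finite K" "finite L" "finite (N - K - L)" using assms by (auto intro: finite_subset)
  have e: "N - (K \<union> L) = N - K - L" "N - K = L \<union> (N - K - L)" "L \<inter> (N - K - L) = {}" "K \<inter> L = {}" using assms by auto
  have "shuffle_sign K (N - K) = shuffle_sign K L * shuffle_sign K (N - K - L)"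
    by (subst e(2), rule shuffle_sign_Un_right) (use fin e in auto)
  moreover have "shuffle_sign (K \<union> L) (N - K - L) = shuffle_sign K (N - K - L) * shuffle_sign L (N - K - L)"
    by (rule shuffle_sign_Un_left) (use fin e in auto)
  ultimately show ?thesis unfolding e(1) by simp
qed

text \<open>Pairs of a set \<open>S\<close> and a subset \<open>K\<close> correspond to disjoint
  pairs \<open>(K, S - K)\<close>.\<close>

lemma sum_Pow_split:
  fixes f :: "'a set \<Rightarrow> 'a set \<Rightarrow> 'b::comm_monoid_add"
  assumes "finite N"
  shows "(\<Sum>S\<in>Pow N. \<Sum>K\<in>Pow S. f K (S - K)) = (\<Sum>K\<in>Pow N. \<Sum>L\<in>Pow (N - K). f K L)"
proof -
  have fin: "finite (Pow S)" if "S \<subseteq> N" for S using assms that by (auto intro: finite_subset)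
  have "(\<Sum>S\<in>Pow N. \<Sum>K\<in>Pow S. f K (S - K)) = (\<Sum>(S, K)\<in>(SIGMA S:Pow N. Pow S). f K (S - K))"
    by (rule sum.Sigma) (use assms fin in auto)
  also have "\<dots> = (\<Sum>(K, L)\<in>(SIGMA K:Pow N. Pow (N - K)). f K L)"
    by (rule sum.reindex_bij_witness[where i = "\<lambda>(K, L). (K \<union> L, K)" and j = "\<lambda>(S, K). (K, S - K)"]) auto
  also have "\<dots> = (\<Sum>K\<in>Pow N. \<Sum>L\<in>Pow (N - K). f K L)"
    by (rule sum.Sigma[symmetric]) (use assms in auto)
  finally show ?thesis .
qed

text \<open>The exterior algebra in the \<open>dz\<close> alone. A bigraded form is built from this
  algebra and its conjugate, so a coordinate change has to be understood only once.\<close>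

definition ext_prod :: "(nat set \<Rightarrow> complex) \<Rightarrow> (nat set \<Rightarrow> complex) \<Rightarrow> nat set \<Rightarrow> complex" where
  "ext_prod a b = (\<lambda>I. \<Sum>K\<in>Pow I. shuffle_sign K (I - K) * a K * b (I - K))"

definition unit_ext :: "nat set \<Rightarrow> complex" where
  "unit_ext = (\<lambda>I. if I = {} then 1 else 0)"

lemma ext_prod_infinite: "infinite I \<Longrightarrow> ext_prod a b I = 0"
  unfolding ext_prod_def by simp

lemma ext_prod_assoc: "ext_prod (ext_prod a b) c = ext_prod a (ext_prod b c)"
proof
  fix I
  show "ext_prod (ext_prod a b) c I = ext_prod a (ext_prod b c) I"
  proof (cases "finite I")
    case True
    let ?f = "\<lambda>K L. shuffle_sign (K \<union> L) (I - (K \<union> L)) * shuffle_sign K L * a K * b L * c (I - (K \<union> L))"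
    have "ext_prod (ext_prod a b) c I = (\<Sum>S\<in>Pow I. \<Sum>K\<in>Pow S. ?f K (S - K))"
      unfolding ext_prod_def sum_distrib_left sum_distrib_right
    proof (intro sum.cong refl)
      fix S K assume "S \<in> Pow I" "K \<in> Pow S"
      then have "K \<union> (S - K) = S" by auto
      then show "shuffle_sign S (I - S) * (shuffle_sign K (S - K) * a K * b (S - K)) * c (I - S) = ?f K (S - K)"
        by (simp only: mult_ac)
    qed
    also have "\<dots> = (\<Sum>K\<in>Pow I. \<Sum>L\<in>Pow (I - K). ?f K L)" by (rule sum_Pow_split[OF True])
    also have "\<dots> = ext_prod a (ext_prod b c) I"
      unfolding ext_prod_def sum_distrib_left
    proof (intro sum.cong refl)
      fix K L assume KL: "K \<in> Pow I" "L \<in> Pow (I - K)"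
      have "I - (K \<union> L) = I - K - L" by auto
      then show "?f K L = shuffle_sign K (I - K) * a K * (shuffle_sign L (I - K - L) * b L * c (I - K - L))"
        using shuffle_sign_cocycle[OF True KL] by simp
    qed
    finally show ?thesis .
  qed (simp add: ext_prod_infinite)
qed

lemma ext_prod_unit_left:
  assumes "finite I" shows "ext_prod unit_ext a I = a I"
proof -
  have "ext_prod unit_ext a I = (\<Sum>K\<in>Pow I. if K = {} then a I else 0)"
    unfolding ext_prod_def unit_ext_def by (intro sum.cong) auto
  then show ?thesis using assms by simp
qed

lemma ext_prod_unit_right:
  assumes "finite I" shows "ext_prod a unit_ext I = a I"
proof -
  have "ext_prod a unit_ext I = (\<Sum>K\<in>Pow I. if K = I then a I else 0)"
    unfolding ext_prod_def unit_ext_def by (intro sum.cong) auto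
  then show ?thesis using assms by simp
qed

lemma ext_prod_scale: "ext_prod (\<lambda>I. c * a I) b = (\<lambda>I. c * ext_prod a b I)"
  "ext_prod a (\<lambda>I. c * b I) = (\<lambda>I. c * ext_prod a b I)"
  unfolding ext_prod_def by (auto simp: fun_eq_iff sum_distrib_left mult_ac)

lemma ext_prod_sum_left: "ext_prod (\<lambda>I. \<Sum>x\<in>X. f x I) b I = (\<Sum>x\<in>X. ext_prod (f x) b I)"
  unfolding ext_prod_def by (simp add: sum_distrib_left sum_distrib_right sum.swap[of _ _ X])

lemma ext_prod_sum_right: "ext_prod a (\<lambda>I. \<Sum>x\<in>X. f x I) I = (\<Sum>x\<in>X. ext_prod a (f x) I)"
  unfolding ext_prod_def by (simp add: sum_distrib_left sum.swap[of _ _ X])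

definition covector :: "nat \<Rightarrow> complex mat \<Rightarrow> nat \<Rightarrow> nat set \<Rightarrow> complex" where
  "covector n A j = (\<lambda>I. \<Sum>i<n. if I = {i} then A $$ (j, i) else 0)"

lemma covector_singleton [simp]: "covector n A j {i} = (if i < n then A $$ (j, i) else 0)"
proof -
  have "covector n A j {i} = (\<Sum>i'<n. if i = i' then A $$ (j, i') else 0)"
    unfolding covector_def by (intro sum.cong) auto
  then show ?thesis by simp
qed

lemma covector_nonzeroD: "covector n A j I \<noteq> 0 \<Longrightarrow> \<exists>i<n. I = {i}"
  unfolding covector_def by (erule sum.not_neutral_contains_not_neutral) (auto split: if_splits)

lemma ext_prod_anticommute:
  assumes a: "\<And>I. a I \<noteq> 0 \<Longrightarrow> \<exists>i. I = {i}" and b: "\<And>I. b I \<noteq> 0 \<Longrightarrow> \<exists>i. I = {i}"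
  shows "ext_prod a b I = - ext_prod b a I"
proof (cases "finite I")
  case True
  have "ext_prod a b I = (\<Sum>K\<in>Pow I. shuffle_sign (I - K) K * a (I - K) * b K)"
    unfolding ext_prod_def
    by (rule sum.reindex_bij_witness[where i = "\<lambda>K. I - K" and j = "\<lambda>K. I - K"])
      (auto simp: double_diff)
  also have "\<dots> = (\<Sum>K\<in>Pow I. - (shuffle_sign K (I - K) * b K * a (I - K)))"
  proof (rule sum.cong[OF refl])
    fix K assume "K \<in> Pow I"
    show "shuffle_sign (I - K) K * a (I - K) * b K = - (shuffle_sign K (I - K) * b K * a (I - K))"
    proof (cases "a (I - K) = 0 \<or> b K = 0")
      case False
      then obtain i j where ij: "I - K = {i}" "K = {j}" using a b by blast
      then have "i \<noteq> j" by auto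
      then show ?thesis unfolding ij(1) unfolding ij(2) using shuffle_sign_singletons[of i j] shuffle_sign_singletons[of j i] by auto
    qed auto
  qed
  also have "\<dots> = - ext_prod b a I" unfolding ext_prod_def by (simp add: sum_negf)
  finally show ?thesis .
qed (simp add: ext_prod_infinite)

lemma covector_anticommute: "ext_prod (covector n A i) (covector n A j) = (\<lambda>I. - ext_prod (covector n A j) (covector n A i) I)"
  using ext_prod_anticommute[of "covector n A i" "covector n A j"] covector_nonzeroD by blast

lemma covector_square: "ext_prod (covector n A i) (covector n A i) = (\<lambda>I. 0)"
  using fun_cong[OF covector_anticommute[of n A i i]] by (simp add: fun_eq_iff)

text \<open>\<open>monom_form n A K\<close> is \<open>dw\<^sub>K\<close> for the coordinates \<open>w = A z\<close>.\<close>

definition monom_form :: "nat \<Rightarrow> complex mat \<Rightarrow> nat set \<Rightarrow> nat set \<Rightarrow> complex" where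
  "monom_form n A K = foldr (\<lambda>j. ext_prod (covector n A j)) (sorted_list_of_set K) unit_ext"

lemma monom_form_empty [simp]: "monom_form n A {} = unit_ext"
  unfolding monom_form_def by simp

lemma monom_form_insert_min:
  assumes "finite K" "\<And>x. x \<in> K \<Longrightarrow> j < x"
  shows "monom_form n A (insert j K) = ext_prod (covector n A j) (monom_form n A K)"
proof -
  have "sorted_list_of_set (insert j K) = j # sorted_list_of_set K"
    by (rule sorted_list_of_set_unique[THEN iffD1]) (use assms in \<open>auto simp: less_imp_le card_insert_if\<close>)
  then show ?thesis unfolding monom_form_def by simp
qed

text \<open>Removing the minimum strips the outermost factor of \<open>monom_form\<close>, whose
  index list is increasing.\<close>

lemma finite_min_induct [consumes 1, case_names empty insert]:
  assumes "finite (K :: nat set)" "P {}"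
    and "\<And>j K. finite K \<Longrightarrow> (\<And>x. x \<in> K \<Longrightarrow> j < x) \<Longrightarrow> P K \<Longrightarrow> P (insert j K)"
  shows "P K"
  using assms(1,2) by (rule finite_linorder_min_induct) (use assms(3) in blast)

lemma monom_form_nonzeroD:
  assumes "finite K" "monom_form n A K I \<noteq> 0"
  shows "I \<subseteq> {..<n} \<and> card I = card K"
  using assms
proof (induction K arbitrary: I rule: finite_min_induct)
  case empty
  then show ?case by (auto simp: unit_ext_def split: if_splits)
next
  case (insert j K)
  then have "(\<Sum>S\<in>Pow I. shuffle_sign S (I - S) * covector n A j S * monom_form n A K (I - S)) \<noteq> 0"
    by (simp add: monom_form_insert_min ext_prod_def)
  then obtain S where S: "S \<in> Pow I" "shuffle_sign S (I - S) * covector n A j S * monom_form n A K (I - S) \<noteq> 0"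
    by (rule sum.not_neutral_contains_not_neutral)
  then obtain i where i: "i < n" "S = {i}" using covector_nonzeroD[of n A j S] by auto
  have IH: "I - S \<subseteq> {..<n}" "card (I - S) = card K" using insert.IH[of "I - S"] S by auto
  have "finite (I - S)" using IH(1) by (rule finite_subset) simp
  then have "card (insert i (I - S)) = Suc (card K)"
    by (subst card_insert_disjoint) (use i IH in auto)
  moreover have "insert i (I - S) = I" using S i by auto
  moreover have "j \<notin> K" using insert.hyps(2) by blast
  ultimately show ?case using IH i insert.hyps(1) by auto
qed

lemma monom_form_infinite: "finite K \<Longrightarrow> infinite I \<Longrightarrow> monom_form n A K I = 0"
  using monom_form_nonzeroD[of K n A I] finite_subset by blast

lemma unit_ext_prod [simp]:
  "(\<And>I. infinite I \<Longrightarrow> a I = 0) \<Longrightarrow> ext_prod unit_ext a = a"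
  "(\<And>I. infinite I \<Longrightarrow> a I = 0) \<Longrightarrow> ext_prod a unit_ext = a"
proof -
  assume a: "\<And>I. infinite I \<Longrightarrow> a I = 0"
  show "ext_prod unit_ext a = a" "ext_prod a unit_ext = a"
  proof (safe intro!: ext)
    fix I
    show "ext_prod unit_ext a I = a I" "ext_prod a unit_ext I = a I"
      using a[of I] by (cases "finite I"; simp add: ext_prod_infinite ext_prod_unit_left ext_prod_unit_right)+
  qed
qed

text \<open>Moving \<open>dw_j\<close> into place costs one sign for each smaller index, and
  \<open>shuffle_sign {j} K\<close> counts these; an equal factor gives zero.\<close>

lemma covector_monom_form:
  assumes "finite K"
  shows "ext_prod (covector n A j) (monom_form n A K) =
    (if j \<in> K then (\<lambda>_. 0) else (\<lambda>I. shuffle_sign {j} K * monom_form n A (insert j K) I))"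
  using assms
proof (induction K rule: finite_min_induct)
  case empty
  then show ?case using monom_form_insert_min[of "{}" j] by auto
next
  case (insert b K)
  have b: "b \<notin> K" using insert.hyps(2) by blast
  have mb: "monom_form n A (insert b K) = ext_prod (covector n A b) (monom_form n A K)"
    by (rule monom_form_insert_min) (use insert.hyps in auto)
  consider "j < b" | "j = b" | "j > b" by linarith
  then show ?case
  proof cases
    case 1
    have "ext_prod (covector n A j) (monom_form n A (insert b K)) = monom_form n A (insert j (insert b K))"
      by (rule monom_form_insert_min[symmetric]) (use insert.hyps 1 in force)+
    moreover have "shuffle_sign {j} (insert b K) = 1" by (rule shuffle_sign_less) (use insert.hyps(2) 1 in force)
    moreover have "j \<notin> insert b K" using insert.hyps(2) 1 by force
    ultimately show ?thesis by simp
  next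
    case 2
    have "ext_prod (covector n A b) (ext_prod (covector n A b) (monom_form n A K)) = (\<lambda>_. 0)"
      unfolding ext_prod_assoc[symmetric] covector_square by (simp add: ext_prod_def)
    then show ?thesis unfolding mb using 2 by simp
  next
    case 3
    have "ext_prod (covector n A j) (monom_form n A (insert b K))
      = ext_prod (\<lambda>I. - 1 * ext_prod (covector n A b) (covector n A j) I) (monom_form n A K)"
      unfolding mb ext_prod_assoc[symmetric] by (subst covector_anticommute) simp
    also have "\<dots> = (\<lambda>I. - 1 * ext_prod (covector n A b) (ext_prod (covector n A j) (monom_form n A K)) I)"
      unfolding ext_prod_scale ext_prod_assoc ..
    finally have eq: "ext_prod (covector n A j) (monom_form n A (insert b K))
      = (\<lambda>I. - 1 * ext_prod (covector n A b) (ext_prod (covector n A j) (monom_form n A K)) I)" .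
    show ?thesis
    proof (cases "j \<in> K")
      case True
      then show ?thesis unfolding eq insert.IH by (auto simp: ext_prod_def)
    next
      case False
      have "ext_prod (covector n A b) (monom_form n A (insert j K)) = monom_form n A (insert b (insert j K))"
        by (rule monom_form_insert_min[symmetric]) (use insert.hyps 3 in auto)
      moreover have "shuffle_sign {j} ({b} \<union> K) = shuffle_sign {j} {b} * shuffle_sign {j} K"
        by (rule shuffle_sign_Un_right) (use insert.hyps b in auto)
      moreover have "shuffle_sign {j} {b} = -1" using 3 by (simp add: shuffle_sign_singletons)
      ultimately show ?thesis unfolding eq insert.IH using False 3
        by (simp add: ext_prod_scale insert_commute fun_eq_iff)
    qed
  qed
qed

text \<open>The \<open>dw_K\<close> multiply by the rule that holds for the basis
  \<open>dz_K\<close>, which makes substitution a homomorphism of algebras.\<close>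

lemma monom_form_prod:
  assumes "finite K" "finite K'"
  shows "ext_prod (monom_form n A K) (monom_form n A K') =
    (if K \<inter> K' = {} then (\<lambda>I. shuffle_sign K K' * monom_form n A (K \<union> K') I) else (\<lambda>_. 0))"
  using assms(1)
proof (induction K rule: finite_min_induct)
  case empty
  then show ?case by (auto simp: monom_form_infinite[OF assms(2)])
next
  case (insert b K)
  have b: "b \<notin> K" using insert.hyps(2) by blast
  have mb: "monom_form n A (insert b K) = ext_prod (covector n A b) (monom_form n A K)"
    by (rule monom_form_insert_min) (use insert.hyps in auto)
  show ?case
  proof (cases "K \<inter> K' = {}")
    case False
    then have "insert b K \<inter> K' \<noteq> {}" by blast
    then show ?thesis unfolding mb ext_prod_assoc insert.IH using False by (auto simp: ext_prod_def)
  next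
    case True
    have cov: "ext_prod (covector n A b) (monom_form n A (K \<union> K')) = (if b \<in> K \<union> K' then (\<lambda>_. 0)
      else (\<lambda>I. shuffle_sign {b} (K \<union> K') * monom_form n A (insert b (K \<union> K')) I))"
      by (rule covector_monom_form) (use insert.hyps assms in auto)
    show ?thesis
    proof (cases "b \<in> K'")
      case b': True
      then show ?thesis unfolding mb ext_prod_assoc insert.IH using True
        by (simp add: ext_prod_scale cov)
    next
      case False
      have "shuffle_sign ({b} \<union> K) K' = shuffle_sign {b} K' * shuffle_sign K K'"
        by (rule shuffle_sign_Un_left) (use insert.hyps b assms in auto)
      moreover have "shuffle_sign {b} (K \<union> K') = shuffle_sign {b} K * shuffle_sign {b} K'"
        by (rule shuffle_sign_Un_right) (use insert.hyps True assms in auto)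
      moreover have "shuffle_sign {b} K = 1" by (rule shuffle_sign_less) (use insert.hyps in auto)
      ultimately show ?thesis unfolding mb ext_prod_assoc insert.IH using True False b
        by (simp add: ext_prod_scale cov fun_eq_iff)
    qed
  qed
qed

section \<open>Substitution of coordinates in the exterior algebra\<close>

definition ext_transform :: "nat \<Rightarrow> complex mat \<Rightarrow> (nat set \<Rightarrow> complex) \<Rightarrow> nat set \<Rightarrow> complex" where
  "ext_transform n A a = (\<lambda>I. \<Sum>K\<in>Pow {..<n}. a K * monom_form n A K I)"

lemma finite_Pow_lessThan: "K \<in> Pow {..<n::nat} \<Longrightarrow> finite K"
  by (auto intro: finite_subset)

lemma monom_form_prod_sum:
  fixes f :: "nat set \<Rightarrow> complex"
  assumes "K \<in> Pow {..<n}"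
  shows "(\<Sum>L\<in>Pow {..<n}. f L * ext_prod (monom_form n A K) (monom_form n A L) I)
    = (\<Sum>L\<in>Pow ({..<n} - K). f L * shuffle_sign K L * monom_form n A (K \<union> L) I)"
proof -
  have "(\<Sum>L\<in>Pow {..<n}. f L * ext_prod (monom_form n A K) (monom_form n A L) I)
    = (\<Sum>L\<in>Pow {..<n}. if K \<inter> L = {} then f L * shuffle_sign K L * monom_form n A (K \<union> L) I else 0)"
    using assms by (intro sum.cong refl) (simp add: monom_form_prod finite_Pow_lessThan)
  also have "\<dots> = (\<Sum>L\<in>Pow ({..<n} - K). f L * shuffle_sign K L * monom_form n A (K \<union> L) I)"
    by (rule sum.mono_neutral_cong_right) auto
  finally show ?thesis .
qed

lemma ext_transform_prod:
  "ext_prod (ext_transform n A a) (ext_transform n A b) = ext_transform n A (ext_prod a b)"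
proof
  fix I
  have "ext_prod (ext_transform n A a) (ext_transform n A b) I
    = (\<Sum>K\<in>Pow {..<n}. \<Sum>L\<in>Pow {..<n}. (a K * b L) * ext_prod (monom_form n A K) (monom_form n A L) I)"
    unfolding ext_transform_def ext_prod_sum_left ext_prod_sum_right ext_prod_scale
    by (simp add: sum_distrib_left mult_ac)
  also have "\<dots> = (\<Sum>K\<in>Pow {..<n}. \<Sum>L\<in>Pow ({..<n} - K). (a K * b L) * shuffle_sign K L * monom_form n A (K \<union> L) I)"
    by (intro sum.cong refl monom_form_prod_sum)
  also have "\<dots> = (\<Sum>S\<in>Pow {..<n}. \<Sum>K\<in>Pow S. (a K * b (S - K)) * shuffle_sign K (S - K) * monom_form n A (K \<union> (S - K)) I)"
    by (rule sum_Pow_split[symmetric]) simp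
  also have "\<dots> = ext_transform n A (ext_prod a b) I"
    unfolding ext_transform_def ext_prod_def sum_distrib_right
  proof (intro sum.cong refl)
    fix S K assume "S \<in> Pow {..<n}" "K \<in> Pow S"
    then have "K \<union> (S - K) = S" by auto
    then show "(a K * b (S - K)) * shuffle_sign K (S - K) * monom_form n A (K \<union> (S - K)) I
      = shuffle_sign K (S - K) * a K * b (S - K) * monom_form n A S I" by (simp only: mult_ac)
  qed
  finally show "ext_prod (ext_transform n A a) (ext_transform n A b) I = ext_transform n A (ext_prod a b) I" .
qed

lemma sum_Pow_singletons:
  fixes f :: "nat set \<Rightarrow> complex"
  assumes "finite N" "\<And>K. K \<subseteq> N \<Longrightarrow> \<not> (\<exists>i. K = {i}) \<Longrightarrow> f K = 0"
  shows "(\<Sum>K\<in>Pow N. f K) = (\<Sum>i\<in>N. f {i})"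
proof -
  have "(\<Sum>i\<in>N. f {i}) = (\<Sum>K\<in>(\<lambda>i. {i}) ` N. f K)" by (subst sum.reindex) (auto simp: inj_on_def)
  also have "\<dots> = (\<Sum>K\<in>Pow N. f K)"
    by (rule sum.mono_neutral_left) (use assms in blast)+
  finally show ?thesis by simp
qed

lemma monom_form_singleton: "monom_form n A {j} = covector n A j"
proof -
  have "monom_form n A {j} = ext_prod (covector n A j) unit_ext"
    using monom_form_insert_min[of "{}" j n A] by simp
  also have "\<dots> = covector n A j"
    by (rule unit_ext_prod) (metis covector_nonzeroD finite.emptyI finite.insertI)
  finally show ?thesis .
qed

lemma ext_transform_covector:
  assumes "A \<in> carrier_mat n n" "B \<in> carrier_mat n n" "j < n"
  shows "ext_transform n B (covector n A j) = covector n (A * B) j"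
proof
  fix I
  have "ext_transform n B (covector n A j) I = (\<Sum>i<n. A $$ (j, i) * covector n B i I)"
    unfolding ext_transform_def
    by (subst sum_Pow_singletons) (auto simp: monom_form_singleton dest: covector_nonzeroD)
  also have "\<dots> = covector n (A * B) j I"
  proof (cases "\<exists>l<n. I = {l}")
    case True
    then obtain l where l: "l < n" "I = {l}" by blast
    then show ?thesis using assms by (auto simp: scalar_prod_def lessThan_atLeast0 intro!: sum.cong)
  next
    case False
    then have "covector n C i I = 0" for C i using covector_nonzeroD by blast
    then show ?thesis by simp
  qed
  finally show "ext_transform n B (covector n A j) I = covector n (A * B) j I" .
qed

lemma ext_transform_unit: "ext_transform n A unit_ext = unit_ext"
proof
  fix I
  have "ext_transform n A unit_ext I = (\<Sum>K\<in>Pow {..<n}. if K = {} then unit_ext I else 0)"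
    unfolding ext_transform_def by (intro sum.cong) (auto simp: unit_ext_def)
  then show "ext_transform n A unit_ext I = unit_ext I" by simp
qed

text \<open>Both sides are multiplicative, and on a single factor the substitution by
  \<open>B\<close> turns row \<open>j\<close> of \<open>A\<close> into row \<open>j\<close> of
  \<open>A * B\<close>. The map applied last is thus the right factor of the matrix product.\<close>

lemma ext_transform_monom_form:
  assumes "A \<in> carrier_mat n n" "B \<in> carrier_mat n n" "K \<subseteq> {..<n}"
  shows "ext_transform n B (monom_form n A K) = monom_form n (A * B) K"
proof -
  have "finite K" using assms(3) by (rule finite_subset) simp
  then show ?thesis using assms(3)
  proof (induction K rule: finite_min_induct)
    case empty
    then show ?case by (simp add: ext_transform_unit)
  next
    case (insert j K)
    have "ext_transform n B (monom_form n A (insert j K))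
      = ext_prod (ext_transform n B (covector n A j)) (ext_transform n B (monom_form n A K))"
      unfolding ext_transform_prod using insert.hyps by (simp add: monom_form_insert_min)
    also have "\<dots> = monom_form n (A * B) (insert j K)"
      using insert assms by (simp add: ext_transform_covector monom_form_insert_min)
    finally show ?case .
  qed
qed

lemma monom_form_one:
  assumes "K \<subseteq> {..<n}"
  shows "monom_form n (1\<^sub>m n) K = (\<lambda>I. if I = K then 1 else 0)"
proof -
  have "finite K" using assms by (rule finite_subset) simp
  then show ?thesis using assms
  proof (induction K rule: finite_min_induct)
    case empty
    then show ?case by (simp add: unit_ext_def)
  next
    case (insert j K)
    have j: "j \<notin> K" using insert.hyps(2) by blast
    have s: "shuffle_sign {j} K = 1" by (rule shuffle_sign_less) (use insert.hyps in auto)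
    show ?case
    proof
      fix I
      have "monom_form n (1\<^sub>m n) (insert j K) I
        = (\<Sum>S\<in>Pow I. shuffle_sign S (I - S) * covector n (1\<^sub>m n) j S * (if I - S = K then 1 else 0))"
        using insert by (simp add: monom_form_insert_min ext_prod_def)
      also have "\<dots> = (\<Sum>S\<in>Pow I. if S = {j} then (if I = insert j K then 1 else 0) else 0)"
      proof (intro sum.cong refl)
        fix S assume S: "S \<in> Pow I"
        show "shuffle_sign S (I - S) * covector n (1\<^sub>m n) j S * (if I - S = K then 1 else 0)
          = (if S = {j} then (if I = insert j K then 1 else 0) else 0)"
        proof (cases "\<exists>i<n. S = {i}")
          case True
          then obtain i where i: "i < n" "S = {i}" by blast
          have jn: "j < n" using insert.prems by simp
          show ?thesis
          proof (cases "i = j")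
            case True
            have iff: "I - {j} = K \<longleftrightarrow> I = insert j K" using S i(2) True j by auto
            show ?thesis
            proof (cases "I - {j} = K")
              case T: True
              show ?thesis using jn iff s unfolding i(2) True T by simp
            next
              case False
              then show ?thesis using iff unfolding i(2) True by simp
            qed
          next
            case False
            then show ?thesis using i jn by simp
          qed
        next
          case False
          then have "covector n (1\<^sub>m n) j S = 0" using covector_nonzeroD by blast
          moreover have "S \<noteq> {j}" using False insert.prems by auto
          ultimately show ?thesis by simp
        qed
      qed
      also have "\<dots> = (if I = insert j K then 1 else 0)"
      proof (cases "I = insert j K")
        case True
        then show ?thesis using insert.hyps(1) by simp
      qed simp
      finally show "monom_form n (1\<^sub>m n) (insert j K) I = (if I = insert j K then 1 else 0)" .
    qed
  qed
qed

section \<open>Wedge product of bigraded forms\<close>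

lemma wedge_infinite: "infinite I \<or> infinite J \<Longrightarrow> wedge \<alpha> \<beta> I J = 0"
  unfolding wedge_def by auto

lemma sum_Pow_split2:
  fixes f :: "'a set \<Rightarrow> 'a set \<Rightarrow> 'b set \<Rightarrow> 'b set \<Rightarrow> 'c::comm_monoid_add"
  assumes "finite N" "finite M"
  shows "(\<Sum>S\<in>Pow N. \<Sum>T\<in>Pow M. \<Sum>K\<in>Pow S. \<Sum>L\<in>Pow T. f K (S - K) L (T - L))
    = (\<Sum>K\<in>Pow N. \<Sum>L\<in>Pow M. \<Sum>K'\<in>Pow (N - K). \<Sum>L'\<in>Pow (M - L). f K K' L L')"
proof -
  have "(\<Sum>S\<in>Pow N. \<Sum>T\<in>Pow M. \<Sum>K\<in>Pow S. \<Sum>L\<in>Pow T. f K (S - K) L (T - L))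
    = (\<Sum>S\<in>Pow N. \<Sum>K\<in>Pow S. \<Sum>T\<in>Pow M. \<Sum>L\<in>Pow T. f K (S - K) L (T - L))"
    by (intro sum.cong refl sum.swap)
  also have "\<dots> = (\<Sum>K\<in>Pow N. \<Sum>K'\<in>Pow (N - K). \<Sum>T\<in>Pow M. \<Sum>L\<in>Pow T. f K K' L (T - L))"
    by (rule sum_Pow_split[OF assms(1), of "\<lambda>K K'. \<Sum>T\<in>Pow M. \<Sum>L\<in>Pow T. f K K' L (T - L)"])
  also have "\<dots> = (\<Sum>K\<in>Pow N. \<Sum>K'\<in>Pow (N - K). \<Sum>L\<in>Pow M. \<Sum>L'\<in>Pow (M - L). f K K' L L')"
    by (intro sum.cong refl sum_Pow_split[OF assms(2)])
  also have "\<dots> = (\<Sum>K\<in>Pow N. \<Sum>L\<in>Pow M. \<Sum>K'\<in>Pow (N - K). \<Sum>L'\<in>Pow (M - L). f K K' L L')"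
    by (intro sum.cong refl sum.swap)
  finally show ?thesis .
qed

lemma wedge_assoc: "wedge (wedge \<alpha> \<beta>) \<gamma> = wedge \<alpha> (wedge \<beta> \<gamma>)"
proof (intro ext)
  fix I J
  show "wedge (wedge \<alpha> \<beta>) \<gamma> I J = wedge \<alpha> (wedge \<beta> \<gamma>) I J"
  proof (cases "finite I \<and> finite J")
    case True
    define f where "f = (\<lambda>K K' L L'. (-1) ^ (card (L \<union> L') * card (I - (K \<union> K'))) * shuffle_sign (K \<union> K') (I - (K \<union> K')) * shuffle_sign (L \<union> L') (J - (L \<union> L'))
      * ((-1) ^ (card L * card K') * shuffle_sign K K' * shuffle_sign L L' * \<alpha> K L * \<beta> K' L') * \<gamma> (I - (K \<union> K')) (J - (L \<union> L')))"
    have "wedge (wedge \<alpha> \<beta>) \<gamma> I J = (\<Sum>S\<in>Pow I. \<Sum>T\<in>Pow J. \<Sum>K\<in>Pow S. \<Sum>L\<in>Pow T. f K (S - K) L (T - L))"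
      unfolding wedge_def sum_distrib_left sum_distrib_right
    proof (intro sum.cong refl)
      fix S T K L assume "S \<in> Pow I" "T \<in> Pow J" "K \<in> Pow S" "L \<in> Pow T"
      then have "K \<union> (S - K) = S" "L \<union> (T - L) = T" by auto
      then show "(-1) ^ (card T * card (I - S)) * shuffle_sign S (I - S) * shuffle_sign T (J - T)
        * ((-1) ^ (card L * card (S - K)) * shuffle_sign K (S - K) * shuffle_sign L (T - L) * \<alpha> K L * \<beta> (S - K) (T - L)) * \<gamma> (I - S) (J - T)
        = f K (S - K) L (T - L)" unfolding f_def by simp
    qed
    also have "\<dots> = (\<Sum>K\<in>Pow I. \<Sum>L\<in>Pow J. \<Sum>K'\<in>Pow (I - K). \<Sum>L'\<in>Pow (J - L). f K K' L L')"
      by (rule sum_Pow_split2) (use True in auto)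
    also have "\<dots> = wedge \<alpha> (wedge \<beta> \<gamma>) I J"
      unfolding wedge_def sum_distrib_left
    proof (intro sum.cong refl)
      fix K L K' L' assume h: "K \<in> Pow I" "L \<in> Pow J" "K' \<in> Pow (I - K)" "L' \<in> Pow (J - L)"
      have fin: "finite L" "finite L'" "finite (I - K)" "finite K'" using h True by (auto intro: finite_subset)
      have c1: "card (L \<union> L') = card L + card L'" using h fin by (intro card_Un_disjoint) auto
      have "card (I - K) = card (K' \<union> (I - K - K'))" using h by (intro arg_cong[of _ _ card]) auto
      also have "\<dots> = card K' + card (I - K - K')" using fin by (intro card_Un_disjoint) auto
      finally have c2: "card (I - K) = card K' + card (I - K - K')" .
      have e: "I - (K \<union> K') = I - K - K'" "J - (L \<union> L') = J - L - L'" by auto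
      have s1: "shuffle_sign (K \<union> K') (I - K - K') * shuffle_sign K K' = shuffle_sign K (I - K) * shuffle_sign K' (I - K - K')"
        using shuffle_sign_cocycle[of I K K'] True h unfolding e by blast
      have s2: "shuffle_sign (L \<union> L') (J - L - L') * shuffle_sign L L' = shuffle_sign L (J - L) * shuffle_sign L' (J - L - L')"
        using shuffle_sign_cocycle[of J L L'] True h unfolding e by blast
      \<comment> \<open>With \<open>R = I - K - K'\<close>, both exponents are
        \<open>|L| |K'| + |L| |R| + |L'| |R|\<close>.\<close>
      have s3: "(-1 :: complex) ^ (card (L \<union> L') * card (I - K - K')) * (-1) ^ (card L * card K')
        = (-1) ^ (card L * card (I - K)) * (-1) ^ (card L' * card (I - K - K'))"
        unfolding c1 c2 power_add[symmetric] by (simp add: algebra_simps)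
      have "f K K' L L' = ((-1) ^ (card (L \<union> L') * card (I - K - K')) * (-1) ^ (card L * card K'))
        * (shuffle_sign (K \<union> K') (I - K - K') * shuffle_sign K K')
        * (shuffle_sign (L \<union> L') (J - L - L') * shuffle_sign L L') * (\<alpha> K L * \<beta> K' L' * \<gamma> (I - K - K') (J - L - L'))"
        unfolding f_def e by (simp only: mult_ac)
      also have "\<dots> = (-1) ^ (card L * card (I - K)) * shuffle_sign K (I - K) * shuffle_sign L (J - L) * \<alpha> K L
        * ((-1) ^ (card L' * card (I - K - K')) * shuffle_sign K' (I - K - K') * shuffle_sign L' (J - L - L') * \<beta> K' L' * \<gamma> (I - K - K') (J - L - L'))"
        unfolding s1 s2 s3 by (simp only: mult_ac)
      finally show "f K K' L L' = (-1) ^ (card L * card (I - K)) * shuffle_sign K (I - K) * shuffle_sign L (J - L) * \<alpha> K L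
        * ((-1) ^ (card L' * card (I - K - K')) * shuffle_sign K' (I - K - K') * shuffle_sign L' (J - L - L') * \<beta> K' L' * \<gamma> (I - K - K') (J - L - L'))" .
    qed
    finally show ?thesis .
  next
    case False
    then show ?thesis by (simp add: wedge_infinite)
  qed
qed

text \<open>Substitution of \<open>dw\<^sub>K \<and> d\<bar>w\<^sub>L\<close> for \<open>dz\<^sub>K \<and> d\<bar>z\<^sub>L\<close>, where \<open>w = A z\<close>.\<close>

definition transform :: "nat \<Rightarrow> complex mat \<Rightarrow> form \<Rightarrow> form" where
  "transform n A \<alpha> = (\<lambda>I J. \<Sum>K\<in>Pow {..<n}. \<Sum>L\<in>Pow {..<n}. \<alpha> K L * monom_form n A K I * cnj (monom_form n A L J))"

lemma sum_swap_four:
  "(\<Sum>t\<in>T. \<Sum>a\<in>A. \<Sum>b\<in>B. \<Sum>c\<in>C. \<Sum>d\<in>D. g t a b c d)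
    = (\<Sum>a\<in>A. \<Sum>b\<in>B. \<Sum>c\<in>C. \<Sum>d\<in>D. \<Sum>t\<in>T. g t a b c d)"
proof -
  have "(\<Sum>t\<in>T. \<Sum>a\<in>A. \<Sum>b\<in>B. \<Sum>c\<in>C. \<Sum>d\<in>D. g t a b c d)
    = (\<Sum>a\<in>A. \<Sum>t\<in>T. \<Sum>b\<in>B. \<Sum>c\<in>C. \<Sum>d\<in>D. g t a b c d)" by (rule sum.swap)
  also have "\<dots> = (\<Sum>a\<in>A. \<Sum>b\<in>B. \<Sum>t\<in>T. \<Sum>c\<in>C. \<Sum>d\<in>D. g t a b c d)"
    by (intro sum.cong refl sum.swap)
  also have "\<dots> = (\<Sum>a\<in>A. \<Sum>b\<in>B. \<Sum>c\<in>C. \<Sum>t\<in>T. \<Sum>d\<in>D. g t a b c d)"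
    by (intro sum.cong refl sum.swap)
  also have "\<dots> = (\<Sum>a\<in>A. \<Sum>b\<in>B. \<Sum>c\<in>C. \<Sum>d\<in>D. \<Sum>t\<in>T. g t a b c d)"
    by (intro sum.cong refl sum.swap)
  finally show ?thesis .
qed

lemma sum_product_scaled:
  "c * sum f A * sum g B = (\<Sum>i\<in>A. \<Sum>j\<in>B. c * f i * g j)" for c :: complex
  unfolding mult.assoc sum_product by (simp only: sum_distrib_left)

text \<open>The sign in \<open>wedge\<close> involves the sizes of \<open>T\<close> and
  \<open>I - S\<close>; where the monomials do not vanish, these are the sizes of \<open>L\<close>
  and \<open>K'\<close>. Once the sign is expressed by the source indices, as in \<open>F\<close>,
  the sums over \<open>S\<close> and \<open>T\<close> separate into an exterior product in the
  \<open>dz\<close> and a conjugated one.\<close>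

lemma transform_wedge: "wedge (transform n A \<alpha>) (transform n A \<beta>) = transform n A (wedge \<alpha> \<beta>)"
proof (intro ext)
  fix I J
  let ?N = "Pow {..<n}" and ?m = "monom_form n A"
  define F where "F = (\<lambda>K L K' L'. (-1) ^ (card L * card K') * \<alpha> K L * \<beta> K' L')"
  have "wedge (transform n A \<alpha>) (transform n A \<beta>) I J
    = (\<Sum>S\<in>Pow I. \<Sum>T\<in>Pow J. \<Sum>K\<in>?N. \<Sum>L\<in>?N. \<Sum>K'\<in>?N. \<Sum>L'\<in>?N.
        F K L K' L' * (shuffle_sign S (I - S) * ?m K S * ?m K' (I - S)) * cnj (shuffle_sign T (J - T) * ?m L T * ?m L' (J - T)))"
    unfolding wedge_def transform_def
  proof (intro sum.cong refl)
    fix S T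
    have "(-1) ^ (card T * card (I - S)) * shuffle_sign S (I - S) * shuffle_sign T (J - T)
      * (\<Sum>K\<in>?N. \<Sum>L\<in>?N. \<alpha> K L * ?m K S * cnj (?m L T)) * (\<Sum>K\<in>?N. \<Sum>L\<in>?N. \<beta> K L * ?m K (I - S) * cnj (?m L (J - T)))
      = (\<Sum>K\<in>?N. \<Sum>L\<in>?N. \<Sum>K'\<in>?N. \<Sum>L'\<in>?N. (-1) ^ (card T * card (I - S)) * shuffle_sign S (I - S) * shuffle_sign T (J - T)
        * (\<alpha> K L * ?m K S * cnj (?m L T)) * (\<beta> K' L' * ?m K' (I - S) * cnj (?m L' (J - T))))"
      by (simp only: sum_distrib_left sum_distrib_right mult_ac)
    also have "\<dots> = (\<Sum>K\<in>?N. \<Sum>L\<in>?N. \<Sum>K'\<in>?N. \<Sum>L'\<in>?N.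
        F K L K' L' * (shuffle_sign S (I - S) * ?m K S * ?m K' (I - S)) * cnj (shuffle_sign T (J - T) * ?m L T * ?m L' (J - T)))"
    proof (intro sum.cong refl)
      fix K L K' L' assume h: "K \<in> ?N" "L \<in> ?N" "K' \<in> ?N" "L' \<in> ?N"
      show "(-1) ^ (card T * card (I - S)) * shuffle_sign S (I - S) * shuffle_sign T (J - T)
        * (\<alpha> K L * ?m K S * cnj (?m L T)) * (\<beta> K' L' * ?m K' (I - S) * cnj (?m L' (J - T)))
        = F K L K' L' * (shuffle_sign S (I - S) * ?m K S * ?m K' (I - S)) * cnj (shuffle_sign T (J - T) * ?m L T * ?m L' (J - T))"
      proof (cases "?m L T = 0 \<or> ?m K' (I - S) = 0")
        case False
        then have "card T = card L" "card (I - S) = card K'"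
          using monom_form_nonzeroD[of L n A T] monom_form_nonzeroD[of K' n A "I - S"] h finite_Pow_lessThan by auto
        then show ?thesis unfolding F_def by simp
      qed auto
    qed
    finally show "(-1) ^ (card T * card (I - S)) * shuffle_sign S (I - S) * shuffle_sign T (J - T)
      * (\<Sum>K\<in>?N. \<Sum>L\<in>?N. \<alpha> K L * ?m K S * cnj (?m L T)) * (\<Sum>K\<in>?N. \<Sum>L\<in>?N. \<beta> K L * ?m K (I - S) * cnj (?m L (J - T)))
      = (\<Sum>K\<in>?N. \<Sum>L\<in>?N. \<Sum>K'\<in>?N. \<Sum>L'\<in>?N.
        F K L K' L' * (shuffle_sign S (I - S) * ?m K S * ?m K' (I - S)) * cnj (shuffle_sign T (J - T) * ?m L T * ?m L' (J - T)))" .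
  qed
  also have "\<dots> = (\<Sum>S\<in>Pow I. \<Sum>K\<in>?N. \<Sum>L\<in>?N. \<Sum>K'\<in>?N. \<Sum>L'\<in>?N. \<Sum>T\<in>Pow J.
        F K L K' L' * (shuffle_sign S (I - S) * ?m K S * ?m K' (I - S)) * cnj (shuffle_sign T (J - T) * ?m L T * ?m L' (J - T)))"
    by (rule sum.cong[OF refl], rule sum_swap_four)
  also have "\<dots> = (\<Sum>K\<in>?N. \<Sum>L\<in>?N. \<Sum>K'\<in>?N. \<Sum>L'\<in>?N. \<Sum>S\<in>Pow I. \<Sum>T\<in>Pow J.
        F K L K' L' * (shuffle_sign S (I - S) * ?m K S * ?m K' (I - S)) * cnj (shuffle_sign T (J - T) * ?m L T * ?m L' (J - T)))"
    by (rule sum_swap_four)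
  also have "\<dots> = (\<Sum>K\<in>?N. \<Sum>L\<in>?N. \<Sum>K'\<in>?N. \<Sum>L'\<in>?N. F K L K' L' * ext_prod (?m K) (?m K') I * cnj (ext_prod (?m L) (?m L') J))"
    unfolding ext_prod_def cnj_sum sum_product_scaled ..
  also have "\<dots> = (\<Sum>K\<in>?N. \<Sum>L\<in>?N. \<Sum>K'\<in>?N. ext_prod (?m K) (?m K') I * cnj (\<Sum>L'\<in>?N. cnj (F K L K' L') * ext_prod (?m L) (?m L') J))"
    by (simp add: sum_distrib_left mult_ac)
  also have "\<dots> = (\<Sum>K\<in>?N. \<Sum>L\<in>?N. \<Sum>K'\<in>?N. ext_prod (?m K) (?m K') I * cnj (\<Sum>L'\<in>Pow ({..<n} - L). cnj (F K L K' L') * shuffle_sign L L' * ?m (L \<union> L') J))"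
    by (intro sum.cong refl arg_cong2[of _ _ _ _ "(*)"] arg_cong[of _ _ cnj] monom_form_prod_sum)
  also have "\<dots> = (\<Sum>K\<in>?N. \<Sum>L\<in>?N. \<Sum>K'\<in>?N. (\<Sum>L'\<in>Pow ({..<n} - L). F K L K' L' * shuffle_sign L L' * cnj (?m (L \<union> L') J)) * ext_prod (?m K) (?m K') I)"
    by (simp add: mult.commute)
  also have "\<dots> = (\<Sum>K\<in>?N. \<Sum>L\<in>?N. \<Sum>K'\<in>Pow ({..<n} - K). (\<Sum>L'\<in>Pow ({..<n} - L). F K L K' L' * shuffle_sign L L' * cnj (?m (L \<union> L') J)) * shuffle_sign K K' * ?m (K \<union> K') I)"
    by (intro sum.cong refl monom_form_prod_sum)
  also have "\<dots> = (\<Sum>K\<in>?N. \<Sum>L\<in>?N. \<Sum>K'\<in>Pow ({..<n} - K). \<Sum>L'\<in>Pow ({..<n} - L).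
      F K L K' L' * shuffle_sign L L' * cnj (?m (L \<union> L') J) * shuffle_sign K K' * ?m (K \<union> K') I)"
    by (simp only: sum_distrib_right)
  also have "\<dots> = (\<Sum>S\<in>?N. \<Sum>T\<in>?N. \<Sum>K\<in>Pow S. \<Sum>L\<in>Pow T.
      F K L (S - K) (T - L) * shuffle_sign L (T - L) * cnj (?m (L \<union> (T - L)) J) * shuffle_sign K (S - K) * ?m (K \<union> (S - K)) I)"
    by (rule sum_Pow_split2[symmetric]) simp_all
  also have "\<dots> = transform n A (wedge \<alpha> \<beta>) I J"
    unfolding transform_def wedge_def sum_distrib_right
  proof (intro sum.cong refl)
    fix S T K L assume "S \<in> ?N" "T \<in> ?N" "K \<in> Pow S" "L \<in> Pow T"
    then have e: "K \<union> (S - K) = S" "L \<union> (T - L) = T" by auto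
    show "F K L (S - K) (T - L) * shuffle_sign L (T - L) * cnj (?m (L \<union> (T - L)) J) * shuffle_sign K (S - K) * ?m (K \<union> (S - K)) I
      = (-1) ^ (card L * card (S - K)) * shuffle_sign K (S - K) * shuffle_sign L (T - L) * \<alpha> K L * \<beta> (S - K) (T - L) * ?m S I * cnj (?m T J)"
      unfolding e F_def by (simp only: mult_ac)
  qed
  finally show "wedge (transform n A \<alpha>) (transform n A \<beta>) I J = transform n A (wedge \<alpha> \<beta>) I J" .
qed

lemma transform_unit: "transform n A unit_form = unit_form"
proof (intro ext)
  fix I J
  have "transform n A unit_form I J = (\<Sum>K\<in>Pow {..<n}. \<Sum>L\<in>Pow {..<n}. if L = {} then (if K = {} then unit_form I J else 0) else 0)"
    unfolding transform_def by (intro sum.cong refl) (auto simp: unit_form_def unit_ext_def)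
  then show "transform n A unit_form I J = unit_form I J" by simp
qed

lemma transform_scale: "transform n A (\<lambda>I J. c * \<alpha> I J) = (\<lambda>I J. c * transform n A \<alpha> I J)"
  unfolding transform_def by (simp add: sum_distrib_left mult_ac)

lemma transform_sum: "transform n A (\<lambda>I J. \<Sum>x\<in>X. f x I J) = (\<lambda>I J. \<Sum>x\<in>X. transform n A (f x) I J)"
  unfolding transform_def by (simp add: sum_distrib_right sum.swap[of _ _ X])

lemma transform_conj: "conj_form (transform n A \<alpha>) = transform n A (conj_form \<alpha>)"
proof (intro ext)
  fix I J
  let ?N = "Pow {..<n}" and ?m = "monom_form n A"
  have "conj_form (transform n A \<alpha>) I J
    = (\<Sum>K\<in>?N. \<Sum>L\<in>?N. (-1) ^ (card I * card J) * (cnj (\<alpha> K L) * cnj (?m K J) * ?m L I))"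
    unfolding conj_form_def transform_def by (simp add: sum_distrib_left)
  also have "\<dots> = (\<Sum>K\<in>?N. \<Sum>L\<in>?N. (-1) ^ (card L * card K) * cnj (\<alpha> K L) * ?m L I * cnj (?m K J))"
  proof (intro sum.cong refl)
    fix K L assume h: "K \<in> ?N" "L \<in> ?N"
    show "(-1) ^ (card I * card J) * (cnj (\<alpha> K L) * cnj (?m K J) * ?m L I)
      = (-1) ^ (card L * card K) * cnj (\<alpha> K L) * ?m L I * cnj (?m K J)"
    proof (cases "?m L I = 0 \<or> ?m K J = 0")
      case False
      then have "card I = card L" "card J = card K"
        using monom_form_nonzeroD[of L n A I] monom_form_nonzeroD[of K n A J] h finite_Pow_lessThan by auto
      then show ?thesis by simp
    qed auto
  qed
  also have "\<dots> = transform n A (conj_form \<alpha>) I J"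
    unfolding transform_def conj_form_def by (rule sum.swap)
  finally show "conj_form (transform n A \<alpha>) I J = transform n A (conj_form \<alpha>) I J" .
qed

lemma transform_transform:
  assumes "A \<in> carrier_mat n n" "B \<in> carrier_mat n n"
  shows "transform n B (transform n A \<alpha>) = transform n (A * B) \<alpha>"
proof (intro ext)
  fix I J
  let ?N = "Pow {..<n}" and ?m = "monom_form n A" and ?l = "monom_form n B"
  have comp: "(\<Sum>S\<in>?N. ?m K S * ?l S I) = monom_form n (A * B) K I" if "K \<in> ?N" for K I
    using fun_cong[OF ext_transform_monom_form[OF assms, of K]] that unfolding ext_transform_def by auto
  have "transform n B (transform n A \<alpha>) I J
    = (\<Sum>S\<in>?N. \<Sum>T\<in>?N. \<Sum>K\<in>?N. \<Sum>L\<in>?N. \<alpha> K L * (?m K S * ?l S I) * cnj (?m L T * ?l T J))"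
    unfolding transform_def by (simp add: sum_distrib_left sum_distrib_right mult_ac)
  also have "\<dots> = (\<Sum>K\<in>?N. \<Sum>L\<in>?N. \<Sum>S\<in>?N. \<Sum>T\<in>?N. \<alpha> K L * (?m K S * ?l S I) * cnj (?m L T * ?l T J))"
  proof -
    have "(\<Sum>S\<in>?N. \<Sum>T\<in>?N. \<Sum>K\<in>?N. \<Sum>L\<in>?N. g S T K L) = (\<Sum>K\<in>?N. \<Sum>L\<in>?N. \<Sum>S\<in>?N. \<Sum>T\<in>?N. g S T K L)" for g :: "_ \<Rightarrow> _ \<Rightarrow> _ \<Rightarrow> _ \<Rightarrow> complex"
    proof -
      have "(\<Sum>S\<in>?N. \<Sum>T\<in>?N. \<Sum>K\<in>?N. \<Sum>L\<in>?N. g S T K L) = (\<Sum>S\<in>?N. \<Sum>K\<in>?N. \<Sum>T\<in>?N. \<Sum>L\<in>?N. g S T K L)"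
        by (intro sum.cong refl sum.swap)
      also have "\<dots> = (\<Sum>K\<in>?N. \<Sum>S\<in>?N. \<Sum>L\<in>?N. \<Sum>T\<in>?N. g S T K L)"
        by (subst sum.swap) (intro sum.cong refl sum.swap)
      also have "\<dots> = (\<Sum>K\<in>?N. \<Sum>L\<in>?N. \<Sum>S\<in>?N. \<Sum>T\<in>?N. g S T K L)"
        by (intro sum.cong refl sum.swap)
      finally show ?thesis .
    qed
    then show ?thesis .
  qed
  also have "\<dots> = (\<Sum>K\<in>?N. \<Sum>L\<in>?N. \<alpha> K L * (\<Sum>S\<in>?N. ?m K S * ?l S I) * cnj (\<Sum>T\<in>?N. ?m L T * ?l T J))"
    unfolding cnj_sum sum_product_scaled ..
  also have "\<dots> = transform n (A * B) \<alpha> I J"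
    unfolding transform_def by (intro sum.cong refl) (simp only: comp)
  finally show "transform n B (transform n A \<alpha>) I J = transform n (A * B) \<alpha> I J" .
qed

lemma transform_one:
  assumes "\<And>I J. \<alpha> I J \<noteq> 0 \<Longrightarrow> I \<subseteq> {..<n} \<and> J \<subseteq> {..<n}"
  shows "transform n (1\<^sub>m n) \<alpha> = \<alpha>"
proof (intro ext)
  fix I J
  have "transform n (1\<^sub>m n) \<alpha> I J = (\<Sum>K\<in>Pow {..<n}. \<Sum>L\<in>Pow {..<n}. if L = J then (if K = I then \<alpha> I J else 0) else 0)"
    unfolding transform_def by (intro sum.cong refl) (auto simp: monom_form_one)
  also have "\<dots> = (if I \<in> Pow {..<n} \<and> J \<in> Pow {..<n} then \<alpha> I J else 0)"
    by (cases "I \<subseteq> {..<n}"; cases "J \<subseteq> {..<n}") simp_all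
  also have "\<dots> = \<alpha> I J" using assms by auto
  finally show "transform n (1\<^sub>m n) \<alpha> I J = \<alpha> I J" .
qed

lemma formsD: "\<alpha> \<in> forms n p q \<Longrightarrow> \<alpha> I J \<noteq> 0 \<Longrightarrow> I \<subseteq> {..<n} \<and> J \<subseteq> {..<n} \<and> card I = p \<and> card J = q"
  unfolding forms_def by blast

lemma transform_forms:
  assumes "\<alpha> \<in> forms n p q"
  shows "transform n A \<alpha> \<in> forms n p q"
  unfolding forms_def
proof (intro CollectI allI impI)
  fix I J assume "transform n A \<alpha> I J \<noteq> 0"
  then obtain K where K: "K \<in> Pow {..<n}" "(\<Sum>L\<in>Pow {..<n}. \<alpha> K L * monom_form n A K I * cnj (monom_form n A L J)) \<noteq> 0"
    unfolding transform_def by (rule sum.not_neutral_contains_not_neutral)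
  then obtain L where L: "L \<in> Pow {..<n}" "\<alpha> K L * monom_form n A K I * cnj (monom_form n A L J) \<noteq> 0"
    by (elim sum.not_neutral_contains_not_neutral)
  then have nz: "\<alpha> K L \<noteq> 0" "monom_form n A K I \<noteq> 0" "monom_form n A L J \<noteq> 0" by auto
  show "I \<subseteq> {..<n} \<and> J \<subseteq> {..<n} \<and> card I = p \<and> card J = q"
    using formsD[OF assms nz(1)] monom_form_nonzeroD[OF finite_Pow_lessThan[OF K(1)] nz(2)]
      monom_form_nonzeroD[OF finite_Pow_lessThan[OF L(1)] nz(3)] by auto
qed

lemma transform_inverse:
  assumes "A \<in> carrier_mat n n" "B \<in> carrier_mat n n" "A * B = 1\<^sub>m n" "\<alpha> \<in> forms n p q"
  shows "transform n B (transform n A \<alpha>) = \<alpha>"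
  unfolding transform_transform[OF assms(1,2)] assms(3)
  by (rule transform_one) (use formsD[OF assms(4)] in blast)

lemma bij_betw_transform:
  assumes "A \<in> carrier_mat n n" "B \<in> carrier_mat n n" "A * B = 1\<^sub>m n" "B * A = 1\<^sub>m n"
  shows "bij_betw (transform n A) (forms n p q) (forms n p q)"
  by (rule bij_betw_byWitness[where f' = "transform n B"])
    (auto simp: transform_inverse[OF assms(1-3)] transform_inverse[OF assms(2,1,4)] transform_forms)

text \<open>Wedging with the transformed form is conjugate to wedging with \<open>\<Omega>\<close>
  under the invertible substitution.\<close>

lemma lefschetz_transform:
  assumes A: "A \<in> carrier_mat n n" "B \<in> carrier_mat n n" "A * B = 1\<^sub>m n" "B * A = 1\<^sub>m n"
    and "lefschetz n p q \<Omega>"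
  shows "lefschetz n p q (transform n A \<Omega>)"
proof -
  have "bij_betw (transform n A \<circ> ((\<lambda>\<alpha>. wedge \<alpha> \<Omega>) \<circ> transform n B)) (forms n p q) (forms n (n - q) (n - p))"
    using bij_betw_transform[OF A(2,1,4,3)] bij_betw_transform[OF A] assms(5)
    unfolding lefschetz_def by (blast intro: bij_betw_trans)
  moreover have "(transform n A \<circ> ((\<lambda>\<alpha>. wedge \<alpha> \<Omega>) \<circ> transform n B)) \<alpha> = wedge \<alpha> (transform n A \<Omega>)"
    if "\<alpha> \<in> forms n p q" for \<alpha>
    using that by (simp add: transform_wedge[symmetric] transform_inverse[OF A(2,1,4)])
  ultimately show ?thesis unfolding lefschetz_def by (simp cong: bij_betw_cong)
qed

section \<open>Diagonal forms\<close>

lemma wedge_scale_left: "wedge (\<lambda>I J. c * \<alpha> I J) \<beta> = (\<lambda>I J. c * wedge \<alpha> \<beta> I J)"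
  unfolding wedge_def by (simp add: sum_distrib_left mult_ac)

lemma wedge_scale_right: "wedge \<alpha> (\<lambda>I J. c * \<beta> I J) = (\<lambda>I J. c * wedge \<alpha> \<beta> I J)"
  unfolding wedge_def by (simp add: sum_distrib_left mult_ac)

lemma wedge_sum_left: "wedge (\<lambda>I J. \<Sum>x\<in>X. f x I J) \<beta> = (\<lambda>I J. \<Sum>x\<in>X. wedge (f x) \<beta> I J)"
  unfolding wedge_def by (simp add: sum_distrib_left sum_distrib_right sum.swap[of _ _ X])

lemma wedge_sum_right: "wedge \<alpha> (\<lambda>I J. \<Sum>x\<in>X. f x I J) = (\<lambda>I J. \<Sum>x\<in>X. wedge \<alpha> (f x) I J)"
  unfolding wedge_def by (simp add: sum_distrib_left sum.swap[of _ _ X])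

lemma wedge_diff_left: "wedge (\<lambda>I J. \<alpha> I J - \<alpha>' I J) \<beta> = (\<lambda>I J. wedge \<alpha> \<beta> I J - wedge \<alpha>' \<beta> I J)"
  unfolding wedge_def sum_subtractf[symmetric] by (simp add: algebra_simps)

lemma forms_diff: "\<alpha> \<in> forms n p q \<Longrightarrow> \<alpha>' \<in> forms n p q \<Longrightarrow> (\<lambda>I J. \<alpha> I J - \<alpha>' I J) \<in> forms n p q"
proof -
  assume a: "\<alpha> \<in> forms n p q" "\<alpha>' \<in> forms n p q"
  have "\<alpha> I J \<noteq> 0 \<or> \<alpha>' I J \<noteq> 0" if "\<alpha> I J - \<alpha>' I J \<noteq> 0" for I J using that by auto
  then show ?thesis using formsD[OF a(1)] formsD[OF a(2)] unfolding forms_def by blast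
qed

lemma wedge_forms:
  assumes "\<alpha> \<in> forms n p q" "\<beta> \<in> forms n k l"
  shows "wedge \<alpha> \<beta> \<in> forms n (p + k) (q + l)"
  unfolding forms_def
proof (intro CollectI allI impI)
  fix I J assume "wedge \<alpha> \<beta> I J \<noteq> 0"
  then obtain K where K: "K \<in> Pow I" "(\<Sum>L\<in>Pow J. (-1) ^ (card L * card (I - K)) * shuffle_sign K (I - K) * shuffle_sign L (J - L)
       * \<alpha> K L * \<beta> (I - K) (J - L)) \<noteq> 0"
    unfolding wedge_def by (rule sum.not_neutral_contains_not_neutral)
  then obtain L where L: "L \<in> Pow J" "(-1) ^ (card L * card (I - K)) * shuffle_sign K (I - K) * shuffle_sign L (J - L)
       * \<alpha> K L * \<beta> (I - K) (J - L) \<noteq> 0"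
    by (elim sum.not_neutral_contains_not_neutral)
  then have nz: "\<alpha> K L \<noteq> 0" "\<beta> (I - K) (J - L) \<noteq> 0" by auto
  note a = formsD[OF assms(1) nz(1)] and b = formsD[OF assms(2) nz(2)]
  have e: "I = K \<union> (I - K)" "J = L \<union> (J - L)" using K(1) L(1) by auto
  have fin: "finite K" "finite L" "finite (I - K)" "finite (J - L)"
    using a b by (meson finite_lessThan finite_subset)+
  have "card I = card K + card (I - K)" by (subst e(1), rule card_Un_disjoint) (use fin in auto)
  moreover have "card J = card L + card (J - L)" by (subst e(2), rule card_Un_disjoint) (use fin in auto)
  ultimately show "I \<subseteq> {..<n} \<and> J \<subseteq> {..<n} \<and> card I = p + k \<and> card J = q + l" using a b e by auto
qed

section \<open>Bijectivity from injectivity\<close>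

definition basis_index :: "nat \<Rightarrow> nat \<Rightarrow> nat \<Rightarrow> (nat set \<times> nat set) set" where
  "basis_index n p q = {(I, J). I \<subseteq> {..<n} \<and> J \<subseteq> {..<n} \<and> card I = p \<and> card J = q}"

definition basis_form :: "nat set \<times> nat set \<Rightarrow> form" where
  "basis_form x = (\<lambda>I J. if (I, J) = x then 1 else 0)"

lemma finite_basis_index [simp]: "finite (basis_index n p q)"
  by (rule finite_subset[of _ "Pow {..<n} \<times> Pow {..<n}"]) (auto simp: basis_index_def)

lemma forms_outside_basis: "\<alpha> \<in> forms n p q \<Longrightarrow> (I, J) \<notin> basis_index n p q \<Longrightarrow> \<alpha> I J = 0"
  unfolding forms_def basis_index_def by blast

lemma forms_basis_sum:
  assumes "bij_betw e {..<N} (basis_index n p q)"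
  shows "(\<lambda>I J. \<Sum>x<N. v x * basis_form (e x) I J) \<in> forms n p q"
    and "\<alpha> \<in> forms n p q \<Longrightarrow> \<alpha> = (\<lambda>I J. \<Sum>x<N. \<alpha> (fst (e x)) (snd (e x)) * basis_form (e x) I J)"
proof -
  have eval: "(\<Sum>x<N. w (e x) * basis_form (e x) I J) = (if (I, J) \<in> basis_index n p q then w (I, J) else 0)" for w I J
  proof -
    have "(\<Sum>x<N. w (e x) * basis_form (e x) I J) = (\<Sum>y\<in>basis_index n p q. w y * basis_form y I J)"
      by (rule sum.reindex_bij_betw[OF assms])
    also have "\<dots> = (\<Sum>y\<in>basis_index n p q. if y = (I, J) then w (I, J) else 0)"
      by (intro sum.cong) (auto simp: basis_form_def)
    finally show ?thesis by simp
  qed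
  have inv: "v x = v (the_inv_into {..<N} e (e x))" if "x < N" for x
    using assms that by (simp add: bij_betw_def the_inv_into_f_f)
  have "(\<Sum>x<N. v x * basis_form (e x) I J) = (if (I, J) \<in> basis_index n p q then v (the_inv_into {..<N} e (I, J)) else 0)" for I J
    using eval[of "\<lambda>y. v (the_inv_into {..<N} e y)" I J] inv by simp
  then show "(\<lambda>I J. \<Sum>x<N. v x * basis_form (e x) I J) \<in> forms n p q"
    unfolding forms_def basis_index_def by auto
  show "\<alpha> = (\<lambda>I J. \<Sum>x<N. \<alpha> (fst (e x)) (snd (e x)) * basis_form (e x) I J)" if "\<alpha> \<in> forms n p q"
    using eval[of "\<lambda>y. \<alpha> (fst y) (snd y)"] forms_outside_basis[OF that] by (auto simp: fun_eq_iff)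
qed

lemma lefschetzI:
  assumes \<Omega>: "\<Omega> \<in> forms n k k" and pqk: "p + q + k = n"
    and inj: "\<And>\<alpha>. \<alpha> \<in> forms n p q \<Longrightarrow> wedge \<alpha> \<Omega> = (\<lambda>I J. 0) \<Longrightarrow> \<alpha> = (\<lambda>I J. 0)"
  shows "lefschetz n p q \<Omega>"
proof -
  have nq: "n - q = p + k" "n - p = q + k" using pqk by auto
  have maps: "wedge \<alpha> \<Omega> \<in> forms n (n - q) (n - p)" if "\<alpha> \<in> forms n p q" for \<alpha>
    unfolding nq by (rule wedge_forms[OF that \<Omega>])
  define N where "N = card (basis_index n p q)"
  obtain e where e: "bij_betw e {..<N} (basis_index n p q)"
    using ex_bij_betw_nat_finite[OF finite_basis_index] unfolding N_def by (metis lessThan_atLeast0)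
  \<comment> \<open>Exchanging and complementing the two index sets matches the bases of source and
    target, so the map has a square matrix \<open>G\<close>, and injectivity makes
    \<open>det G\<close> nonzero.\<close>
  let ?h = "\<lambda>(I, J). ({..<n} - J, {..<n} - I)"
  have h: "bij_betw ?h (basis_index n p q) (basis_index n (n - q) (n - p))"
    by (rule bij_betw_byWitness[where f' = ?h])
      (use pqk in \<open>auto simp: basis_index_def card_Diff_subset finite_subset[OF _ finite_lessThan] double_diff\<close>)
  define f where "f = ?h \<circ> e"
  have f: "bij_betw f {..<N} (basis_index n (n - q) (n - p))"
    unfolding f_def by (rule bij_betw_trans[OF e h])
  define G where "G = mat N N (\<lambda>(y, x). wedge (basis_form (e x)) \<Omega> (fst (f y)) (snd (f y)))"
  have G: "G \<in> carrier_mat N N" unfolding G_def by simp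
  define mk where "mk = (\<lambda>(v::complex vec) I J. \<Sum>x<N. v $ x * basis_form (e x) I J)"
  have mk: "mk v \<in> forms n p q" for v unfolding mk_def by (rule forms_basis_sum(1)[OF e])
  have wmk: "wedge (mk v) \<Omega> (fst (f y)) (snd (f y)) = (G *\<^sub>v v) $ y" if "y < N" "v \<in> carrier_vec N" for v y
    using that unfolding mk_def wedge_sum_left wedge_scale_left
    by (auto simp: G_def scalar_prod_def lessThan_atLeast0 mult.commute intro!: sum.cong)
  have ext: "\<beta> = \<beta>'" if "\<beta> \<in> forms n (n - q) (n - p)" "\<beta>' \<in> forms n (n - q) (n - p)"
    "\<And>y. y < N \<Longrightarrow> \<beta> (fst (f y)) (snd (f y)) = \<beta>' (fst (f y)) (snd (f y))" for \<beta> \<beta>'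
  proof (intro ext)
    fix I J
    show "\<beta> I J = \<beta>' I J"
    proof (cases "(I, J) \<in> basis_index n (n - q) (n - p)")
      case True
      then obtain y where "y < N" "f y = (I, J)" using f by (metis bij_betw_iff_bijections lessThan_iff)
      then show ?thesis using that(3)[of y] by simp
    qed (use forms_outside_basis that in metis)
  qed
  have mk0: "v = 0\<^sub>v N" if "mk v = (\<lambda>I J. 0)" "v \<in> carrier_vec N" for v
  proof (rule eq_vecI)
    fix x assume x: "x < dim_vec (0\<^sub>v N :: complex vec)"
    have "mk v (fst (e x)) (snd (e x)) = (\<Sum>y<N. if y = x then v $ x else 0)"
      unfolding mk_def using e x by (intro sum.cong) (auto simp: basis_form_def bij_betw_def inj_on_def)
    then show "v $ x = 0\<^sub>v N $ x" using x that(1) by simp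
  qed (use that in simp)
  have zero: "(\<lambda>I J. 0) \<in> forms n a b" for a b unfolding forms_def by simp
  have "det G \<noteq> 0"
  proof
    assume "det G = 0"
    then obtain v where v: "v \<in> carrier_vec N" "v \<noteq> 0\<^sub>v N" "G *\<^sub>v v = 0\<^sub>v N"
      unfolding det_0_iff_vec_prod_zero_field[OF G] by blast
    have "wedge (mk v) \<Omega> = (\<lambda>I J. 0)"
      by (rule ext[OF maps[OF mk] zero]) (use v wmk in simp)
    with inj[OF mk] have "mk v = (\<lambda>I J. 0)" .
    with mk0 v show False by blast
  qed
  from det_non_zero_imp_unit[OF G this, of "()"]
  obtain H where H: "H \<in> carrier_mat N N" "G * H = 1\<^sub>m N"
    unfolding Units_def ring_mat_def by auto
  show ?thesis unfolding lefschetz_def bij_betw_def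
  proof
    show "inj_on (\<lambda>\<alpha>. wedge \<alpha> \<Omega>) (forms n p q)"
    proof (rule inj_onI)
      fix \<alpha> \<alpha>' assume a: "\<alpha> \<in> forms n p q" "\<alpha>' \<in> forms n p q" "wedge \<alpha> \<Omega> = wedge \<alpha>' \<Omega>"
      have "(\<lambda>I J. \<alpha> I J - \<alpha>' I J) = (\<lambda>I J. 0)"
        by (rule inj[OF forms_diff[OF a(1,2)]]) (simp add: wedge_diff_left a(3))
      then show "\<alpha> = \<alpha>'" by (simp add: fun_eq_iff)
    qed
    show "(\<lambda>\<alpha>. wedge \<alpha> \<Omega>) ` forms n p q = forms n (n - q) (n - p)"
    proof (intro subset_antisym subsetI)
      fix \<beta> assume b: "\<beta> \<in> forms n (n - q) (n - p)"
      define b where "b = vec N (\<lambda>y. \<beta> (fst (f y)) (snd (f y)))"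
      have bN: "b \<in> carrier_vec N" unfolding b_def by simp
      have "G *\<^sub>v (H *\<^sub>v b) = b"
        using assoc_mult_mat_vec[OF G H(1) bN] H(2) bN by simp
      moreover have "H *\<^sub>v b \<in> carrier_vec N" using H(1) bN by simp
      ultimately have "wedge (mk (H *\<^sub>v b)) \<Omega> = \<beta>"
        by (intro ext[OF maps[OF mk] b]) (simp add: wmk b_def)
      then show "\<beta> \<in> (\<lambda>\<alpha>. wedge \<alpha> \<Omega>) ` forms n p q" using mk by blast
    qed (use maps in auto)
  qed
qed

text \<open>
  For \<open>J = {j\<^sub>1 < \<dots> < j\<^sub>p}\<close> one has \<open>\<And>\<^bsub>j\<in>J\<^esub> V\<^sub>j = vol_coeff p dz\<^sub>J \<and> d\<bar>z\<^sub>J\<close>, so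
  \<open>diag_form c\<close> below is \<open>\<Sum>\<^sub>J c\<^sub>J V\<^sub>J\<close>.
\<close>

fun vol_coeff :: "nat \<Rightarrow> complex" where
  "vol_coeff 0 = 1"
| "vol_coeff (Suc p) = vol_coeff p * ((\<i> / 2) * (-1) ^ p)"

lemma vol_coeff_add: "vol_coeff (p + q) = (-1) ^ (p * q) * vol_coeff p * vol_coeff q"
  by (induction q) (simp_all add: power_add algebra_simps)

lemma vol_coeff_nonzero [simp]: "vol_coeff p \<noteq> 0"
  by (induction p) simp_all

lemma cnj_vol_coeff: "cnj (vol_coeff p) = (-1) ^ p * vol_coeff p"
  by (induction p) simp_all

definition diag_form :: "(nat set \<Rightarrow> complex) \<Rightarrow> form" where
  "diag_form c = (\<lambda>I J. if I = J \<and> finite I then vol_coeff (card I) * c I else 0)"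

text \<open>The product of the commutative algebra spanned by the \<open>V_J\<close>:
  \<open>V_K V_L\<close> is \<open>V\<close> of the union for disjoint index sets and zero
  otherwise, without signs because each \<open>V_j\<close> has even degree.\<close>

definition subset_conv :: "(nat set \<Rightarrow> complex) \<Rightarrow> (nat set \<Rightarrow> complex) \<Rightarrow> nat set \<Rightarrow> complex" where
  "subset_conv f g = (\<lambda>I. \<Sum>K\<in>Pow I. f K * g (I - K))"

lemma wedge_diag_right:
  assumes fin: "finite I" "finite J"
  shows "wedge \<alpha> (diag_form c) I J = (\<Sum>R\<in>Pow (I \<inter> J). (-1) ^ (card (J - R) * card R)
    * shuffle_sign (I - R) R * shuffle_sign (J - R) R * \<alpha> (I - R) (J - R) * (vol_coeff (card R) * c R))"
proof -
  let ?t = "\<lambda>R. (-1) ^ (card (J - R) * card R)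
    * shuffle_sign (I - R) R * shuffle_sign (J - R) R * \<alpha> (I - R) (J - R) * (vol_coeff (card R) * c R)"
  have refl_sum: "(\<Sum>K\<in>Pow S. g K (S - K)) = (\<Sum>R\<in>Pow S. g (S - R) R)" for S :: "nat set" and g :: "nat set \<Rightarrow> nat set \<Rightarrow> complex"
    by (rule sum.reindex_bij_witness[where i = "\<lambda>K. S - K" and j = "\<lambda>K. S - K"]) (auto simp: double_diff)
  have "wedge \<alpha> (diag_form c) I J = (\<Sum>K\<in>Pow I. \<Sum>R'\<in>Pow J. (-1) ^ (card (J - R') * card (I - K)) * shuffle_sign K (I - K) * shuffle_sign (J - R') R'
       * \<alpha> K (J - R') * diag_form c (I - K) R')"
    unfolding wedge_def by (intro sum.cong refl refl_sum)
  also have "\<dots> = (\<Sum>R\<in>Pow I. \<Sum>R'\<in>Pow J. (-1) ^ (card (J - R') * card R) * shuffle_sign (I - R) R * shuffle_sign (J - R') R'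
       * \<alpha> (I - R) (J - R') * diag_form c R R')"
    by (rule refl_sum[of "\<lambda>K R. \<Sum>R'\<in>Pow J. (-1) ^ (card (J - R') * card R) * shuffle_sign K R * shuffle_sign (J - R') R'
       * \<alpha> K (J - R') * diag_form c R R'"])
  also have "\<dots> = (\<Sum>R\<in>Pow I. \<Sum>R'\<in>Pow J. if R' = R then ?t R else 0)"
    using fin by (intro sum.cong refl) (auto simp: diag_form_def dest: finite_subset)
  also have "\<dots> = (\<Sum>R\<in>Pow I. if R \<in> Pow J then ?t R else 0)"
    using fin by (intro sum.cong refl) (simp only: sum.delta finite_Pow_iff)
  also have "\<dots> = (\<Sum>R\<in>Pow (I \<inter> J). ?t R)"
    by (rule sum.mono_neutral_cong_right) (use fin in auto)
  finally show ?thesis .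
qed

lemma wedge_diag_form: "wedge (diag_form f) (diag_form g) = diag_form (subset_conv f g)"
proof (intro ext)
  fix I J
  show "wedge (diag_form f) (diag_form g) I J = diag_form (subset_conv f g) I J"
  proof (cases "finite I \<and> finite J")
    case True
    note w = wedge_diag_right[of I J "diag_form f" g]
    show ?thesis
    proof (cases "I = J")
      case False
      have "I - R \<noteq> J - R" if "R \<in> Pow (I \<inter> J)" for R using that False by blast
      then show ?thesis using w True False by (simp add: diag_form_def)
    next
      case eq: True
      have finI: "finite I" using True by simp
      have "wedge (diag_form f) (diag_form g) I I = (\<Sum>R\<in>Pow I. vol_coeff (card I) * (f (I - R) * g R))"
        unfolding wedge_diag_right[OF finI finI] Int_absorb
      proof (intro sum.cong refl)
        fix R assume R: "R \<in> Pow I"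
        have fin: "finite R" "finite (I - R)" using True R by (auto intro: finite_subset)
        have "I = (I - R) \<union> R" using R by auto
        then have "card I = card (I - R) + card R" using fin card_Un_disjoint[of "I - R" R] by (metis Diff_disjoint inf_commute)
        then have v: "vol_coeff (card I) = (-1) ^ (card (I - R) * card R) * vol_coeff (card (I - R)) * vol_coeff (card R)"
          by (simp add: vol_coeff_add)
        show "(-1) ^ (card (I - R) * card R) * shuffle_sign (I - R) R * shuffle_sign (I - R) R * diag_form f (I - R) (I - R)
          * (vol_coeff (card R) * g R) = vol_coeff (card I) * (f (I - R) * g R)"
          unfolding v using fin by (simp add: diag_form_def mult_ac)
      qed
      also have "\<dots> = vol_coeff (card I) * (\<Sum>K\<in>Pow I. f K * g (I - K))"
        unfolding sum_distrib_left
        by (rule sum.reindex_bij_witness[where i = "\<lambda>K. I - K" and j = "\<lambda>K. I - K"]) (auto simp: double_diff)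
      finally show ?thesis using True eq by (simp add: diag_form_def subset_conv_def)
    qed
  next
    case False
    then show ?thesis by (auto simp: wedge_infinite diag_form_def)
  qed
qed

lemma diag_form_forms:
  assumes "\<And>I. c I \<noteq> 0 \<Longrightarrow> I \<subseteq> {..<n} \<and> card I = k"
  shows "diag_form c \<in> forms n k k"
  using assms unfolding forms_def diag_form_def by auto

text \<open>Conjugating \<open>vol_coeff p\<close> gives the sign \<open>(-1) ^ p\<close>, and
  exchanging \<open>p\<close> holomorphic with \<open>p\<close> antiholomorphic factors gives
  \<open>(-1) ^ (p * p)\<close>; the parities agree.\<close>

lemma conj_diag_form:
  assumes "\<And>I. cnj (c I) = c I"
  shows "conj_form (diag_form c) = diag_form c"
proof (intro ext)
  fix I J :: "nat set"
  have "(-1 :: complex) ^ (card I * card I) * (-1) ^ card I = 1"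
    by (cases "even (card I)") auto
  then have "(-1) ^ (card I * card I) * ((-1) ^ card I * x) = x" for x :: complex
    by (simp flip: mult.assoc)
  then show "conj_form (diag_form c) I J = diag_form c I J"
    using assms unfolding conj_form_def diag_form_def by (auto simp: cnj_vol_coeff mult.assoc)
qed

lemma card_lessThan_minus: "I \<subseteq> {..<n} \<Longrightarrow> card ({..<n::nat} - I) = n - card I"
  by (simp add: card_Diff_subset finite_subset[OF _ finite_lessThan])

text \<open>Wedging with \<open>V_R\<close> adds \<open>R\<close> to both index sets, so
  \<open>P = I - J\<close> and \<open>Q = J - I\<close> are preserved and only the common part
  \<open>S\<close> varies inside \<open>X\<close>. Because
  \<open>2 * card S \<le> p + q \<le> 3\<close>, the set \<open>S\<close> is empty, which gives a
  scalar equation, or a singleton, which gives the linear system in \<open>nonsing\<close>.\<close>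

lemma lefschetz_diag_form:
  assumes supp: "\<And>R. c R \<noteq> 0 \<Longrightarrow> R \<subseteq> {..<n} \<and> card R = k"
    and nz: "\<And>R. R \<subseteq> {..<n} \<Longrightarrow> card R = k \<Longrightarrow> c R \<noteq> 0"
    and nonsing: "\<And>X u. X \<subseteq> {..<n} \<Longrightarrow> card X = k + 2 \<Longrightarrow>
      (\<And>i. i \<in> X \<Longrightarrow> (\<Sum>j\<in>X - {i}. c (X - {i, j}) * u j) = 0) \<Longrightarrow> \<forall>i\<in>X. u i = 0"
    and pq: "p + q + k = n" "p + q \<le> 3"
  shows "lefschetz n p q (diag_form c)"
proof (rule lefschetzI[OF diag_form_forms[OF supp] pq(1)])
  fix \<alpha> assume \<alpha>: "\<alpha> \<in> forms n p q" and zero: "wedge \<alpha> (diag_form c) = (\<lambda>I J. 0)"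
  show "\<alpha> = (\<lambda>I J. 0)"
  proof (intro ext, rule ccontr)
    fix I0 J0 assume nzero: "\<alpha> I0 J0 \<noteq> 0"
    then have IJ: "I0 \<subseteq> {..<n}" "J0 \<subseteq> {..<n}" "card I0 = p" "card J0 = q" using formsD[OF \<alpha>] by auto
    then have fin: "finite I0" "finite J0" by (auto intro: finite_subset)
    define S P Q where "S = I0 \<inter> J0" and "P = I0 - J0" and "Q = J0 - I0"
    define X where "X = {..<n} - P - Q"
    have finPQ: "finite P" "finite Q" "finite S" "finite X" using fin unfolding P_def Q_def S_def X_def by auto
    have "I0 = P \<union> S" "J0 = Q \<union> S" "P \<inter> S = {}" "Q \<inter> S = {}" unfolding P_def Q_def S_def by auto
    then have cI: "p = card P + card S" and cJ: "q = card Q + card S"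
      using card_Un_disjoint[of P S] card_Un_disjoint[of Q S] finPQ IJ by simp_all
    have PQ: "P \<union> Q \<subseteq> {..<n}" "P \<inter> Q = {}" "S \<subseteq> X" "P \<subseteq> {..<n}" "Q \<subseteq> {..<n}"
      using IJ unfolding P_def Q_def S_def X_def by auto
    have "X = {..<n} - (P \<union> Q)" unfolding X_def by auto
    then have "card X = n - card (P \<union> Q)" using card_lessThan_minus[OF PQ(1)] by simp
    also have "card (P \<union> Q) = card P + card Q" using finPQ PQ(2) by (intro card_Un_disjoint)
    finally have cX: "card X = k + 2 * card S" using pq(1) cI cJ by simp
    have eqn: "(\<Sum>R\<in>Pow (I \<inter> J). (-1) ^ (card (J - R) * card R)
      * shuffle_sign (I - R) R * shuffle_sign (J - R) R * \<alpha> (I - R) (J - R) * (vol_coeff (card R) * c R)) = 0"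
      if "finite I" "finite J" for I J
      using wedge_diag_right[OF that, of \<alpha> c] zero by (simp add: fun_eq_iff)
    have "card S \<le> 1" using cI cJ pq(2) by linarith
    then consider "card S = 0" | "card S = 1" by linarith
    then show False
    proof cases
      case 1
      then have S: "S = {}" using finPQ by simp
      \<comment> \<open>Here \<open>I \<inter> J = X\<close> has exactly \<open>k\<close> elements,
        so the coefficient at these index sets contains the single term
        \<open>R = X\<close>.\<close>
      define I J where "I = {..<n} - J0" and "J = {..<n} - I0"
      have IJX: "I \<inter> J = X" "I - X = I0" "J - X = J0"
        using S IJ unfolding I_def J_def X_def P_def Q_def S_def by auto
      have XX: "X \<subseteq> {..<n}" "card X = k" using cX 1 unfolding X_def by auto
      define t where "t = (\<lambda>R. (-1) ^ (card (J - R) * card R)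
        * shuffle_sign (I - R) R * shuffle_sign (J - R) R * \<alpha> (I - R) (J - R) * (vol_coeff (card R) * c R))"
      have "(\<Sum>R\<in>Pow X. t R) = 0"
        unfolding t_def by (rule eqn[of I J, unfolded IJX(1)]) (simp_all add: I_def J_def)
      also have "(\<Sum>R\<in>Pow X. t R) = (\<Sum>R\<in>{X}. t R)"
      proof (rule sum.mono_neutral_right)
        show "\<forall>R\<in>Pow X - {X}. t R = 0"
        proof
          fix R assume R: "R \<in> Pow X - {X}"
          then have "card R < card X" using finPQ(4) by (intro psubset_card_mono) auto
          then have "c R = 0" using supp[of R] XX by auto
          then show "t R = 0" unfolding t_def by simp
        qed
      qed (use finPQ in auto)
      finally have "\<alpha> I0 J0 * c X = 0" by (simp add: t_def IJX)
      then show False using nzero nz[OF XX] by simp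
    next
      case 2
      then obtain i0 where S: "S = {i0}" by (rule card_1_singletonE)
      have i0: "i0 \<in> X" using PQ(3) S by auto
      have I0J0: "I0 = insert i0 P" "J0 = insert i0 Q" using S unfolding S_def P_def Q_def by auto
      have X: "X \<subseteq> {..<n}" "card X = k + 2" using cX 2 unfolding X_def by auto
      have XP: "X \<inter> P = {}" "X \<inter> Q = {}" unfolding X_def by auto
      \<comment> \<open>The signs that depend on \<open>j\<close> are absorbed into the unknowns;
        what remains besides \<open>c (X - {i, j})\<close> is the factor \<open>C\<close>, common to
        all \<open>j\<close>.\<close>
      define u where "u = (\<lambda>j. shuffle_sign P {j} * shuffle_sign Q {j} * \<alpha> (insert j P) (insert j Q))"
      have "\<forall>i\<in>X. u i = 0"
      proof (rule nonsing[OF X])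
        fix i assume i: "i \<in> X"
        \<comment> \<open>These are \<open>P \<union> (X - {i})\<close> and
          \<open>Q \<union> (X - {i})\<close>. A subset of \<open>X - {i}\<close> with
          \<open>k\<close> elements omits one further index \<open>j\<close>, and it meets the
          coefficient of \<open>\<alpha>\<close> with common part \<open>{j}\<close>.\<close>
        define I J where "I = {..<n} - Q - {i}" and "J = {..<n} - P - {i}"
        have IJ: "I \<inter> J = X - {i}" unfolding I_def J_def X_def by auto
        define t where "t = (\<lambda>R. (-1) ^ (card (J - R) * card R)
          * shuffle_sign (I - R) R * shuffle_sign (J - R) R * \<alpha> (I - R) (J - R) * (vol_coeff (card R) * c R))"
        define C where "C = (-1) ^ (Suc (card Q) * k) * vol_coeff k
          * (shuffle_sign P X * shuffle_sign P {i}) * (shuffle_sign Q X * shuffle_sign Q {i})"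
        have "(\<Sum>R\<in>Pow (X - {i}). t R) = 0"
          unfolding t_def by (rule eqn[of I J, unfolded IJ]) (simp_all add: I_def J_def)
        also have "(\<Sum>R\<in>Pow (X - {i}). t R) = (\<Sum>R\<in>(\<lambda>j. X - {i, j}) ` (X - {i}). t R)"
        proof (rule sum.mono_neutral_right)
          show "\<forall>R\<in>Pow (X - {i}) - (\<lambda>j. X - {i, j}) ` (X - {i}). t R = 0"
          proof
            fix R assume R: "R \<in> Pow (X - {i}) - (\<lambda>j. X - {i, j}) ` (X - {i})"
            have "card R \<noteq> k"
            proof
              assume "card R = k"
              have "card (X - {i} - R) = card (X - {i}) - card R"
                using R finPQ(4) by (intro card_Diff_subset) (auto intro: finite_subset)
              also have "\<dots> = 1" using \<open>card R = k\<close> X i finPQ(4) by simp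
              finally obtain j where "X - {i} - R = {j}" by (rule card_1_singletonE)
              then have "R = X - {i, j}" "j \<in> X - {i}" using R by auto
              then show False using R by blast
            qed
            then have "c R = 0" using supp[of R] by auto
            then show "t R = 0" unfolding t_def by simp
          qed
        qed (use finPQ in auto)
        also have "\<dots> = (\<Sum>j\<in>X - {i}. t (X - {i, j}))"
          by (subst sum.reindex) (auto simp: inj_on_def)
        also have "\<dots> = (\<Sum>j\<in>X - {i}. C * (c (X - {i, j}) * u j))"
        proof (rule sum.cong[OF refl])
          fix j assume j: "j \<in> X - {i}"
          let ?R = "X - {i, j}"
          have sets: "I - ?R = insert j P" "J - ?R = insert j Q"
            using j PQ i unfolding I_def J_def X_def by auto
          have cR: "card ?R = k" using j i X finPQ(4) by (simp add: card_Diff_subset)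
          have cJ: "card (J - ?R) = Suc (card Q)" unfolding sets using j XP finPQ by (subst card_insert_disjoint) auto
          \<comment> \<open>The factor \<open>shuffle_sign {j} ?R\<close> is the same for
            \<open>P\<close> and \<open>Q\<close> and cancels as a square; what is left splits into
            signs for \<open>X\<close>, \<open>i\<close> and \<open>j\<close> separately.\<close>
          have sgn: "shuffle_sign (insert j T) ?R = shuffle_sign {j} ?R * (shuffle_sign T X * shuffle_sign T {i} * shuffle_sign T {j})"
            if T: "finite T" "X \<inter> T = {}" for T
          proof -
            have "shuffle_sign ({j} \<union> T) ?R = shuffle_sign {j} ?R * shuffle_sign T ?R"
              by (rule shuffle_sign_Un_left) (use T j finPQ in auto)
            moreover have "shuffle_sign T ({i} \<union> ({j} \<union> ?R)) = shuffle_sign T {i} * (shuffle_sign T {j} * shuffle_sign T ?R)"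
              by (subst shuffle_sign_Un_right, (use T j finPQ in auto)[4], subst shuffle_sign_Un_right) (use T j finPQ in auto)
            moreover have "{i} \<union> ({j} \<union> ?R) = X" "{j} \<union> T = insert j T" using i j by auto
            ultimately have e: "shuffle_sign (insert j T) ?R = shuffle_sign {j} ?R * shuffle_sign T ?R"
              "shuffle_sign T X = shuffle_sign T {i} * (shuffle_sign T {j} * shuffle_sign T ?R)" by (simp_all only:)
            have "shuffle_sign T {i} * (shuffle_sign T {j} * s) * shuffle_sign T {i} * shuffle_sign T {j}
              = (shuffle_sign T {i} * shuffle_sign T {i}) * (shuffle_sign T {j} * shuffle_sign T {j}) * s" for s
              by (simp only: mult_ac)
            then show ?thesis unfolding e by (simp only: shuffle_sign_square mult_1)
          qed
          have "t ?R = (-1) ^ (Suc (card Q) * k) * (shuffle_sign {j} ?R * shuffle_sign {j} ?R)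
            * (shuffle_sign P X * shuffle_sign P {i} * shuffle_sign P {j})
            * (shuffle_sign Q X * shuffle_sign Q {i} * shuffle_sign Q {j})
            * \<alpha> (insert j P) (insert j Q) * (vol_coeff k * c ?R)"
            unfolding t_def cJ cR unfolding sets sgn[OF finPQ(1) XP(1)] sgn[OF finPQ(2) XP(2)] by (simp only: mult_ac)
          then show "t ?R = C * (c ?R * u j)"
            unfolding C_def u_def shuffle_sign_square by (simp only: mult_ac mult_1)
        qed
        finally have "C * (\<Sum>j\<in>X - {i}. c (X - {i, j}) * u j) = 0" by (simp only: sum_distrib_left)
        moreover have "C \<noteq> 0" unfolding C_def by simp
        ultimately show "(\<Sum>j\<in>X - {i}. c (X - {i, j}) * u j) = 0" by simp
      qed
      then have "u i0 = 0" using i0 by blast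
      then show False using nzero unfolding u_def I0J0 by simp
    qed
  qed
qed

section \<open>Expansion of the determinant\<close>

definition singleton_fun :: "(nat \<Rightarrow> complex) \<Rightarrow> nat set \<Rightarrow> complex" where
  "singleton_fun x = (\<lambda>S. if card S = 1 then x (the_elem S) else 0)"

lemma singleton_fun_simps [simp]: "singleton_fun x {j} = x j" "singleton_fun x {} = 0"
  unfolding singleton_fun_def by simp_all

lemma singleton_fun_nonzeroD: "singleton_fun x S \<noteq> 0 \<Longrightarrow> \<exists>j. S = {j} \<and> x j \<noteq> 0"
  unfolding singleton_fun_def
  by (cases "card S = 1") (auto elim!: card_1_singletonE simp del: One_nat_def)

lemma unit_form_diag: "unit_form = diag_form unit_ext"
  unfolding unit_form_def diag_form_def unit_ext_def by (auto simp: fun_eq_iff)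

lemma bijs_empty: "bijs {} J = (if J = {} then {\<lambda>_. undefined} else {})"
  unfolding bijs_def by (auto simp: bij_betw_def)

lemma sum_bijs_insert:
  fixes F :: "('a \<Rightarrow> 'b) \<Rightarrow> complex"
  assumes "finite J" "finite S" "a \<notin> S"
  shows "(\<Sum>\<tau>\<in>bijs (insert a S) J. F \<tau>) = (\<Sum>j\<in>J. \<Sum>\<tau>\<in>bijs S (J - {j}). F (\<tau>(a := j)))"
proof -
  have "(\<Sum>j\<in>J. \<Sum>\<tau>\<in>bijs S (J - {j}). F (\<tau>(a := j))) = (\<Sum>(j, \<tau>)\<in>(SIGMA j:J. bijs S (J - {j})). F (\<tau>(a := j)))"
    by (rule sum.Sigma) (use assms in auto)
  also have "\<dots> = (\<Sum>\<tau>\<in>bijs (insert a S) J. F \<tau>)"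
  proof (rule sum.reindex_bij_witness[where j = "\<lambda>(j, \<tau>). \<tau>(a := j)" and i = "\<lambda>\<tau>. (\<tau> a, \<tau>(a := undefined))"])
    fix x assume "x \<in> (SIGMA j:J. bijs S (J - {j}))"
    then obtain j \<tau> where x: "x = (j, \<tau>)" "j \<in> J" "\<tau> \<in> bijs S (J - {j})" by auto
    have und: "\<tau> a = undefined" using x(3) assms(3) unfolding bijs_def by (auto simp: PiE_def extensional_def)
    then show "((\<lambda>(j, \<tau>). \<tau>(a := j)) x a, ((\<lambda>(j, \<tau>). \<tau>(a := j)) x)(a := undefined)) = x"
      unfolding x by auto
    have "bij_betw (\<tau>(a := j)) S (J - {j})"
      using bijsD(1)[OF x(3)] assms(3) by (subst bij_betw_cong[of _ _ \<tau>]) auto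
    then have "bij_betw (\<tau>(a := j)) (S \<union> {a}) (J - {j} \<union> {j})"
      by (rule bij_betw_combine) (auto simp: bij_betw_def)
    moreover have "J - {j} \<union> {j} = J" using x(2) by auto
    ultimately have "bij_betw (\<tau>(a := j)) (insert a S) J" by simp
    moreover have "\<tau>(a := j) \<in> insert a S \<rightarrow>\<^sub>E J"
      using x(2,3) unfolding bijs_def by (auto simp: PiE_def extensional_def)
    ultimately show "(\<lambda>(j, \<tau>). \<tau>(a := j)) x \<in> bijs (insert a S) J" unfolding x bijs_def by simp
    show "F ((\<lambda>(j, \<tau>). \<tau>(a := j)) x) = (\<lambda>(j, \<tau>). F (\<tau>(a := j))) x" unfolding x by simp
  next
    fix \<tau> assume t: "\<tau> \<in> bijs (insert a S) J"
    show "(\<lambda>(j, \<tau>). \<tau>(a := j)) (\<tau> a, \<tau>(a := undefined)) = \<tau>" by auto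
    have b: "bij_betw \<tau> (insert a S) J" by (rule bijsD(1)[OF t])
    have "\<tau> ` S = J - {\<tau> a}" using b assms(3) unfolding bij_betw_def inj_on_def by auto
    moreover have "inj_on \<tau> S" using b unfolding bij_betw_def by (auto intro: inj_on_subset)
    ultimately have "bij_betw \<tau> S (J - {\<tau> a})" unfolding bij_betw_def by simp
    then have "bij_betw (\<tau>(a := undefined)) S (J - {\<tau> a})"
      using assms(3) by (subst bij_betw_cong[of _ _ \<tau>]) auto
    moreover have "\<tau>(a := undefined) \<in> S \<rightarrow>\<^sub>E (J - {\<tau> a})"
      using t \<open>\<tau> ` S = J - {\<tau> a}\<close> assms(3) unfolding bijs_def by (auto simp: PiE_def extensional_def)
    moreover have "\<tau> a \<in> J" using bijsD(2)[OF t] by simp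
    ultimately show "(\<tau> a, \<tau>(a := undefined)) \<in> (SIGMA j:J. bijs S (J - {j}))" unfolding bijs_def by simp
  qed
  finally show ?thesis by simp
qed

text \<open>One factor \<open>\<Sum>j. x a j V_j\<close> for each \<open>a\<close> in
  \<open>xs\<close> is multiplied out. A contribution to \<open>V_J\<close> picks an index for every
  \<open>a\<close>, without repetition since each \<open>V_j\<close> squares to zero, and exhausts
  \<open>J\<close>.\<close>

lemma subset_conv_bijs:
  assumes "distinct xs" "finite J"
  shows "foldr (\<lambda>a. subset_conv (singleton_fun (x a))) xs unit_ext J = (\<Sum>\<tau>\<in>bijs (set xs) J. \<Prod>a\<in>set xs. x a (\<tau> a))"
  using assms
proof (induction xs arbitrary: J)
  case Nil
  then show ?case by (simp add: bijs_empty unit_ext_def)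
next
  case (Cons a xs)
  let ?r = "foldr (\<lambda>a. subset_conv (singleton_fun (x a))) xs unit_ext"
  have "foldr (\<lambda>a. subset_conv (singleton_fun (x a))) (a # xs) unit_ext J = (\<Sum>K\<in>Pow J. singleton_fun (x a) K * ?r (J - K))"
    by (simp add: subset_conv_def)
  also have "\<dots> = (\<Sum>j\<in>J. singleton_fun (x a) {j} * ?r (J - {j}))"
  proof (rule sum_Pow_singletons)
    fix K :: "nat set" assume "\<not> (\<exists>j. K = {j})"
    then have "singleton_fun (x a) K = 0" using singleton_fun_nonzeroD[of "x a" K] by blast
    then show "singleton_fun (x a) K * ?r (J - K) = 0" by simp
  qed (use Cons.prems in simp)
  also have "\<dots> = (\<Sum>j\<in>J. \<Sum>\<tau>\<in>bijs (set xs) (J - {j}). \<Prod>b\<in>set (a # xs). x b ((\<tau>(a := j)) b))"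
  proof (rule sum.cong[OF refl])
    fix j assume "j \<in> J"
    have a: "a \<notin> set xs" using Cons.prems by simp
    have "?r (J - {j}) = (\<Sum>\<tau>\<in>bijs (set xs) (J - {j}). \<Prod>b\<in>set xs. x b (\<tau> b))"
      using Cons by simp
    moreover have "(\<Prod>b\<in>set (a # xs). x b ((\<tau>(a := j)) b)) = x a j * (\<Prod>b\<in>set xs. x b (\<tau> b))" for \<tau>
    proof -
      have "(\<Prod>b\<in>set xs. x b ((\<tau>(a := j)) b)) = (\<Prod>b\<in>set xs. x b (\<tau> b))"
        using a by (intro prod.cong) auto
      then show ?thesis using a by simp
    qed
    ultimately show "singleton_fun (x a) {j} * ?r (J - {j})
      = (\<Sum>\<tau>\<in>bijs (set xs) (J - {j}). \<Prod>b\<in>set (a # xs). x b ((\<tau>(a := j)) b))"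
      by (simp add: sum_distrib_left)
  qed
  also have "\<dots> = (\<Sum>\<tau>\<in>bijs (set (a # xs)) J. \<Prod>b\<in>set (a # xs). x b (\<tau> b))"
    using Cons.prems by (simp only: list.set sum_bijs_insert finite_set distinct.simps not_False_eq_True)
  finally show ?case .
qed

lemma wedge_list_diag:
  "wedge_list (map (\<lambda>a. transform n A (diag_form (f a))) xs)
    = transform n A (diag_form (foldr (\<lambda>a. subset_conv (f a)) xs unit_ext))"
proof (induction xs)
  case Nil
  then show ?case using transform_unit[of n A] by (simp add: wedge_list_def unit_form_diag)
next
  case (Cons a xs)
  then show ?case by (simp add: wedge_list_def transform_wedge wedge_diag_form)
qed

lemma diag_form_cong: "(\<And>I. finite I \<Longrightarrow> f I = g I) \<Longrightarrow> diag_form f = diag_form g"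
  unfolding diag_form_def by (auto simp: fun_eq_iff)

lemma diag_form_sum: "diag_form (\<lambda>I. \<Sum>x\<in>X. c x * f x I) = (\<lambda>I J. \<Sum>x\<in>X. c x * diag_form (f x) I J)"
proof (intro ext)
  fix I J
  show "diag_form (\<lambda>I. \<Sum>x\<in>X. c x * f x I) I J = (\<Sum>x\<in>X. c x * diag_form (f x) I J)"
  proof (cases "I = J \<and> finite I")
    case True
    then show ?thesis unfolding diag_form_def by (simp add: sum_distrib_left mult_ac)
  next
    case False
    then have "diag_form g I J = 0" for g unfolding diag_form_def by auto
    then show ?thesis by simp
  qed
qed

text \<open>Substitution commutes with wedge products, so the determinant can be evaluated in the
  coordinates where all entries are diagonal. For each \<open>\<sigma>\<close> the product of the
  rows is a sum over bijections, and interchanging the two sums gives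
  \<open>mixed_coeff\<close>.\<close>

lemma form_det_transform:
  assumes "\<And>a b. a < k \<Longrightarrow> b < k \<Longrightarrow> M $$ (a, b) = transform n A (diag_form (singleton_fun (\<lambda>j. B j a b)))"
  shows "form_det k M = transform n A (diag_form (mixed_coeff k B))"
proof -
  define c where "c = (\<lambda>\<sigma> J. \<Sum>\<tau>\<in>bijs {..<k} J. \<Prod>a<k. B (\<tau> a) a (\<sigma> a))"
  have "wedge_list (map (\<lambda>a. M $$ (a, \<sigma> a)) [0..<k]) = transform n A (diag_form (c \<sigma>))"
    if "\<sigma> permutes {..<k}" for \<sigma>
  proof -
    have "map (\<lambda>a. M $$ (a, \<sigma> a)) [0..<k] = map (\<lambda>a. transform n A (diag_form (singleton_fun (\<lambda>j. B j a (\<sigma> a))))) [0..<k]"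
      using assms permutes_lessThan[OF that] by auto
    also have "wedge_list \<dots> = transform n A (diag_form (foldr (\<lambda>a. subset_conv (singleton_fun (\<lambda>j. B j a (\<sigma> a)))) [0..<k] unit_ext))"
      by (rule wedge_list_diag)
    also have "diag_form (foldr (\<lambda>a. subset_conv (singleton_fun (\<lambda>j. B j a (\<sigma> a)))) [0..<k] unit_ext) = diag_form (c \<sigma>)"
      by (rule diag_form_cong) (simp add: subset_conv_bijs c_def atLeast0LessThan)
    finally show ?thesis .
  qed
  then have "form_det k M = (\<lambda>I J. \<Sum>\<sigma> | \<sigma> permutes {..<k}. of_int (sign \<sigma>) * transform n A (diag_form (c \<sigma>)) I J)"
    unfolding form_det_def by (intro ext sum.cong) auto
  also have "\<dots> = transform n A (diag_form (\<lambda>J. \<Sum>\<sigma> | \<sigma> permutes {..<k}. of_int (sign \<sigma>) * c \<sigma> J))"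
    unfolding diag_form_sum transform_sum transform_scale ..
  also have "(\<lambda>J. \<Sum>\<sigma> | \<sigma> permutes {..<k}. of_int (sign \<sigma>) * c \<sigma> J) = mixed_coeff k B"
    unfolding mixed_coeff_def c_def sum_distrib_left by (intro ext sum.swap)
  finally show ?thesis .
qed

section \<open>Conjugation and decomposable forms\<close>

lemma conj_wedge: "conj_form (wedge \<alpha> \<beta>) = wedge (conj_form \<alpha>) (conj_form \<beta>)"
proof (intro ext)
  fix I J :: "nat set"
  show "conj_form (wedge \<alpha> \<beta>) I J = wedge (conj_form \<alpha>) (conj_form \<beta>) I J"
  proof (cases "finite I \<and> finite J")
    case True
    have "conj_form (wedge \<alpha> \<beta>) I J = (\<Sum>K\<in>Pow J. \<Sum>L\<in>Pow I. (-1) ^ (card I * card J) *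
      ((-1) ^ (card L * card (J - K)) * shuffle_sign K (J - K) * shuffle_sign L (I - L)
       * cnj (\<alpha> K L) * cnj (\<beta> (J - K) (I - L))))"
      unfolding conj_form_def wedge_def by (simp add: sum_distrib_left)
    also have "\<dots> = (\<Sum>L\<in>Pow I. \<Sum>K\<in>Pow J. (-1) ^ (card I * card J) *
      ((-1) ^ (card L * card (J - K)) * shuffle_sign K (J - K) * shuffle_sign L (I - L)
       * cnj (\<alpha> K L) * cnj (\<beta> (J - K) (I - L))))" by (rule sum.swap)
    also have "\<dots> = wedge (conj_form \<alpha>) (conj_form \<beta>) I J"
      unfolding wedge_def
    proof (intro sum.cong refl)
      fix L K assume LK: "L \<in> Pow I" "K \<in> Pow J"
      define l l' m m' where "l = card L" and "l' = card (I - L)" and "m = card K" and "m' = card (J - K)"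
      have cI: "card I = l + l'" and cJ: "card J = m + m'"
        using LK True finite_subset[of L I] finite_subset[of K J]
          card_Diff_subset[of L I] card_Diff_subset[of K J] card_mono[of I L] card_mono[of J K]
        unfolding l_def l'_def m_def m'_def by auto
      \<comment> \<open>Multiplying out \<open>(l + l') * (m + m')\<close> produces a second
        \<open>l * m'\<close>, which cancels the given one; the other three terms are the signs on
        the conjugated side.\<close>
      have "(-1 :: complex) ^ (card I * card J) * (-1) ^ (l * m') = (-1) ^ (l * m + l' * m + l' * m' + (l * m' + l * m'))"
        unfolding cI cJ power_add[symmetric] by (simp add: algebra_simps)
      also have "\<dots> = (-1) ^ (m * l') * (-1) ^ (l * m) * (-1) ^ (l' * m')"
        by (simp only: power_add minus_one_mult_self mult_ac mult_1)
      finally have sgn: "(-1 :: complex) ^ (card I * card J) * (-1) ^ (l * m') = (-1) ^ (m * l') * (-1) ^ (l * m) * (-1) ^ (l' * m')" .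
      have "(-1) ^ (card I * card J) * ((-1) ^ (card L * card (J - K)) * shuffle_sign K (J - K) * shuffle_sign L (I - L)
         * cnj (\<alpha> K L) * cnj (\<beta> (J - K) (I - L)))
       = ((-1) ^ (card I * card J) * (-1) ^ (l * m')) * shuffle_sign K (J - K) * shuffle_sign L (I - L)
         * cnj (\<alpha> K L) * cnj (\<beta> (J - K) (I - L))" unfolding l_def m'_def by (simp only: mult_ac)
      also have "\<dots> = (-1) ^ (card K * card (I - L)) * shuffle_sign L (I - L) * shuffle_sign K (J - K)
         * conj_form \<alpha> L K * conj_form \<beta> (I - L) (J - K)"
        unfolding sgn conj_form_def unfolding l_def l'_def m_def m'_def by (simp only: mult_ac)
      finally show "(-1) ^ (card I * card J) * ((-1) ^ (card L * card (J - K)) * shuffle_sign K (J - K) * shuffle_sign L (I - L)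
         * cnj (\<alpha> K L) * cnj (\<beta> (J - K) (I - L)))
       = (-1) ^ (card K * card (I - L)) * shuffle_sign L (I - L) * shuffle_sign K (J - K)
         * conj_form \<alpha> L K * conj_form \<beta> (I - L) (J - K)" .
    qed
    finally show ?thesis .
  next
    case False
    then have "wedge \<alpha> \<beta> J I = 0" by (intro wedge_infinite) auto
    moreover have "wedge (conj_form \<alpha>) (conj_form \<beta>) I J = 0" using False by (intro wedge_infinite) auto
    ultimately show ?thesis unfolding conj_form_def by simp
  qed
qed

lemma conj_forms: "\<alpha> \<in> forms n p q \<Longrightarrow> conj_form \<alpha> \<in> forms n q p"
  unfolding forms_def conj_form_def by auto

lemma conj_form_zeroD: "conj_form \<alpha> = (\<lambda>I J. 0) \<Longrightarrow> \<alpha> = (\<lambda>I J. 0)"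
  unfolding conj_form_def fun_eq_iff by auto

lemma wedge_unit_right:
  assumes "\<alpha> \<in> forms n p q"
  shows "wedge \<alpha> unit_form = \<alpha>"
proof (intro ext)
  fix I J
  show "wedge \<alpha> unit_form I J = \<alpha> I J"
  proof (cases "finite I \<and> finite J")
    case True
    have "wedge \<alpha> unit_form I J = (\<Sum>R\<in>Pow (I \<inter> J). if R = {} then \<alpha> I J else 0)"
      unfolding unit_form_diag wedge_diag_right[OF conjunct1[OF True] conjunct2[OF True]]
      by (intro sum.cong refl) (auto simp: unit_ext_def)
    then show ?thesis using True by simp
  next
    case False
    then have "\<alpha> I J = 0" using formsD[OF assms, of I J] finite_subset[OF _ finite_lessThan] by blast
    moreover have "wedge \<alpha> unit_form I J = 0" using False by (intro wedge_infinite) auto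
    ultimately show ?thesis by simp
  qed
qed

text \<open>The conjugate on \<open>b\<close> lets both arguments live in the same exterior algebra
  and makes the diagonal coefficients of \<open>tensor x x\<close> squared moduli.\<close>

definition tensor :: "(nat set \<Rightarrow> complex) \<Rightarrow> (nat set \<Rightarrow> complex) \<Rightarrow> form" where
  "tensor a b = (\<lambda>I J. a I * cnj (b J))"

lemma wedge_tensor:
  assumes "\<And>L. b L \<noteq> 0 \<Longrightarrow> card L = q" "\<And>K. a' K \<noteq> 0 \<Longrightarrow> card K = p"
  shows "wedge (tensor a b) (tensor a' b') = (\<lambda>I J. (-1) ^ (q * p) * tensor (ext_prod a a') (ext_prod b b') I J)"
proof (intro ext)
  fix I J
  have "wedge (tensor a b) (tensor a' b') I J = (\<Sum>K\<in>Pow I. \<Sum>L\<in>Pow J. (-1) ^ (q * p) *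
     ((shuffle_sign K (I - K) * a K * a' (I - K)) * cnj (shuffle_sign L (J - L) * b L * b' (J - L))))"
    unfolding wedge_def tensor_def
  proof (intro sum.cong refl)
    fix K L
    show "(-1) ^ (card L * card (I - K)) * shuffle_sign K (I - K) * shuffle_sign L (J - L) * (a K * cnj (b L)) * (a' (I - K) * cnj (b' (J - L)))
      = (-1) ^ (q * p) * ((shuffle_sign K (I - K) * a K * a' (I - K)) * cnj (shuffle_sign L (J - L) * b L * b' (J - L)))"
    proof (cases "b L = 0 \<or> a' (I - K) = 0")
      case False
      then have "card L = q" "card (I - K) = p" using assms by auto
      then show ?thesis by simp
    qed auto
  qed
  also have "\<dots> = (-1) ^ (q * p) * tensor (ext_prod a a') (ext_prod b b') I J"
    unfolding tensor_def ext_prod_def cnj_sum sum_product by (simp only: sum_distrib_left)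
  finally show "wedge (tensor a b) (tensor a' b') I J = (-1) ^ (q * p) * tensor (ext_prod a a') (ext_prod b b') I J" .
qed

lemma transform_diag_tensor:
  "transform n A (diag_form c) = (\<lambda>I J. \<Sum>K\<in>Pow {..<n}. (vol_coeff (card K) * c K) * tensor (monom_form n A K) (monom_form n A K) I J)"
proof (intro ext)
  fix I J
  have "transform n A (diag_form c) I J = (\<Sum>K\<in>Pow {..<n}. \<Sum>L\<in>Pow {..<n}. if L = K then
    (vol_coeff (card K) * c K) * tensor (monom_form n A K) (monom_form n A K) I J else 0)"
    unfolding transform_def
  proof (intro sum.cong refl)
    fix K L assume "K \<in> Pow {..<n}"
    then have "finite K" by (rule finite_Pow_lessThan)
    then show "diag_form c K L * monom_form n A K I * cnj (monom_form n A L J)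
      = (if L = K then (vol_coeff (card K) * c K) * tensor (monom_form n A K) (monom_form n A K) I J else 0)"
      by (auto simp: diag_form_def tensor_def)
  qed
  then show "transform n A (diag_form c) I J
    = (\<Sum>K\<in>Pow {..<n}. (vol_coeff (card K) * c K) * tensor (monom_form n A K) (monom_form n A K) I J)" by simp
qed

lemma ext_transform_transform:
  assumes "A \<in> carrier_mat n n" "B \<in> carrier_mat n n" "A * B = 1\<^sub>m n" "\<And>I. a I \<noteq> 0 \<Longrightarrow> I \<subseteq> {..<n}"
  shows "ext_transform n B (ext_transform n A a) = a"
proof
  fix I
  have "ext_transform n B (ext_transform n A a) I
    = (\<Sum>S\<in>Pow {..<n}. \<Sum>K\<in>Pow {..<n}. a K * (monom_form n A K S * monom_form n B S I))"
    unfolding ext_transform_def by (simp add: sum_distrib_right mult.assoc)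
  also have "\<dots> = (\<Sum>K\<in>Pow {..<n}. a K * (\<Sum>S\<in>Pow {..<n}. monom_form n A K S * monom_form n B S I))"
    by (subst sum.swap) (simp add: sum_distrib_left)
  also have "\<dots> = (\<Sum>K\<in>Pow {..<n}. if K = I then a I else 0)"
  proof (rule sum.cong[OF refl])
    fix K assume "K \<in> Pow {..<n}"
    then have "(\<Sum>S\<in>Pow {..<n}. monom_form n A K S * monom_form n B S I) = (if I = K then 1 else 0)"
      using fun_cong[OF ext_transform_monom_form[OF assms(1,2), of K], of I] monom_form_one[of K n]
      unfolding ext_transform_def assms(3) by simp
    then show "a K * (\<Sum>S\<in>Pow {..<n}. monom_form n A K S * monom_form n B S I) = (if K = I then a I else 0)" by auto
  qed
  also have "\<dots> = a I" using assms(4) by auto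
  finally show "ext_transform n B (ext_transform n A a) I = a I" .
qed

text \<open>In the coordinates \<open>w\<close> the monomials are basis elements. Multiplication by
  one whose index set \<open>K\<close> is disjoint from \<open>I\<close> isolates the coefficient at
  \<open>I\<close>, and \<open>q + k \<le> n\<close> leaves room for such a
  \<open>K\<close>.\<close>

lemma annihilates_monoms_imp_zero:
  assumes A: "A \<in> carrier_mat n n" "B \<in> carrier_mat n n" "A * B = 1\<^sub>m n" "B * A = 1\<^sub>m n"
    and x: "\<And>I. x I \<noteq> 0 \<Longrightarrow> I \<subseteq> {..<n} \<and> card I = q" and qk: "q + k \<le> n"
    and ann: "\<And>K. K \<subseteq> {..<n} \<Longrightarrow> card K = k \<Longrightarrow> ext_prod x (monom_form n A K) = (\<lambda>_. 0)"
  shows "x = (\<lambda>_. 0)"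
proof -
  define y where "y = ext_transform n B x"
  have y0: "y I = 0" for I
  proof (rule ccontr)
    assume "y I \<noteq> 0"
    then obtain S where S: "S \<in> Pow {..<n}" "x S * monom_form n B S I \<noteq> 0"
      unfolding y_def ext_transform_def by (rule sum.not_neutral_contains_not_neutral)
    then have I: "I \<subseteq> {..<n}" "card I = q" using monom_form_nonzeroD[OF finite_Pow_lessThan[OF S(1)], of n B I] x[of S] by auto
    then have fI: "finite I" by (auto intro: finite_subset)
    have "k \<le> card ({..<n} - I)" using card_lessThan_minus[OF I(1)] I(2) qk by simp
    then obtain K where K: "K \<subseteq> {..<n} - I" "card K = k" "finite K" by (rule obtain_subset_with_card_n)
    have Kn: "K \<subseteq> {..<n}" using K(1) by auto
    have "ext_prod y (ext_transform n B (monom_form n A K)) = ext_transform n B (\<lambda>_. 0)"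
      unfolding y_def ext_transform_prod ann[OF Kn K(2)] ..
    also have "\<dots> = (\<lambda>_. 0)" unfolding ext_transform_def by simp
    also have "ext_transform n B (monom_form n A K) = (\<lambda>I. if I = K then 1 else 0)"
      unfolding ext_transform_monom_form[OF A(1,2) Kn] A(3) by (rule monom_form_one[OF Kn])
    finally have "ext_prod y (\<lambda>I. if I = K then 1 else 0) (I \<union> K) = 0" by simp
    also have "ext_prod y (\<lambda>I. if I = K then 1 else 0) (I \<union> K)
      = (\<Sum>S\<in>Pow (I \<union> K). if S = I then shuffle_sign I K * y I else 0)"
      unfolding ext_prod_def
    proof (intro sum.cong refl)
      fix S assume "S \<in> Pow (I \<union> K)"
      then have "(I \<union> K) - S = K \<longleftrightarrow> S = I" using K(1) by auto
      then show "shuffle_sign S (I \<union> K - S) * y S * (if I \<union> K - S = K then 1 else 0)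
        = (if S = I then shuffle_sign I K * y I else 0)" by auto
    qed
    also have "\<dots> = shuffle_sign I K * y I" using fI K(3) by simp
    finally show False using \<open>y I \<noteq> 0\<close> by simp
  qed
  have "x = ext_transform n A y"
    unfolding y_def by (rule ext_transform_transform[symmetric, OF A(2,1,4)]) (use x in blast)
  also have "\<dots> = (\<lambda>_. 0)" unfolding ext_transform_def y0 by simp
  finally show ?thesis .
qed

text \<open>
  Up to a nonzero constant, the top coefficient of \<open>\<bar>\<alpha> \<and> \<alpha> \<and> \<Omega> \<and> \<omega>\<^sup>2\<close> is
  \<open>\<Sum>\<^sub>K \<Sum>\<^sub>S c\<^sub>K |(\<bar>\<alpha> \<and> dw\<^sub>K)\<^sub>S|\<^sup>2\<close> if \<open>\<omega>\<close> is standard and \<open>\<Omega> = \<Sum>\<^sub>K c\<^sub>K V\<^sub>K\<close> in the coordinates \<open>w\<close>.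
\<close>

lemma lefschetz_wedge_square_antiholomorphic:
  assumes A: "A \<in> carrier_mat n n" "B \<in> carrier_mat n n" "A * B = 1\<^sub>m n" "B * A = 1\<^sub>m n"
    and supp: "\<And>R. c R \<noteq> 0 \<Longrightarrow> R \<subseteq> {..<n} \<and> card R = k"
    and pos: "\<And>R. R \<subseteq> {..<n} \<Longrightarrow> card R = k \<Longrightarrow> c R = of_real (c' R) \<and> c' R > 0"
    and s: "\<And>R. s R = (if R \<subseteq> {..<n} \<and> card R = 2 then 2 else 0)"
    and qk: "q + k + 2 = n"
    and \<alpha>: "\<alpha> \<in> forms n 0 q" and zero: "wedge \<alpha> (wedge (transform n A (diag_form c)) (diag_form s)) = (\<lambda>I J. 0)"
  shows "\<alpha> = (\<lambda>I J. 0)"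
proof -
  let ?m = "monom_form n A" and ?N = "{..<n}"
  \<comment> \<open>The conjugated coefficients, so that \<open>\<alpha>\<close> is
    \<open>tensor unit_ext x\<close> and its conjugate is \<open>tensor x unit_ext\<close>.\<close>
  define x where "x = (\<lambda>J. cnj (\<alpha> {} J))"
  have x: "I \<subseteq> {..<n} \<and> card I = q" if "x I \<noteq> 0" for I
    using formsD[OF \<alpha>, of "{}" I] that unfolding x_def by auto
  have fin_x: "infinite I \<Longrightarrow> x I = 0" for I using x finite_subset[OF _ finite_lessThan] by blast
  have \<alpha>x: "\<alpha> = tensor unit_ext x"
  proof (intro ext)
    fix I J
    have "\<alpha> I J = 0" if "I \<noteq> {}"
    proof (rule ccontr)
      assume "\<alpha> I J \<noteq> 0"
      then have "I \<subseteq> {..<n}" "card I = 0" using formsD[OF \<alpha>] by auto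
      then show False using that finite_subset[of I "{..<n}"] by auto
    qed
    then show "\<alpha> I J = tensor unit_ext x I J" unfolding tensor_def unit_ext_def x_def by auto
  qed
  define \<Theta> where "\<Theta> = wedge (transform n A (diag_form c)) (diag_form s)"
  have ux: "unit_ext L \<noteq> 0 \<Longrightarrow> card L = 0" for L unfolding unit_ext_def by (auto split: if_splits)
  have b\<alpha>: "wedge (tensor x unit_ext) \<alpha> = tensor x x"
    unfolding \<alpha>x using wedge_tensor[of unit_ext 0 unit_ext 0 x x] ux fin_x by simp
  have "wedge (tensor x x) \<Theta> = wedge (tensor x unit_ext) (wedge \<alpha> \<Theta>)"
    unfolding b\<alpha>[symmetric] wedge_assoc ..
  also have "\<dots> = (\<lambda>I J. 0)" unfolding \<Theta>_def zero by (simp add: wedge_def)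
  finally have z: "wedge (wedge (tensor x x) (transform n A (diag_form c))) (diag_form s) = (\<lambda>I J. 0)"
    unfolding \<Theta>_def wedge_assoc .
  define \<Phi> where "\<Phi> = wedge (tensor x x) (transform n A (diag_form c))"
  \<comment> \<open>The factor in front depends on neither \<open>S\<close> nor \<open>K\<close>, so
    the squared moduli cannot cancel when the coefficients are summed.\<close>
  have \<Phi>: "\<Phi> S S = ((-1) ^ (q * k) * vol_coeff k) * of_real (\<Sum>K\<in>Pow ?N. Re (c K) * (cmod (ext_prod x (?m K) S))\<^sup>2)" for S
  proof -
    have "\<Phi> S S = (\<Sum>K\<in>Pow ?N. (vol_coeff (card K) * c K) * wedge (tensor x x) (tensor (?m K) (?m K)) S S)"
      unfolding \<Phi>_def transform_diag_tensor wedge_sum_right wedge_scale_right ..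
    also have "\<dots> = (\<Sum>K\<in>Pow ?N. ((-1) ^ (q * k) * vol_coeff k) * of_real (Re (c K) * (cmod (ext_prod x (?m K) S))\<^sup>2))"
    proof (rule sum.cong[OF refl])
      fix K assume K: "K \<in> Pow ?N"
      show "(vol_coeff (card K) * c K) * wedge (tensor x x) (tensor (?m K) (?m K)) S S
        = ((-1) ^ (q * k) * vol_coeff k) * of_real (Re (c K) * (cmod (ext_prod x (?m K) S))\<^sup>2)"
      proof (cases "c K = 0")
        case False
        then have cK: "card K = k" using supp by blast
        then have c: "c K = of_real (Re (c K))" using pos[of K] K by auto
        have "wedge (tensor x x) (tensor (?m K) (?m K)) S S = (-1) ^ (q * k) * tensor (ext_prod x (?m K)) (ext_prod x (?m K)) S S"
          by (subst wedge_tensor[of x q "?m K" k])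
            (use x monom_form_nonzeroD[OF finite_Pow_lessThan[OF K]] cK in auto)
        also have "tensor (ext_prod x (?m K)) (ext_prod x (?m K)) S S = of_real ((cmod (ext_prod x (?m K) S))\<^sup>2)"
          unfolding tensor_def complex_norm_square ..
        finally show ?thesis unfolding cK of_real_mult by (subst c) (simp only: mult_ac)
      qed simp
    qed
    finally show ?thesis by (simp only: sum_distrib_left of_real_sum)
  qed
  have Re_c: "Re (c K) \<ge> 0" for K using supp[of K] pos[of K] by (cases "c K = 0") auto
  define T where "T = (\<Sum>R\<in>Pow ?N. if card R = 2 then (\<Sum>K\<in>Pow ?N. Re (c K) * (cmod (ext_prod x (?m K) (?N - R)))\<^sup>2) else 0)"
  have "0 = wedge \<Phi> (diag_form s) ?N ?N" unfolding \<Phi>_def z ..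
  also have "\<dots> = (\<Sum>R\<in>Pow ?N. (-1) ^ (card (?N - R) * card R) * shuffle_sign (?N - R) R * shuffle_sign (?N - R) R
      * \<Phi> (?N - R) (?N - R) * (vol_coeff (card R) * s R))"
    by (subst wedge_diag_right) simp_all
  also have "\<dots> = (\<Sum>R\<in>Pow ?N. if card R = 2 then 2 * vol_coeff 2 * \<Phi> (?N - R) (?N - R) else 0)"
  proof (intro sum.cong refl)
    fix R assume "R \<in> Pow ?N"
    moreover have "(-1 :: complex) ^ (m * 2) = 1" for m by (simp add: power_mult mult.commute[of m])
    ultimately show "(-1) ^ (card (?N - R) * card R) * shuffle_sign (?N - R) R * shuffle_sign (?N - R) R
      * \<Phi> (?N - R) (?N - R) * (vol_coeff (card R) * s R) = (if card R = 2 then 2 * vol_coeff 2 * \<Phi> (?N - R) (?N - R) else 0)"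
      unfolding s by (simp only: mult.assoc[of _ "shuffle_sign _ _" "shuffle_sign _ _"] shuffle_sign_square) auto
  qed
  also have "\<dots> = (2 * vol_coeff 2 * ((-1) ^ (q * k) * vol_coeff k)) *
    of_real T"
    unfolding T_def of_real_sum sum_distrib_left by (intro sum.cong refl) (simp add: \<Phi> sum_distrib_left mult.assoc)
  finally have "complex_of_real T = 0" by simp
  then have sum0: "(\<Sum>R\<in>Pow ?N. if card R = 2 then (\<Sum>K\<in>Pow ?N. Re (c K) * (cmod (ext_prod x (?m K) (?N - R)))\<^sup>2) else 0) = 0"
    unfolding T_def by (simp only: of_real_eq_0_iff)
  have ann: "ext_prod x (?m K) = (\<lambda>_. 0)" if K: "K \<subseteq> ?N" "card K = k" for K
  proof
    fix S
    show "ext_prod x (?m K) S = 0"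
    proof (rule ccontr)
      assume nz: "ext_prod x (?m K) S \<noteq> 0"
      then obtain T where T: "T \<in> Pow S" "shuffle_sign T (S - T) * x T * ?m K (S - T) \<noteq> 0"
        unfolding ext_prod_def by (rule sum.not_neutral_contains_not_neutral)
      have fK: "finite K" using K(1) by (rule finite_subset) simp
      have T1: "T \<subseteq> ?N" "card T = q" using x[of T] T by auto
      have T2: "S - T \<subseteq> ?N" "card (S - T) = k" using monom_form_nonzeroD[OF fK, of n A "S - T"] T K by auto
      have "S = T \<union> (S - T)" using T by auto
      then have S: "S \<subseteq> ?N" "card S = q + k"
        using T1 T2 card_Un_disjoint[of T "S - T"] finite_subset[OF T1(1)] finite_subset[OF T2(1)] by auto
      have "card (?N - S) = 2" using card_lessThan_minus[OF S(1)] S(2) qk by simp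
      moreover have "?N - (?N - S) = S" using S(1) by auto
      moreover have "(if card (?N - S) = 2 then (\<Sum>K\<in>Pow ?N. Re (c K) * (cmod (ext_prod x (?m K) (?N - (?N - S))))\<^sup>2) else 0) = 0"
        by (rule sum_nonneg_0[OF _ _ sum0]) (simp_all add: sum_nonneg Re_c)
      ultimately have "(\<Sum>K\<in>Pow ?N. Re (c K) * (cmod (ext_prod x (?m K) S))\<^sup>2) = 0" by simp
      from sum_nonneg_0[OF _ _ this, of K] have "Re (c K) * (cmod (ext_prod x (?m K) S))\<^sup>2 = 0"
        using K(1) Re_c by simp
      then show False using nz K pos[OF K] by auto
    qed
  qed
  have "x = (\<lambda>_. 0)" by (rule annihilates_monoms_imp_zero[OF A x _ ann]) (use qk in auto)
  then show ?thesis unfolding \<alpha>x tensor_def by simp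
qed

section \<open>The determinant of a positive matrix of forms\<close>

lemma transform_singleton_entry:
  "transform n A (diag_form (singleton_fun x)) I J
    = (\<Sum>r<n. (\<i> / 2) * x r * covector n A r I * cnj (covector n A r J))"
proof -
  have "transform n A (diag_form (singleton_fun x)) I J
    = (\<Sum>r<n. (vol_coeff (card {r}) * singleton_fun x {r}) * tensor (monom_form n A {r}) (monom_form n A {r}) I J)"
    unfolding transform_diag_tensor
  proof (rule sum_Pow_singletons)
    fix K :: "nat set" assume "\<not> (\<exists>i. K = {i})"
    then have "singleton_fun x K = 0" using singleton_fun_nonzeroD[of x K] by blast
    then show "(vol_coeff (card K) * singleton_fun x K) * tensor (monom_form n A K) (monom_form n A K) I J = 0" by simp
  qed simp
  then show ?thesis by (simp add: monom_form_singleton tensor_def mult_ac)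
qed

lemma coord_volume_eq: "coord_volume n A j = (\<lambda>I J. (\<i> / 2) * covector n A j I * cnj (covector n A j J))"
proof -
  have cf: "coord_form n A j = tensor (covector n A j) unit_ext"
    unfolding coord_form_def tensor_def covector_def unit_ext_def by (intro ext) auto
  have cc: "conj_form (coord_form n A j) = tensor unit_ext (covector n A j)"
    unfolding cf conj_form_def tensor_def unit_ext_def by (intro ext) auto
  have ux: "unit_ext L \<noteq> 0 \<Longrightarrow> card L = 0" for L unfolding unit_ext_def by (auto split: if_splits)
  have fin: "infinite I \<Longrightarrow> covector n A j I = 0" for I using covector_nonzeroD[of n A j I] by auto
  have "wedge (coord_form n A j) (conj_form (coord_form n A j)) = tensor (covector n A j) (covector n A j)"
    unfolding cc unfolding cf using wedge_tensor[of unit_ext 0 unit_ext 0 "covector n A j" "covector n A j"] ux fin by simp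
  then show ?thesis unfolding coord_volume_def tensor_def by (simp add: mult.assoc)
qed

section \<open>Kaehler forms in adapted coordinates\<close>

definition std_kahler :: "nat \<Rightarrow> form" where
  "std_kahler n = diag_form (singleton_fun (\<lambda>j. of_bool (j < n)))"

lemma forms_1_1_eqI:
  assumes "\<alpha> \<in> forms n 1 1" "\<beta> \<in> forms n 1 1" "\<And>i j. i < n \<Longrightarrow> j < n \<Longrightarrow> \<alpha> {i} {j} = \<beta> {i} {j}"
  shows "\<alpha> = \<beta>"
proof (intro ext)
  fix I J
  show "\<alpha> I J = \<beta> I J"
  proof (cases "I \<subseteq> {..<n} \<and> J \<subseteq> {..<n} \<and> card I = 1 \<and> card J = 1")
    case True
    then obtain i j where "I = {i}" "J = {j}" by (metis card_1_singletonE)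
    then show ?thesis using True assms(3)[of i j] by simp
  next
    case False
    then have "\<alpha> I J = 0" "\<beta> I J = 0" using formsD[OF assms(1), of I J] formsD[OF assms(2), of I J] by blast+
    then show ?thesis by simp
  qed
qed

lemma std_kahler_forms: "std_kahler n \<in> forms n 1 1"
  unfolding std_kahler_def
  by (rule diag_form_forms) (auto dest!: singleton_fun_nonzeroD split: if_splits)

lemma kahler_pos_def:
  assumes "kahler n \<omega>"
  shows "pos_def n (\<lambda>i j. (2 / \<i>) * \<omega> {i} {j})"
  unfolding pos_def_def
proof (intro conjI allI impI)
  fix i j :: nat
  have "conj_form \<omega> {j} {i} = \<omega> {j} {i}" using assms unfolding kahler_def real_form_def by simp
  then have "\<omega> {j} {i} = - cnj (\<omega> {i} {j})" unfolding conj_form_def by simp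
  then show "(2 / \<i>) * \<omega> {j} {i} = cnj ((2 / \<i>) * \<omega> {i} {j})" by simp
next
  fix x :: "nat \<Rightarrow> complex" assume "\<exists>a<n. x a \<noteq> 0"
  then obtain a where a: "a < n" "x a \<noteq> 0" by blast
  have "vec n x \<noteq> 0\<^sub>v n"
  proof
    assume "vec n x = 0\<^sub>v n"
    then have "vec n x $ a = 0\<^sub>v n $ a" by simp
    then show False using a by simp
  qed
  then have "0 < Re (assoc_hermitian n \<omega> (vec n x))" using assms unfolding kahler_def by simp
  also have "assoc_hermitian n \<omega> (vec n x) = herm_form n (\<lambda>i j. (2 / \<i>) * \<omega> {i} {j}) x"
    unfolding assoc_hermitian_def herm_form_def by (intro sum.cong refl) simp
  finally show "0 < Re (herm_form n (\<lambda>i j. (2 / \<i>) * \<omega> {i} {j}) x)" .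
qed

text \<open>If \<open>L\<close> is a triangular factor of the associated Hermitian matrix, the
  column \<open>r\<close> of \<open>L\<close> holds the coefficients of the new coordinate
  \<open>w_r\<close>. Coordinates are rows in \<open>transform\<close>, hence the transpose.\<close>

lemma kahler_standard:
  assumes "kahler n \<omega>"
  obtains P P' where "P \<in> carrier_mat n n" "P' \<in> carrier_mat n n" "P * P' = 1\<^sub>m n" "P' * P = 1\<^sub>m n"
    "\<omega> = transform n P (std_kahler n)"
proof -
  obtain L N where LN: "L \<in> carrier_mat n n" "N \<in> carrier_mat n n" "L * N = 1\<^sub>m n" "N * L = 1\<^sub>m n"
    and h: "\<And>i j. i < n \<Longrightarrow> j < n \<Longrightarrow> (2 / \<i>) * \<omega> {i} {j} = (\<Sum>r<n. L $$ (i, r) * cnj (L $$ (j, r)))"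
    by (rule pos_def_decompose[OF kahler_pos_def[OF assms]]) (rule that)
  have "\<omega> = transform n L\<^sup>T (std_kahler n)"
  proof (rule forms_1_1_eqI)
    show "\<omega> \<in> forms n 1 1" using assms unfolding kahler_def real_form_def by blast
    show "transform n L\<^sup>T (std_kahler n) \<in> forms n 1 1" by (rule transform_forms[OF std_kahler_forms])
    fix i j assume ij: "i < n" "j < n"
    have "transform n L\<^sup>T (std_kahler n) {i} {j} = (\<i> / 2) * (\<Sum>r<n. L $$ (i, r) * cnj (L $$ (j, r)))"
      unfolding std_kahler_def transform_singleton_entry sum_distrib_left
      using ij LN(1) by (intro sum.cong refl) (simp add: mult_ac)
    also have "\<dots> = \<omega> {i} {j}" unfolding h[OF ij, symmetric] by simp
    finally show "\<omega> {i} {j} = transform n L\<^sup>T (std_kahler n) {i} {j}" by simp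
  qed
  moreover have "L\<^sup>T * N\<^sup>T = 1\<^sub>m n" "N\<^sup>T * L\<^sup>T = 1\<^sub>m n"
    using transpose_mult[OF LN(2,1)] transpose_mult[OF LN(1,2)] unfolding LN(3,4) transpose_one by simp_all
  ultimately show ?thesis using LN(1,2) by (intro that[of "L\<^sup>T" "N\<^sup>T"]) auto
qed

text \<open>Every two-element set arises in two orders, hence the coefficient
  \<open>2\<close>.\<close>

lemma std_kahler_square:
  "wedge (std_kahler n) (std_kahler n) = diag_form (\<lambda>R. if R \<subseteq> {..<n} \<and> card R = 2 then 2 else 0)"
  unfolding std_kahler_def wedge_diag_form
proof (rule diag_form_cong)
  fix S :: "nat set" assume fin: "finite S"
  let ?\<sigma> = "singleton_fun (\<lambda>j. of_bool (j < n))"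
  have "subset_conv ?\<sigma> ?\<sigma> S = (\<Sum>j\<in>S. ?\<sigma> {j} * ?\<sigma> (S - {j}))"
    unfolding subset_conv_def
  proof (rule sum_Pow_singletons[OF fin])
    fix K :: "nat set" assume "\<not> (\<exists>i. K = {i})"
    then have "?\<sigma> K = 0" using singleton_fun_nonzeroD by blast
    then show "?\<sigma> K * ?\<sigma> (S - K) = 0" by simp
  qed
  also have "\<dots> = (if S \<subseteq> {..<n} \<and> card S = 2 then 2 else 0)"
  proof (cases "card S = 2")
    case True
    then obtain x y where S: "S = {x, y}" "x \<noteq> y" by (auto simp: card_2_iff)
    have diff: "{x, y} - {x} = {y}" "{x, y} - {y} = {x}" using S(2) by auto
    have two: "sum f {x, y} = f x + f y" for f :: "nat \<Rightarrow> complex" using S(2) by simp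
    have "card {x, y} = 2" using S(2) by simp
    then show ?thesis unfolding S(1) two diff by simp
  next
    case False
    have "?\<sigma> (S - {j}) = 0" if j: "j \<in> S" for j
    proof (rule ccontr)
      assume "?\<sigma> (S - {j}) \<noteq> 0"
      then obtain l where "S - {j} = {l}" using singleton_fun_nonzeroD by blast
      then have "S = {j, l}" "j \<noteq> l" using j by auto
      then show False using False by simp
    qed
    then show ?thesis using False by simp
  qed
  finally show "subset_conv ?\<sigma> ?\<sigma> S = (if S \<subseteq> {..<n} \<and> card S = 2 then 2 else 0)" .
qed

lemma wedge_power_0: "wedge_power \<omega> 0 = unit_form"
  unfolding wedge_power_def wedge_list_def by simp

lemma wedge_power_2: "\<omega> \<in> forms n 1 1 \<Longrightarrow> wedge_power \<omega> 2 = wedge \<omega> \<omega>"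
  unfolding wedge_power_def wedge_list_def numeral_2_eq_2 by (simp add: wedge_unit_right)

text \<open>The square of \<open>\<omega>\<close> need not be diagonal in the coordinates
  \<open>P\<close>. Factoring \<open>P = Q * R\<close>, with \<open>R\<close> making
  \<open>\<omega>\<close> standard, reduces to a standard \<open>\<omega>\<close> and a first factor
  that is diagonal in the coordinates \<open>Q\<close>. As \<open>\<Theta>\<close> is real,
  conjugation reduces bidegree \<open>(a, 0)\<close> to \<open>(0, a)\<close>.\<close>

lemma lefschetz_wedge_kahler_square:
  assumes P: "P \<in> carrier_mat n n" "P' \<in> carrier_mat n n" "P * P' = 1\<^sub>m n" "P' * P = 1\<^sub>m n"
    and supp: "\<And>R. c R \<noteq> 0 \<Longrightarrow> R \<subseteq> {..<n} \<and> card R = k"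
    and pos: "\<And>R. R \<subseteq> {..<n} \<Longrightarrow> card R = k \<Longrightarrow> c R = of_real (c' R) \<and> c' R > 0"
    and \<omega>: "kahler n \<omega>" and ab: "a = 0 \<or> b = 0" "a + b + (k + 2) = n"
  shows "lefschetz n a b (wedge (transform n P (diag_form c)) (wedge_power \<omega> 2))"
proof -
  define s :: "nat set \<Rightarrow> complex" where "s = (\<lambda>R. if R \<subseteq> {..<n} \<and> card R = 2 then 2 else 0)"
  obtain R R' where R: "R \<in> carrier_mat n n" "R' \<in> carrier_mat n n" "R * R' = 1\<^sub>m n" "R' * R = 1\<^sub>m n"
    and \<omega>R: "\<omega> = transform n R (std_kahler n)" by (rule kahler_standard[OF \<omega>]) (rule that)
  have "\<omega> \<in> forms n 1 1" using \<omega> unfolding kahler_def real_form_def by blast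
  then have "wedge_power \<omega> 2 = wedge \<omega> \<omega>" by (rule wedge_power_2)
  also have "\<dots> = transform n R (diag_form s)"
    unfolding \<omega>R transform_wedge std_kahler_square s_def ..
  finally have \<omega>2: "wedge_power \<omega> 2 = transform n R (diag_form s)" .
  define Q Q' where "Q = P * R'" and "Q' = R * P'"
  have Q: "Q \<in> carrier_mat n n" "Q' \<in> carrier_mat n n" unfolding Q_def Q'_def using P R by auto
  have QR: "Q * R = P" unfolding Q_def using assoc_mult_mat[OF P(1) R(2,1)] R(4) P(1) by simp
  have "Q * Q' = P * (R' * (R * P'))" unfolding Q_def Q'_def 
    by (rule assoc_mult_mat[OF P(1) R(2) mult_carrier_mat[OF R(1) P(2)]])
  also have "R' * (R * P') = P'" using assoc_mult_mat[OF R(2,1) P(2)] R(4) P(2) by simp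
  finally have QQ': "Q * Q' = 1\<^sub>m n" using P(3) by simp
  have "Q' * Q = R * (P' * (P * R'))" unfolding Q_def Q'_def 
    by (rule assoc_mult_mat[OF R(1) P(2) mult_carrier_mat[OF P(1) R(2)]])
  also have "P' * (P * R') = R'" using assoc_mult_mat[OF P(2,1) R(2)] P(4) R(2) by simp
  finally have Q'Q: "Q' * Q = 1\<^sub>m n" using R(3) by simp
  define \<Theta> where "\<Theta> = wedge (transform n Q (diag_form c)) (diag_form s)"
  have "wedge (transform n P (diag_form c)) (wedge_power \<omega> 2) = transform n R \<Theta>"
    unfolding \<omega>2 \<Theta>_def transform_wedge[symmetric] transform_transform[OF Q(1) R(1)] QR ..
  moreover have "lefschetz n a b \<Theta>"
  proof (rule lefschetzI)
    show "\<Theta> \<in> forms n (k + 2) (k + 2)"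
      unfolding \<Theta>_def by (intro wedge_forms transform_forms diag_form_forms supp) (auto simp: s_def split: if_splits)
    show "a + b + (k + 2) = n" by fact
    have zero: "\<beta> = (\<lambda>I J. 0)" if "q + k + 2 = n" "\<beta> \<in> forms n 0 q" "wedge \<beta> \<Theta> = (\<lambda>I J. 0)" for \<beta> q
      by (rule lefschetz_wedge_square_antiholomorphic[OF Q QQ' Q'Q supp pos _ that(1,2), where s = s])
        (use that(3) in \<open>simp_all add: \<Theta>_def s_def\<close>)
    fix \<alpha> assume \<alpha>: "\<alpha> \<in> forms n a b" "wedge \<alpha> \<Theta> = (\<lambda>I J. 0)"
    show "\<alpha> = (\<lambda>I J. 0)"
    proof (cases "a = 0")
      case True
      show ?thesis by (rule zero[of b]) (use True \<alpha> ab in auto)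
    next
      case False
      then have b: "b = 0" using ab by simp
      have "cnj (c I) = c I" for I using supp[of I] pos[of I] by (cases "c I = 0") auto
      moreover have "cnj (s I) = s I" for I unfolding s_def by simp
      ultimately have "conj_form \<Theta> = \<Theta>"
        unfolding \<Theta>_def conj_wedge transform_conj by (simp add: conj_diag_form)
      then have "wedge (conj_form \<alpha>) \<Theta> = conj_form (wedge \<alpha> \<Theta>)" by (simp add: conj_wedge)
      also have "\<dots> = (\<lambda>I J. 0)" unfolding \<alpha>(2) conj_form_def by simp
      finally have w: "wedge (conj_form \<alpha>) \<Theta> = (\<lambda>I J. 0)" .
      have "conj_form \<alpha> = (\<lambda>I J. 0)"
        by (rule zero[of a, OF _ _ w]) (use conj_forms[OF \<alpha>(1)] b ab in auto)
      then show ?thesis by (rule conj_form_zeroD)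
    qed
  qed
  ultimately show ?thesis using lefschetz_transform[OF R] by simp
qed

section \<open>Coefficients over arbitrary index sets\<close>

lemma mixed_coeff_outside:
  assumes "finite J" "card J \<noteq> k \<or> (\<exists>j\<in>J. \<forall>a<k. \<forall>b<k. B j a b = 0)"
  shows "mixed_coeff k B J = 0"
  unfolding mixed_coeff_def
proof (intro sum.neutral ballI)
  fix \<tau> \<sigma> assume t: "\<tau> \<in> bijs {..<k} J" and s: "\<sigma> \<in> {\<sigma>. \<sigma> permutes {..<k}}"
  have b: "bij_betw \<tau> {..<k} J" by (rule bijsD(1)[OF t])
  then have "card J = k" using bij_betw_same_card by fastforce
  then obtain j where j: "j \<in> J" "\<forall>a<k. \<forall>b<k. B j a b = 0" using assms(2) by blast
  then obtain a where a: "a < k" "\<tau> a = j" using b by (auto simp: bij_betw_def)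
  have "(\<Prod>a<k. B (\<tau> a) a (\<sigma> a)) = 0"
    using a j s permutes_lessThan[of \<sigma> k a] by (intro prod_zero) (auto intro!: bexI[of _ a])
  then show "of_int (sign \<sigma>) * (\<Prod>a<k. B (\<tau> a) a (\<sigma> a)) = 0" by simp
qed

lemma mixed_coeff_coeff_mat:
  assumes h: "bij_betw h {..<k+2} X" and pd: "\<And>j. j \<in> X \<Longrightarrow> pos_def k (B j)"
    and ij: "i < k + 2" "j < k + 2" "i \<noteq> j"
  shows "mixed_coeff k B (X - {h i, h j}) = of_real (coeff_mat k (\<lambda>l. B (h l)) i j)"
proof -
  have inj: "inj_on h {..<k+2}" using h by (simp add: bij_betw_def)
  have "X - {h i, h j} = h ` {..<k+2} - h ` {i, j}" using h by (simp add: bij_betw_def)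
  also have "\<dots> = h ` ({..<k+2} - {i, j})"
    by (rule inj_on_image_set_diff[OF inj, symmetric]) (use ij in auto)
  finally have e: "X - {h i, h j} = h ` ({..<k+2} - {i, j})" .
  have m: "mixed_coeff k B (X - {h i, h j}) = mixed_coeff k (\<lambda>l. B (h l)) ({..<k+2} - {i, j})"
    unfolding e by (rule mixed_coeff_reindex) (rule inj_on_subset[OF inj], auto)
  have hX: "h l \<in> X" if "l < k + 2" for l using h that by (auto simp: bij_betw_def)
  have "cnj (mixed_coeff k (\<lambda>l. B (h l)) ({..<k+2} - {i, j})) = mixed_coeff k (\<lambda>l. B (h l)) ({..<k+2} - {i, j})"
    by (rule mixed_coeff_real, rule pos_def_sym[OF pd[OF hX]]) auto
  then have "mixed_coeff k (\<lambda>l. B (h l)) ({..<k+2} - {i, j}) = of_real (Re (mixed_coeff k (\<lambda>l. B (h l)) ({..<k+2} - {i, j})))"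
    by (metis Reals_cnj_iff of_real_Re)
  then show ?thesis unfolding m coeff_mat_def using ij(3) by simp
qed

lemma mixed_coeff_nonsingular:
  assumes k: "k > 0" and X: "finite X" "card X = k + 2" and pd: "\<And>j. j \<in> X \<Longrightarrow> pos_def k (B j)"
    and u: "\<And>i. i \<in> X \<Longrightarrow> (\<Sum>j\<in>X - {i}. mixed_coeff k B (X - {i, j}) * u j) = 0"
  shows "\<forall>i\<in>X. u i = 0"
proof -
  obtain h where h: "bij_betw h {..<k+2} X"
    using ex_bij_betw_nat_finite[OF X(1)] unfolding X(2) lessThan_atLeast0 by blast
  let ?A = "coeff_mat k (\<lambda>l. B (h l))"
  have hX: "h l \<in> X" if "l < k + 2" for l using h that by (auto simp: bij_betw_def)
  have "all_pos_def k (\<lambda>l. B (h l))" unfolding all_pos_def_def using pd hX by blast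
  then have ns: "\<not> singular_mat (k + 2) ?A" using k by (rule coeff_mat_nonsingular)
  have row: "(\<Sum>j<k+2. of_real (?A i j) * u (h j)) = 0" if i: "i < k + 2" for i
  proof -
    have "bij_betw h ({..<k+2} - {i}) (X - {h i})"
    proof -
      have inj: "inj_on h {..<k+2}" using h by (simp add: bij_betw_def)
      have "h ` ({..<k+2} - {i}) = X - {h i}"
        using inj_on_image_set_diff[OF inj, of "{..<k+2}" "{i}"] h i by (simp add: bij_betw_def)
      then show ?thesis unfolding bij_betw_def using inj_on_subset[OF inj] by auto
    qed
    from sum.reindex_bij_betw[OF this, of "\<lambda>j. mixed_coeff k B (X - {h i, j}) * u j"] u[OF hX[OF i]]
    have "(\<Sum>j\<in>{..<k+2} - {i}. mixed_coeff k B (X - {h i, h j}) * u (h j)) = 0" by simp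
    also have "(\<Sum>j\<in>{..<k+2} - {i}. mixed_coeff k B (X - {h i, h j}) * u (h j))
      = (\<Sum>j\<in>{..<k+2} - {i}. of_real (?A i j) * u (h j))"
      by (intro sum.cong refl) (use i in \<open>auto simp: mixed_coeff_coeff_mat[OF h pd]\<close>)
    also have "\<dots> = (\<Sum>j<k+2. of_real (?A i j) * u (h j))"
      by (rule sum.mono_neutral_left) auto
    finally show ?thesis .
  qed
  \<comment> \<open>The matrix is real, so the real and imaginary parts of a kernel vector lie in
    the kernel separately.\<close>
  have "Re (u (h j)) = 0 \<and> Im (u (h j)) = 0" if j: "j < k + 2" for j
  proof -
    have RI: "(\<Sum>j<k+2. ?A i j * Re (u (h j))) = Re (\<Sum>j<k+2. of_real (?A i j) * u (h j))"
      "(\<Sum>j<k+2. ?A i j * Im (u (h j))) = Im (\<Sum>j<k+2. of_real (?A i j) * u (h j))" for i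
      unfolding Re_sum Im_sum by (intro sum.cong refl; simp)+
    have re: "\<forall>i<k+2. (\<Sum>j<k+2. ?A i j * Re (u (h j))) = 0"
    proof (intro allI impI)
      fix i assume "i < k + 2"
      from row[OF this] show "(\<Sum>j<k+2. ?A i j * Re (u (h j))) = 0" unfolding RI(1) by (simp only: zero_complex.sel)
    qed
    have im: "\<forall>i<k+2. (\<Sum>j<k+2. ?A i j * Im (u (h j))) = 0"
    proof (intro allI impI)
      fix i assume "i < k + 2"
      from row[OF this] show "(\<Sum>j<k+2. ?A i j * Im (u (h j))) = 0" unfolding RI(2) by (simp only: zero_complex.sel)
    qed
    have "w j = 0" if "\<forall>i<k+2. (\<Sum>j<k+2. ?A i j * w j) = 0" for w
    proof (rule ccontr)
      assume "w j \<noteq> 0"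
      then have "singular_mat (k + 2) ?A" unfolding singular_mat_def using that j by (intro exI[of _ w]) (rule conjI, rule exI[of _ j], simp_all)
      then show False using ns by blast
    qed
    from this[OF re] this[OF im] show ?thesis by blast
  qed
  then have "u (h j) = 0" if "j < k + 2" for j using that by (simp add: complex_eq_iff)
  then show ?thesis using h by (auto simp: bij_betw_def)
qed

text \<open>Two more indices, available because \<open>k + 2 \<le> n\<close>, enlarge
  \<open>J\<close> to a set \<open>X\<close> of \<open>k + 2\<close> elements, and the coefficient
  at \<open>J\<close> becomes an off-diagonal entry of the coefficient matrix of
  \<open>X\<close>.\<close>

lemma mixed_coeff_pos:
  assumes k: "k > 0" and J: "J \<subseteq> {..<n}" "card J = k" and n: "k + 2 \<le> n" and pd: "\<And>j. j < n \<Longrightarrow> pos_def k (B j)"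
  shows "mixed_coeff k B J = of_real (Re (mixed_coeff k B J)) \<and> 0 < Re (mixed_coeff k B J)"
proof -
  have fJ: "finite J" using J(1) by (rule finite_subset) simp
  have "2 \<le> card ({..<n} - J)" using card_lessThan_minus[OF J(1)] J(2) n by simp
  then obtain Y where Y: "Y \<subseteq> {..<n} - J" "card Y = 2" "finite Y" by (rule obtain_subset_with_card_n)
  then obtain x y where xy: "Y = {x, y}" "x \<noteq> y" by (auto simp: card_2_iff)
  define X where "X = J \<union> Y"
  have "J \<inter> Y = {}" using Y(1) by auto
  from card_Un_disjoint[OF fJ Y(3) this] have X: "finite X" "card X = k + 2" "X \<subseteq> {..<n}"
    unfolding X_def using Y J fJ by auto
  obtain h where h: "bij_betw h {..<k+2} X"
    using ex_bij_betw_nat_finite[OF X(1)] unfolding X(2) lessThan_atLeast0 by blast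
  have "x \<in> h ` {..<k+2}" "y \<in> h ` {..<k+2}" using h xy unfolding X_def by (auto simp: bij_betw_def)
  then obtain i j where ij: "i < k + 2" "h i = x" "j < k + 2" "h j = y" by auto
  have "i \<noteq> j" using ij xy by auto
  have J_eq: "J = X - {h i, h j}" unfolding ij X_def using Y xy by auto
  have pdX: "pos_def k (B l)" if "l \<in> X" for l using pd that X(3) by auto
  have "all_pos_def k (\<lambda>l. B (h l))" unfolding all_pos_def_def using pdX h by (auto simp: bij_betw_def)
  then have "0 < coeff_mat k (\<lambda>l. B (h l)) i j" using k ij \<open>i \<noteq> j\<close> by (intro coeff_mat_pos)
  moreover have "mixed_coeff k B J = of_real (coeff_mat k (\<lambda>l. B (h l)) i j)"
    unfolding J_eq by (rule mixed_coeff_coeff_mat[OF h pdX ij(1,3) \<open>i \<noteq> j\<close>])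
  ultimately show ?thesis by simp
qed

text \<open>Stated for arbitrary coordinates \<open>P\<close> and positive definite \<open>B\<close>
  because it serves every point of the path: \<open>B\<close> varies along one leg, \<open>P\<close>
  along the other.\<close>

lemma form_det_lefschetz:
  assumes P: "P \<in> carrier_mat n n" "P' \<in> carrier_mat n n" "P * P' = 1\<^sub>m n" "P' * P = 1\<^sub>m n"
    and pd: "\<And>j. j < n \<Longrightarrow> pos_def k (B j)" and k: "k > 0" and n: "k + 2 \<le> n" "n \<le> k + 3"
    and M: "\<And>a b. a < k \<Longrightarrow> b < k \<Longrightarrow>
      M $$ (a, b) = transform n P (diag_form (singleton_fun (\<lambda>j. if j < n then B j a b else 0)))"
    and \<omega>: "kahler n \<omega>" and pq: "p + q = n - k"
  shows "real_form n k (form_det k M)"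
    and "r \<le> min p q \<Longrightarrow> lefschetz n (p - r) (q - r) (wedge (form_det k M) (wedge_power \<omega> (2 * r)))"
proof -
  \<comment> \<open>The cut-off makes the coefficient of every \<open>J\<close> outside
    \<open>{..<n}\<close> vanish, as \<open>lefschetz_diag_form\<close> demands of its
    support.\<close>
  define B0 where "B0 = (\<lambda>j a b. if j < n then B j a b else 0)"
  define c where "c = (\<lambda>J. if J \<subseteq> {..<n} \<and> card J = k then mixed_coeff k B0 J else 0)"
  have pd0: "pos_def k (B0 j)" if "j < n" for j using pd[OF that] that unfolding B0_def by simp
  have "diag_form (mixed_coeff k B0) = diag_form c"
  proof (rule diag_form_cong)
    fix J :: "nat set" assume "finite J"
    show "mixed_coeff k B0 J = c J"
    proof (cases "J \<subseteq> {..<n} \<and> card J = k")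
      case False
      then have "card J \<noteq> k \<or> (\<exists>j\<in>J. \<not> j < n)" by auto
      then have "card J \<noteq> k \<or> (\<exists>j\<in>J. \<forall>a<k. \<forall>b<k. B0 j a b = 0)" unfolding B0_def by auto
      then have "mixed_coeff k B0 J = 0" by (rule mixed_coeff_outside[OF \<open>finite J\<close>])
      then show ?thesis using False unfolding c_def by simp
    qed (simp add: c_def)
  qed
  moreover have "form_det k M = transform n P (diag_form (mixed_coeff k B0))"
    by (rule form_det_transform) (use M in \<open>simp add: B0_def\<close>)
  ultimately have det: "form_det k M = transform n P (diag_form c)" by simp
  have supp: "R \<subseteq> {..<n} \<and> card R = k" if "c R \<noteq> 0" for R using that unfolding c_def by (auto split: if_splits)
  have pos: "c R = of_real (Re (c R)) \<and> Re (c R) > 0" if "R \<subseteq> {..<n}" "card R = k" for R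
    using mixed_coeff_pos[OF k that n(1) pd0] that unfolding c_def by simp
  have c_real: "cnj (c R) = c R" for R
    using supp[of R] pos[of R] by (cases "c R = 0") (auto simp: complex_eq_iff)
  have forms: "form_det k M \<in> forms n k k" unfolding det by (intro transform_forms diag_form_forms supp)
  show "real_form n k (form_det k M)"
    unfolding real_form_def using forms by (simp add: det transform_conj conj_diag_form c_real)
  have k_le: "p + q + k = n" "p + q \<le> 3" using pq n by auto
  assume r: "r \<le> min p q"
  then have "2 * r \<le> 3" using k_le by auto
  then consider "r = 0" | "r = 1" by linarith
  then show "lefschetz n (p - r) (q - r) (wedge (form_det k M) (wedge_power \<omega> (2 * r)))"
  proof cases
    case 1
    have "lefschetz n p q (diag_form c)"
    proof (rule lefschetz_diag_form[OF supp])
      show "c R \<noteq> 0" if "R \<subseteq> {..<n}" "card R = k" for R using pos[OF that] by auto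
      fix X u assume X: "X \<subseteq> {..<n}" "card X = k + 2"
        and u: "\<And>i. i \<in> X \<Longrightarrow> (\<Sum>j\<in>X - {i}. c (X - {i, j}) * u j) = 0"
      have fX: "finite X" using X(1) by (rule finite_subset) simp
      show "\<forall>i\<in>X. u i = 0"
      proof (rule mixed_coeff_nonsingular[OF k fX X(2)])
        show "pos_def k (B0 j)" if "j \<in> X" for j using that X pd0 by auto
        fix i assume i: "i \<in> X"
        have "(\<Sum>j\<in>X - {i}. mixed_coeff k B0 (X - {i, j}) * u j) = (\<Sum>j\<in>X - {i}. c (X - {i, j}) * u j)"
        proof (rule sum.cong[OF refl])
          fix j assume j: "j \<in> X - {i}"
          have "card (X - {i, j}) = k" using i j X fX by (simp add: card_Diff_subset)
          then show "mixed_coeff k B0 (X - {i, j}) * u j = c (X - {i, j}) * u j"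
            using X(1) unfolding c_def by auto
        qed
        then show "(\<Sum>j\<in>X - {i}. mixed_coeff k B0 (X - {i, j}) * u j) = 0" using u[OF i] by simp
      qed
    qed (use k_le in auto)
    then have "lefschetz n p q (form_det k M)" unfolding det by (rule lefschetz_transform[OF P])
    then show ?thesis using 1 by (simp add: wedge_power_0 wedge_unit_right[OF forms])
  next
    case 2
    \<comment> \<open>Both \<open>p\<close> and \<open>q\<close> are at least \<open>1\<close> and
      \<open>p + q \<le> 3\<close>, so \<open>p - 1\<close> or \<open>q - 1\<close> is zero.\<close>
    have "lefschetz n (p - 1) (q - 1) (wedge (transform n P (diag_form c)) (wedge_power \<omega> 2))"
      by (rule lefschetz_wedge_kahler_square[OF P supp pos \<omega>]) (use r 2 k_le in auto)
    then show ?thesis using 2 by (simp add: det)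
  qed
qed

section \<open>The path\<close>

lemma assoc_hermitian_transform:
  "assoc_hermitian n (transform n A (diag_form (singleton_fun x))) v
    = (\<Sum>r<n. x r * of_real ((cmod (\<Sum>i<n. A $$ (r, i) * v $ i))\<^sup>2))"
proof -
  have "assoc_hermitian n (transform n A (diag_form (singleton_fun x))) v
    = (\<Sum>i<n. \<Sum>j<n. \<Sum>r<n. x r * ((A $$ (r, i) * v $ i) * cnj (A $$ (r, j) * v $ j)))"
    unfolding assoc_hermitian_def transform_singleton_entry
    by (intro sum.cong refl) (simp add: sum_distrib_left sum_distrib_right mult_ac)
  also have "\<dots> = (\<Sum>i<n. \<Sum>r<n. \<Sum>j<n. x r * ((A $$ (r, i) * v $ i) * cnj (A $$ (r, j) * v $ j)))"
    by (intro sum.cong refl sum.swap)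
  also have "\<dots> = (\<Sum>r<n. \<Sum>i<n. \<Sum>j<n. x r * ((A $$ (r, i) * v $ i) * cnj (A $$ (r, j) * v $ j)))"
    by (rule sum.swap)
  also have "\<dots> = (\<Sum>r<n. x r * ((\<Sum>i<n. A $$ (r, i) * v $ i) * cnj (\<Sum>i<n. A $$ (r, i) * v $ i)))"
    by (simp only: cnj_sum sum_product) (simp only: sum_distrib_left)
  finally show ?thesis unfolding complex_norm_square .
qed

lemma row_mult_vec:
  "A \<in> carrier_mat n n \<Longrightarrow> v \<in> carrier_vec n \<Longrightarrow> r < n \<Longrightarrow> (\<Sum>i<n. A $$ (r, i) * v $ i) = (A *\<^sub>v v) $ r"
  by (auto simp: scalar_prod_def lessThan_atLeast0)

lemma kahler_transform_std:
  assumes A: "A \<in> carrier_mat n n" "A' \<in> carrier_mat n n" "A' * A = 1\<^sub>m n"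
  shows "kahler n (transform n A (std_kahler n))"
  unfolding kahler_def
proof (intro conjI ballI impI)
  have "conj_form (std_kahler n) = std_kahler n"
    unfolding std_kahler_def by (rule conj_diag_form) (simp add: singleton_fun_def)
  then show "real_form n 1 (transform n A (std_kahler n))"
    unfolding real_form_def transform_conj using transform_forms[OF std_kahler_forms] by (simp del: One_nat_def)
  fix v :: "complex vec" assume v: "v \<in> carrier_vec n" "v \<noteq> 0\<^sub>v n"
  have "A *\<^sub>v v \<noteq> 0\<^sub>v n"
  proof
    assume "A *\<^sub>v v = 0\<^sub>v n"
    then have "A' *\<^sub>v (A *\<^sub>v v) = 0\<^sub>v n" using A(2) by auto
    then show False using assoc_mult_mat_vec[OF A(2,1) v(1)] A(3) v by simp
  qed
  then obtain r where r: "r < n" "(A *\<^sub>v v) $ r \<noteq> 0"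
    using A(1) by (metis carrier_matD(1) dim_mult_mat_vec eq_vecI index_zero_vec(1,2))
  have "assoc_hermitian n (transform n A (std_kahler n)) v = of_real (\<Sum>r<n. (cmod ((A *\<^sub>v v) $ r))\<^sup>2)"
    unfolding std_kahler_def assoc_hermitian_transform of_real_sum
    by (intro sum.cong refl) (simp add: row_mult_vec[OF A(1) v(1)])
  moreover have "0 < (\<Sum>r<n. (cmod ((A *\<^sub>v v) $ r))\<^sup>2)"
    by (rule sum_pos2[of _ r]) (use r in auto)
  ultimately show "0 < Re (assoc_hermitian n (transform n A (std_kahler n)) v)" by simp
qed

lemma convex_pos:
  fixes x y s :: real
  assumes "0 \<le> s" "s \<le> 1" "0 < x" "0 < y"
  shows "0 < (1 - s) * x + s * y"
proof (cases "s = 0")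
  case False
  then have "0 < s * y" "0 \<le> (1 - s) * x" using assms by auto
  then show ?thesis by linarith
qed (use assms in simp)

lemma kahler_convex:
  assumes \<alpha>: "kahler n \<alpha>" and \<beta>: "kahler n \<beta>" and s: "0 \<le> s" "s \<le> 1"
  shows "kahler n (\<lambda>I J. (1 - of_real s) * \<alpha> I J + of_real s * \<beta> I J)" (is "kahler n ?\<gamma>")
  unfolding kahler_def
proof (intro conjI ballI impI)
  have f: "\<alpha> \<in> forms n 1 1" "\<beta> \<in> forms n 1 1" and c: "conj_form \<alpha> = \<alpha>" "conj_form \<beta> = \<beta>"
    using \<alpha> \<beta> unfolding kahler_def real_form_def by auto
  have "?\<gamma> \<in> forms n 1 1"
    unfolding forms_def
  proof (intro CollectI allI impI)
    fix I J assume "(1 - of_real s) * \<alpha> I J + of_real s * \<beta> I J \<noteq> 0"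
    then have "\<alpha> I J \<noteq> 0 \<or> \<beta> I J \<noteq> 0" by auto
    then show "I \<subseteq> {..<n} \<and> J \<subseteq> {..<n} \<and> card I = 1 \<and> card J = 1" using formsD[OF f(1)] formsD[OF f(2)] by blast
  qed
  moreover have "conj_form ?\<gamma> = ?\<gamma>"
  proof (intro ext)
    fix I J
    have "conj_form ?\<gamma> I J = (1 - of_real s) * conj_form \<alpha> I J + of_real s * conj_form \<beta> I J"
      unfolding conj_form_def by (simp add: algebra_simps)
    then show "conj_form ?\<gamma> I J = ?\<gamma> I J" unfolding c .
  qed
  ultimately show "real_form n 1 ?\<gamma>" unfolding real_form_def by blast
  fix v :: "complex vec" assume v: "v \<in> carrier_vec n" "v \<noteq> 0\<^sub>v n"
  have "assoc_hermitian n ?\<gamma> v = of_real (1 - s) * assoc_hermitian n \<alpha> v + of_real s * assoc_hermitian n \<beta> v"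
    unfolding assoc_hermitian_def sum_distrib_left sum.distrib[symmetric]
    by (intro sum.cong refl) (simp add: algebra_simps)
  then have "Re (assoc_hermitian n ?\<gamma> v) = (1 - s) * Re (assoc_hermitian n \<alpha> v) + s * Re (assoc_hermitian n \<beta> v)"
    by simp
  also have "\<dots> > 0" using \<alpha> \<beta> v unfolding kahler_def by (intro convex_pos[OF s]) auto
  finally show "0 < Re (assoc_hermitian n ?\<gamma> v)" .
qed

lemma pos_def_convex:
  assumes H: "pos_def k H" and H': "pos_def k H'" and s: "0 \<le> s" "s \<le> 1"
  shows "pos_def k (\<lambda>a b. (1 - of_real s) * H a b + of_real s * H' a b)" (is "pos_def k ?G")
  unfolding pos_def_def
proof (intro conjI allI impI)
  fix a b assume ab: "a < k" "b < k"
  show "(1 - of_real s) * H b a + of_real s * H' b a = cnj ((1 - of_real s) * H a b + of_real s * H' a b)"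
    by (simp add: pos_def_sym[OF H ab] pos_def_sym[OF H' ab])
next
  fix x :: "nat \<Rightarrow> complex" assume "\<exists>a<k. x a \<noteq> 0"
  then obtain a where a: "a < k" "x a \<noteq> 0" by blast
  have "herm_form k ?G x = of_real (1 - s) * herm_form k H x + of_real s * herm_form k H' x"
    unfolding herm_form_def sum_distrib_left sum.distrib[symmetric]
    by (intro sum.cong refl) (simp add: algebra_simps)
  then have "Re (herm_form k ?G x) = (1 - s) * Re (herm_form k H x) + s * Re (herm_form k H' x)" by simp
  also have "\<dots> > 0" by (rule convex_pos[OF s pos_def_pos[of k H a x, OF H a] pos_def_pos[of k H' a x, OF H' a]])
  finally show "0 < Re (herm_form k ?G x)" .
qed

text \<open>Contracting \<open>M\<close> with \<open>\<theta>\<close> gives the diagonal form with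
  entries \<open>herm_form k (B r) x\<close>. Its Hermitian form is evaluated at column
  \<open>j\<close> of the inverse of \<open>A\<close>, where \<open>w_j\<close> is \<open>1\<close>
  and all other coordinates vanish, so only the entry \<open>r = j\<close> is left.\<close>

lemma griffiths_pos_def:
  assumes A: "A \<in> carrier_mat n n" "A' \<in> carrier_mat n n" "A * A' = 1\<^sub>m n"
    and herm: "\<And>j a b. j < n \<Longrightarrow> a < k \<Longrightarrow> b < k \<Longrightarrow> B j b a = cnj (B j a b)"
    and M: "\<And>a b. a < k \<Longrightarrow> b < k \<Longrightarrow>
      M $$ (a, b) = transform n A (diag_form (singleton_fun (\<lambda>j. if j < n then B j a b else 0)))"
    and pos: "griffiths_positive n k M" and j: "j < n"
  shows "pos_def k (B j)"
  unfolding pos_def_def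
proof (intro conjI allI impI)
  fix x :: "nat \<Rightarrow> complex" assume "\<exists>a<k. x a \<noteq> 0"
  then obtain a where a: "a < k" "x a \<noteq> 0" by blast
  define \<theta> where "\<theta> = vec k x"
  have "\<theta> \<in> carrier_vec k" unfolding \<theta>_def by simp
  have "\<theta> \<noteq> 0\<^sub>v k"
  proof
    assume "\<theta> = 0\<^sub>v k"
    then have "\<theta> $ a = 0\<^sub>v k $ a" by simp
    then show False using a by (simp add: \<theta>_def)
  qed
  let ?F = "\<lambda>I J. \<Sum>a<k. \<Sum>b<k. (\<theta> $ a) * cnj (\<theta> $ b) * (M $$ (a, b)) I J"
  let ?t = "\<lambda>r I J. covector n A r I * cnj (covector n A r J)"
  have "?F = transform n A (diag_form (singleton_fun (\<lambda>r. herm_form k (B r) x)))"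
  proof (intro ext)
    fix I J
    have "?F I J = (\<Sum>a<k. \<Sum>b<k. \<Sum>r<n. (\<i> / 2) * (B r a b * x a * cnj (x b)) * ?t r I J)"
      by (intro sum.cong refl) (simp add: M \<theta>_def transform_singleton_entry sum_distrib_left mult_ac)
    also have "\<dots> = (\<Sum>a<k. \<Sum>r<n. \<Sum>b<k. (\<i> / 2) * (B r a b * x a * cnj (x b)) * ?t r I J)"
      by (intro sum.cong refl sum.swap)
    also have "\<dots> = (\<Sum>r<n. \<Sum>a<k. \<Sum>b<k. (\<i> / 2) * (B r a b * x a * cnj (x b)) * ?t r I J)"
      by (rule sum.swap)
    also have "\<dots> = (\<Sum>r<n. (\<i> / 2) * herm_form k (B r) x * covector n A r I * cnj (covector n A r J))"
      unfolding herm_form_def by (simp only: sum_distrib_left sum_distrib_right mult.assoc)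
    finally show "?F I J = transform n A (diag_form (singleton_fun (\<lambda>r. herm_form k (B r) x))) I J"
      unfolding transform_singleton_entry .
  qed
  moreover have "kahler n ?F" using pos \<open>\<theta> \<noteq> 0\<^sub>v k\<close> \<open>\<theta> \<in> carrier_vec k\<close>
    unfolding griffiths_positive_def by blast
  ultimately have K: "kahler n (transform n A (diag_form (singleton_fun (\<lambda>r. herm_form k (B r) x))))" by simp
  define v where "v = col A' j"
  have v: "v \<in> carrier_vec n" unfolding v_def using A(2) j by simp
  have Av: "A *\<^sub>v v = unit_vec n j"
  proof -
    have "A *\<^sub>v col A' j = col (A * A') j" by (rule col_mult2[OF A(1,2) j, symmetric])
    then show ?thesis unfolding v_def A(3) using j by simp
  qed
  have "v \<noteq> 0\<^sub>v n"
  proof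
    assume "v = 0\<^sub>v n"
    then have "A *\<^sub>v v = 0\<^sub>v n" using A(1) by auto
    then have "unit_vec n j = (0\<^sub>v n :: complex vec)" using Av by simp
    then have "unit_vec n j $ j = (0\<^sub>v n :: complex vec) $ j" by simp
    then show False using j by simp
  qed
  then have "0 < Re (assoc_hermitian n (transform n A (diag_form (singleton_fun (\<lambda>r. herm_form k (B r) x)))) v)"
    using K v unfolding kahler_def by blast
  also have "assoc_hermitian n (transform n A (diag_form (singleton_fun (\<lambda>r. herm_form k (B r) x)))) v
    = (\<Sum>r<n. if r = j then herm_form k (B j) x else 0)"
    unfolding assoc_hermitian_transform
    by (intro sum.cong refl) (use j in \<open>auto simp: row_mult_vec[OF A(1) v] Av\<close>)
  also have "\<dots> = herm_form k (B j) x" using j by simp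
  finally show "0 < Re (herm_form k (B j) x)" .
qed (rule herm[OF j])

section \<open>Endpoint and continuity of the path\<close>

lemma wedge_list_zero: "(\<lambda>I J. 0) \<in> set xs \<Longrightarrow> wedge_list xs = (\<lambda>I J. 0)"
proof (induction xs)
  case (Cons x xs)
  have "wedge \<alpha> (\<lambda>I J. 0) = (\<lambda>I J. 0)" "wedge (\<lambda>I J. 0) \<alpha> = (\<lambda>I J. 0)" for \<alpha>
    unfolding wedge_def by simp_all
  then show ?case using Cons by (auto simp: wedge_list_def)
qed simp

lemma form_det_cong:
  assumes "\<And>a b. a < k \<Longrightarrow> b < k \<Longrightarrow> M $$ (a, b) = M' $$ (a, b)"
  shows "form_det k M = form_det k M'"
proof -
  have "map (\<lambda>a. M $$ (a, \<sigma> a)) [0..<k] = map (\<lambda>a. M' $$ (a, \<sigma> a)) [0..<k]" if "\<sigma> permutes {..<k}" for \<sigma>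
    using assms permutes_lessThan[OF that] by auto
  then show ?thesis unfolding form_det_def by (intro ext sum.cong refl) (simp del: map_eq_conv)
qed

lemma form_det_scalar:
  assumes "\<And>a b. a < k \<Longrightarrow> b < k \<Longrightarrow> M $$ (a, b) = (\<lambda>I J. of_bool (a = b) * \<omega> I J)"
  shows "form_det k M = wedge_power \<omega> k"
proof (intro ext)
  fix I J
  have "of_int (sign \<sigma>) * wedge_list (map (\<lambda>a. M $$ (a, \<sigma> a)) [0..<k]) I J = (if \<sigma> = id then wedge_power \<omega> k I J else 0)"
    if \<sigma>: "\<sigma> permutes {..<k}" for \<sigma>
  proof (cases "\<sigma> = id")
    case True
    have "map (\<lambda>a. M $$ (a, \<sigma> a)) [0..<k] = map (\<lambda>a. \<omega>) [0..<k]"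
      using assms True by (intro map_cong refl) auto
    also have "\<dots> = replicate k \<omega>" by (simp add: map_replicate_const)
    finally show ?thesis using True by (simp add: wedge_power_def)
  next
    case False
    then obtain a where a: "a < k" "\<sigma> a \<noteq> a"
      using permutes_not_in[OF \<sigma>] by (metis eq_id_iff lessThan_iff)
    then have "M $$ (a, \<sigma> a) = (\<lambda>I J. 0)" using assms[OF a(1) permutes_lessThan[OF \<sigma> a(1)]] by simp
    then have "(\<lambda>I J. 0) \<in> set (map (\<lambda>a. M $$ (a, \<sigma> a)) [0..<k])" using a(1) by (auto intro!: image_eqI[of _ _ a])
    then show ?thesis using False wedge_list_zero by simp
  qed
  then have "form_det k M I J = (\<Sum>\<sigma> | \<sigma> permutes {..<k}. if \<sigma> = id then wedge_power \<omega> k I J else 0)"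
    unfolding form_det_def by (intro sum.cong refl) simp
  then show "form_det k M I J = wedge_power \<omega> k I J" by (simp add: finite_permutations permutes_id)
qed

lemma continuous_on_wedge_list:
  assumes "\<And>a I J. a \<in> set xs \<Longrightarrow> continuous_on S (\<lambda>t. f t a I J)"
  shows "continuous_on S (\<lambda>t. wedge_list (map (f t) xs) I J)"
  using assms
proof (induction xs arbitrary: I J)
  case (Cons a xs)
  then show ?case unfolding wedge_list_def list.map foldr.simps comp_apply wedge_def
    by (intro continuous_intros) (auto simp: wedge_def)
qed (simp add: wedge_list_def)

lemma continuous_on_form_det:
  assumes "\<And>a b I J. a < k \<Longrightarrow> b < k \<Longrightarrow> continuous_on S (\<lambda>t. (M t $$ (a, b)) I J)"
  shows "continuous_on S (\<lambda>t. form_det k (M t) I J)"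
  unfolding form_det_def
  by (intro continuous_intros continuous_on_wedge_list assms) (auto dest: permutes_lessThan)

theorem corollary1p3:
  fixes n k :: nat and M :: "form mat"
  assumes "n \<ge> 4" and "2 \<le> k" and "k \<le> n - 2"
    and "hermitian_form_matrix n k M"
    and "griffiths_positive n k M"
    and "SD_condition n k M"
    and "n - k = 2 \<or> n - k = 3"
  shows "\<forall>\<omega> p q. kahler n \<omega> \<longrightarrow> p + q = n - k \<longrightarrow> hodge_riemann n k p q \<omega> (form_det k M)"
proof (intro allI impI)
  fix \<omega> p q assume \<omega>: "kahler n \<omega>" and pq: "p + q = n - k"
  obtain A B where A: "A \<in> carrier_mat n n" "invertible_mat A"
    and Bj: "\<And>j. j < n \<Longrightarrow> B j \<in> carrier_mat k k \<and> mat_adjoint (B j) = B j"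
    and MB: "\<And>a b. a < k \<Longrightarrow> b < k \<Longrightarrow> M $$ (a, b) = (\<lambda>I J. \<Sum>j<n. B j $$ (a, b) * coord_volume n A j I J)"
    using assms(6) unfolding SD_condition_def by blast
  obtain A' where A': "A * A' = 1\<^sub>m n" "A' * A = 1\<^sub>m (dim_row A')"
    using A unfolding invertible_mat_def inverts_mat_def by auto
  have A'n: "A' \<in> carrier_mat n n"
  proof
    show "dim_col A' = n" using arg_cong[OF A'(1), of dim_col] by simp
    show "dim_row A' = n" using arg_cong[OF A'(2), of dim_col] A(1) by simp
  qed
  have A'A: "A' * A = 1\<^sub>m n" using A'(2) A'n by simp
  define C where "C = (\<lambda>j a b. B j $$ (a, b))"
  have M: "M $$ (a, b) = transform n A (diag_form (singleton_fun (\<lambda>j. if j < n then C j a b else 0)))"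
    if "a < k" "b < k" for a b
    unfolding MB[OF that] transform_singleton_entry[abs_def] coord_volume_eq C_def
    by (intro ext sum.cong refl) (simp add: mult_ac)
  have herm: "C j b a = cnj (C j a b)" if "j < n" "a < k" "b < k" for j a b
  proof -
    have "mat_adjoint (B j) $$ (b, a) = cnj (B j $$ (a, b))"
      using conjunct1[OF Bj[OF that(1)]] that by (auto simp: mat_adjoint_def mat_of_rows_def)
    then show ?thesis using Bj[OF that(1)] unfolding C_def by simp
  qed
  have pd: "pos_def k (C j)" if "j < n" for j
    by (rule griffiths_pos_def[OF A(1) A'n A'(1) herm M assms(5) that])
  define W where "W = transform n A (std_kahler n)"
  have W: "kahler n W" unfolding W_def by (rule kahler_transform_std[OF A(1) A'n A'A])
  \<comment> \<open>Clamped parameters: \<open>s1\<close> grows from \<open>0\<close> to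
    \<open>1\<close> on the first half of the interval while \<open>s2\<close> is \<open>0\<close>,
    and \<open>s2\<close> does so on the second half while \<open>s1\<close> is \<open>1\<close>. A
    single formula for \<open>N\<close> covers both legs, and continuity needs no gluing.\<close>
  define s1 s2 :: "real \<Rightarrow> real" where "s1 = (\<lambda>t. min (2 * t) 1)" and "s2 = (\<lambda>t. max (2 * t - 1) 0)"
  define N where "N = (\<lambda>t. mat k k (\<lambda>(a, b) I J. (1 - of_real (s1 t)) * (M $$ (a, b)) I J
    + of_real (s1 t) * of_bool (a = b) * ((1 - of_real (s2 t)) * W I J + of_real (s2 t) * \<omega> I J)) :: form mat)"
  have Nab: "N t $$ (a, b) = (\<lambda>I J. (1 - of_real (s1 t)) * (M $$ (a, b)) I J
    + of_real (s1 t) * of_bool (a = b) * ((1 - of_real (s2 t)) * W I J + of_real (s2 t) * \<omega> I J))"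
    if "a < k" "b < k" for t a b using that unfolding N_def by simp
  have k: "k > 0" "k + 2 \<le> n" "n \<le> k + 3" using assms(1-3,7) by auto
  have step: "real_form n k (form_det k (N t)) \<and> (\<forall>r\<le>min p q.
      lefschetz n (p - r) (q - r) (wedge (form_det k (N t)) (wedge_power \<omega> (2 * r))))" if t: "t \<in> {0..1}" for t
  proof (cases "t \<le> 1 / 2")
    case True
    then have s: "s2 t = 0" "0 \<le> s1 t" "s1 t \<le> 1" using t unfolding s1_def s2_def by auto
    \<comment> \<open>\<open>W\<close> times the identity has the identity matrix as coefficient at
      every \<open>j\<close>, so on this leg the coefficients are convex combinations of positive
      definite matrices, in the fixed coordinates \<open>A\<close>.\<close>
    define D where "D = (\<lambda>j a b. (1 - of_real (s1 t)) * C j a b + of_real (s1 t) * of_bool (a = b))"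
    have D: "pos_def k (D j)" if "j < n" for j
      unfolding D_def by (rule pos_def_convex[OF pd[OF that] pos_def_id s(2,3)])
    have ND: "N t $$ (a, b) = transform n A (diag_form (singleton_fun (\<lambda>j. if j < n then D j a b else 0)))"
      if "a < k" "b < k" for a b
    proof (intro ext)
      fix I J
      have "(N t $$ (a, b)) I J = (1 - of_real (s1 t)) * (\<Sum>r<n. (\<i> / 2) * (if r < n then C r a b else 0) * covector n A r I * cnj (covector n A r J))
        + of_real (s1 t) * of_bool (a = b) * (\<Sum>r<n. (\<i> / 2) * of_bool (r < n) * covector n A r I * cnj (covector n A r J))"
        unfolding Nab[OF that] M[OF that] W_def std_kahler_def transform_singleton_entry s(1)
        by (simp only: of_real_0 diff_zero mult_1 mult_zero_left add_0_right)
      also have "\<dots> = transform n A (diag_form (singleton_fun (\<lambda>j. if j < n then D j a b else 0))) I J"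
        unfolding transform_singleton_entry sum_distrib_left sum.distrib[symmetric]
        by (intro sum.cong refl) (simp add: D_def field_simps)
      finally show "(N t $$ (a, b)) I J
        = transform n A (diag_form (singleton_fun (\<lambda>j. if j < n then D j a b else 0))) I J" .
    qed
    show ?thesis
      using form_det_lefschetz[where B = D, OF A(1) A'n A'(1) A'A D k ND \<omega> pq] by simp
  next
    case False
    then have s: "s1 t = 1" "0 \<le> s2 t" "s2 t \<le> 1" using t unfolding s1_def s2_def by auto
    \<comment> \<open>On this leg the matrix is a Kaehler form times the identity. The coordinates
      \<open>P\<close> are chosen for each \<open>t\<close> separately; continuity of the path is
      read off the entries of \<open>N t\<close>.\<close>
    obtain P P' where P: "P \<in> carrier_mat n n" "P' \<in> carrier_mat n n" "P * P' = 1\<^sub>m n" "P' * P = 1\<^sub>m n"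
      and eq: "(\<lambda>I J. (1 - of_real (s2 t)) * W I J + of_real (s2 t) * \<omega> I J) = transform n P (std_kahler n)"
      by (rule kahler_standard[OF kahler_convex[OF W \<omega> s(2,3)]]) (rule that)
    have NP: "N t $$ (a, b) = transform n P (diag_form (singleton_fun (\<lambda>j. if j < n then of_bool (a = b) else 0)))"
      if "a < k" "b < k" for a b
    proof -
      have "N t $$ (a, b) = (\<lambda>I J. of_bool (a = b) * transform n P (std_kahler n) I J)"
        unfolding Nab[OF that] eq[symmetric] s(1) by simp
      also have "\<dots> = transform n P (diag_form (singleton_fun (\<lambda>j. if j < n then of_bool (a = b) else 0)))"
        unfolding std_kahler_def transform_singleton_entry[abs_def] by (cases "a = b") simp_all
      finally show ?thesis .
    qed
    show ?thesis
      using form_det_lefschetz[where B = "\<lambda>_. id_mat", OF P pos_def_id k NP \<omega> pq] by simp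
  qed
  have start: "form_det k (N 0) = form_det k M"
    by (rule form_det_cong) (simp add: Nab s1_def)
  have finish: "form_det k (N 1) = wedge_power \<omega> k"
    by (rule form_det_scalar) (simp add: Nab s1_def s2_def)
  have cont: "continuous_on {0..1} (\<lambda>t. form_det k (N t) I J)" for I J
  proof (rule continuous_on_form_det)
    fix a b I J assume ab: "a < k" "b < k"
    show "continuous_on {0..1} (\<lambda>t. (N t $$ (a, b)) I J)"
      unfolding Nab[OF ab] s1_def s2_def by (intro continuous_intros)
  qed
  show "hodge_riemann n k p q \<omega> (form_det k M)"
    unfolding hodge_riemann_def
    by (rule exI[of _ "\<lambda>t. form_det k (N t)"]) (use cont step start finish in blast)
qed

end
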